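(* Let $P=\Delta_1=[0,1]\subseteq\mathbb{R}$ and $\mathbf{a}'=(1)$. For all $k,n\ge1$, the bigraded Frobenius characteristic of $\mathbb{C}[(\Delta_1)^{\times n}]$ is given by \[ \sum_{r\ge0}t^r\sum_{\vec\lambda\vdash_k n}\prod_{i=0}^{k-1}\prod_{j=1}^{\ell(\lambda^i)}[r+1]_{q_{i,j}}\ \frac{\overline{P}_{\vec\lambda}[X]}{Z_{\vec\lambda}}=\frac{\sum_{\vec\lambda\vdash_k n}\sum_{T\in\mathrm{SYT}(\vec\lambda)}t^{\mathrm{wdes}(T)}q^{\mathrm{wcomaj}(T)}\,s_{\vec\lambda}[X]}{(1-t)\prod_{j=1}^n(1-t^kq^{kj})}, \] where $q_{i,j}=u_i\,q^{\lambda^i_j}$ (for the $\vec\lambda$ of the outer sum) and $[N]_y=1+y+\cdots+y^{N-1}$. In particular, for $k=1$, \[ \sum_{i\ge0}t^i\sum_{\lambda\vdash n}s_\lambda\big[[i+1]_q\big]s_\lambda[X]=\frac{\sum_{\lambda\vdash n}\sum_{T\in\mathrm{SYT}(\lambda)}t^{\mathrm{des}(T)}q^{\mathrm{comaj}(T)}s_\lambda[X]}{\prod_{j=0}^n(1-tq^j)}. \]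
   Context: $u_j=e^{2\pi ij/k}$. $\mathbb{C}[(\Delta_1)^{\times n}]$ is the subalgebra of $\mathbb{C}[t,x_1,\dots,x_n]$ spanned by the monomials $t^d\prod_ix_i^{c_i}$ with $0\le c_i\le d$, bigraded by $d$ (variable $t$) and $\sum c_i$ (variable $q$). $\sigma\in Z_k\wr S_n$ ($n\times n$ matrices with one nonzero entry per row and column, entries $k$-th roots of unity; $u(\sigma,i)$ the entry of row $i$, in column $\sigma_i$) acts by fixing $t$, $x_i\mapsto u(\sigma,i)x_{\sigma_i}$, extended multiplicatively and linearly; bigraded character $\chi(\sigma)=\sum_{d,e}\operatorname{tr}(\sigma|_{\text{piece }(d,e)})t^dq^e$. Cycles of $\sigma$ are those of $i\mapsto\sigma_i$, a cycle $(i_1,\dots,i_r)$ being a $C_j$-cycle if $\prod u(\sigma,i_l)=u_j$; $\vec\lambda\vdash_k n$ denotes a $k$-tuple $(\lambda^0,\dots,\lambda^{k-1})$ of partitions of total size $n$; $C_{\vec\lambda}$ is the conjugacy class of elements whose $C_j$-cycle lengths form $\lambda^j$; $Z_{\vec\lambda}=n!k^n/|C_{\vec\lambda}|$. With $k$ alphabets $X^i=x_{i,1}+x_{i,2}+\cdots$ and $p_l(X^i)=\sum_jx_{i,j}^l$: $\overline P_{\vec\lambda}[X]=\prod_{r=0}^{k-1}\prod_l\big(\sum_{j=0}^{k-1}\overline{u_r^{\,j}}p_{\lambda^r_l}(X^j)\big)$, $s_{\vec\lambda}[X]=\prod_is_{\lambda^i}[X^i]$. The Frobenius characteristic of a bigraded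 module with character $\chi$ is $\frac1{n!k^n}\sum_\sigma\chi(\sigma)\overline P_{\vec\lambda(\sigma)}[X]$ (for $k=1$: $\frac1{n!}\sum\chi(\sigma)p_{\lambda(\sigma)}$ in one alphabet $X$); $s_\lambda[[i+1]_q]=s_\lambda(1,q,\dots,q^i)$. $\mathrm{SYT}(\vec\lambda)$: fillings of the cells of $\lambda^0,\dots,\lambda^{k-1}$ (French convention) with $1,\dots,n$, each once, rows increasing left to right and columns increasing bottom to top within each component. Wreath statistics: for $T\in\mathrm{SYT}(\vec\lambda)$, define $a_1,\dots,a_n$: if label $1$ is in $\lambda^r$, $a_1=r$; if label $i$ is in $\lambda^r$ and $i+1$ in $\lambda^s$, then $a_{i+1}=a_i+s-r$ if $i+1$ is strictly to the right of $i$ (meaning $s>r$, or $s=r$ and the column of $i+1$ exceeds the column of $i$), and $a_{i+1}=a_i+k+s-r$ otherwise ($i+1$ weakly left of $i$). Then $\mathrm{wcomaj}(T)=\sum_ia_i$ and $\mathrm{wdes}(T)=\max_ia_i$. For $k=1$ these specialize to $\mathrm{des}(T)$ (number of $i$ with $i+1$ weakly left of $i$) and $\mathrm{comaj}(T)=\sum_{i\text{ such a descent}}(n-i)$, i.e. $\mathrm{des}=\mathrm{wdes}$, $\mathrm{comaj}=\mathrm{wcomaj}$ for $k=1$. *)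

theory Defs
  imports
    "HOL-Library.Poly_Mapping"
    "HOL-Library.FuncSet"
    "HOL-Library.Multiset"
    "HOL-Computational_Algebra.Formal_Power_Series"
    "HOL-Combinatorics.Orbits"
    "Jordan_Normal_Form.Matrix"
    Complex_Main
begin

section \<open>Formal power series in an arbitrary set of variables\<close>

text \<open>
  Symmetric functions in infinitely many variables are formal power series, i.e. arbitrary
  functions from (finitely supported) monomials to coefficients. Every monomial has only
  finitely many factorisations, so the Cauchy product makes sense.
\<close>

typedef (overloaded) ('i, 'a) mfps = "UNIV :: (('i \<Rightarrow>\<^sub>0 nat) \<Rightarrow> 'a) set"
  morphisms mfps_nth Abs_mfps by simp

lemma mfps_nth_Abs [simp]: "mfps_nth (Abs_mfps f) m = f m"
  by (simp add: Abs_mfps_inverse)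

lemma mfps_eqI: "(\<And>m. mfps_nth f m = mfps_nth g m) \<Longrightarrow> f = g"
  by (metis mfps_nth_inject ext)

definition factorisations :: "('i \<Rightarrow>\<^sub>0 nat) \<Rightarrow> (('i \<Rightarrow>\<^sub>0 nat) \<times> ('i \<Rightarrow>\<^sub>0 nat)) set" where
  "factorisations m = {(a, b). a + b = m}"

lemma finite_below: "finite {a :: 'i \<Rightarrow>\<^sub>0 nat. \<exists>b. a + b = m}"
proof -
  let ?B = "PiE (Poly_Mapping.keys m) (\<lambda>i. {..Poly_Mapping.lookup m i})"
  have "finite ?B" by (rule finite_PiE) auto
  moreover have "(\<lambda>a. restrict (Poly_Mapping.lookup a) (Poly_Mapping.keys m)) ` {a. \<exists>b. a + b = m} \<subseteq> ?B"
    by (auto simp: Poly_Mapping.lookup_add)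
  moreover have "inj_on (\<lambda>a. restrict (Poly_Mapping.lookup a) (Poly_Mapping.keys m)) {a. \<exists>b. a + b = m}"
  proof (rule inj_onI, rule poly_mapping_eqI)
    fix a c i
    assume a: "a \<in> {a. \<exists>b. a + b = m}" and c: "c \<in> {a. \<exists>b. a + b = m}"
      and eq: "restrict (Poly_Mapping.lookup a) (Poly_Mapping.keys m) = restrict (Poly_Mapping.lookup c) (Poly_Mapping.keys m)"
    show "Poly_Mapping.lookup a i = Poly_Mapping.lookup c i"
    proof (cases "i \<in> Poly_Mapping.keys m")
      case True
      then show ?thesis using fun_cong[OF eq, of i] by simp
    next
      case False
      then have "Poly_Mapping.lookup m i = 0" by (simp add: in_keys_iff)
      moreover obtain b d where "a + b = m" "c + d = m" using a c by blast
      ultimately show ?thesis by (metis Poly_Mapping.lookup_add add_is_0)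
    qed
  qed
  ultimately show ?thesis by (meson finite_imageD finite_subset)
qed

lemma finite_factorisations [simp]: "finite (factorisations m)"
proof (rule finite_subset)
  show "factorisations m \<subseteq> {a. \<exists>b. a + b = m} \<times> {a. \<exists>b. a + b = m}"
    by (auto simp: factorisations_def) (metis add.commute)
qed (intro finite_cartesian_product finite_below)

instantiation mfps :: (type, comm_ring_1) comm_ring_1
begin

definition "0 = Abs_mfps (\<lambda>_. 0)"
definition "1 = Abs_mfps (\<lambda>m. if m = 0 then 1 else 0)"
definition "f + g = Abs_mfps (\<lambda>m. mfps_nth f m + mfps_nth g m)"
definition "f - g = Abs_mfps (\<lambda>m. mfps_nth f m - mfps_nth g m)"
definition "- f = Abs_mfps (\<lambda>m. - mfps_nth f m)"
definition "f * g = Abs_mfps (\<lambda>m. \<Sum>(a, b)\<in>factorisations m. mfps_nth f a * mfps_nth g b)"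

instance
proof
  fix f g h :: "('a, 'b) mfps"
  show "f + g + h = f + (g + h)" "f + g = g + f" "0 + f = f" "- f + f = 0" "f - g = f + - g"
    by (auto intro!: mfps_eqI simp: plus_mfps_def zero_mfps_def uminus_mfps_def minus_mfps_def)
  show "(f + g) * h = f * h + g * h"
    by (rule mfps_eqI)
      (simp add: plus_mfps_def times_mfps_def sum.distrib[symmetric] case_prod_unfold distrib_right)
  show "f * g = g * f"
  proof (rule mfps_eqI)
    fix m
    have "(\<Sum>(a, b)\<in>factorisations m. mfps_nth f a * mfps_nth g b) =
          (\<Sum>(a, b)\<in>factorisations m. mfps_nth g a * mfps_nth f b)"
      by (rule sum.reindex_bij_witness[of _ prod.swap prod.swap])
        (auto simp: factorisations_def add.commute mult.commute)
    then show "mfps_nth (f * g) m = mfps_nth (g * f) m" by (simp add: times_mfps_def)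
  qed
  show "1 * f = f"
  proof (rule mfps_eqI)
    fix m
    have "(\<Sum>(a, b)\<in>factorisations m. (if a = 0 then 1 else 0) * mfps_nth f b) =
          (\<Sum>(a, b)\<in>{(0 :: 'a \<Rightarrow>\<^sub>0 nat, m)}. (if a = 0 then 1 else 0) * mfps_nth f b)"
      by (rule sum.mono_neutral_right) (use finite_factorisations[of m] in \<open>auto simp: factorisations_def split: if_splits\<close>)
    then show "mfps_nth (1 * f) m = mfps_nth f m" by (simp add: times_mfps_def one_mfps_def)
  qed
  show "f * g * h = f * (g * h)"
  proof (rule mfps_eqI)
    fix m
    have "mfps_nth (f * g * h) m = (\<Sum>(p, c)\<in>factorisations m. \<Sum>(a, b)\<in>factorisations p.
        mfps_nth f a * mfps_nth g b * mfps_nth h c)"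
      by (simp add: times_mfps_def sum_distrib_right case_prod_unfold)
    also have "\<dots> = (\<Sum>((p, c), (a, b))\<in>Sigma (factorisations m) (\<lambda>(p, c). factorisations p).
        mfps_nth f a * mfps_nth g b * mfps_nth h c)"
      by (subst sum.Sigma[symmetric]) (auto simp: case_prod_unfold)
    also have "\<dots> = (\<Sum>((a, p), (b, c))\<in>Sigma (factorisations m) (\<lambda>(a, p). factorisations p).
        mfps_nth f a * (mfps_nth g b * mfps_nth h c))"
      by (rule sum.reindex_bij_witness[of _ "\<lambda>((a, p), (b, c)). ((a + b, c), (a, b))"
            "\<lambda>((p, c), (a, b)). ((a, b + c), (b, c))"])
        (auto simp: factorisations_def add.assoc mult.assoc)
    also have "\<dots> = (\<Sum>(a, p)\<in>factorisations m. \<Sum>(b, c)\<in>factorisations p.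
        mfps_nth f a * (mfps_nth g b * mfps_nth h c))"
      by (subst sum.Sigma[symmetric]) (auto simp: case_prod_unfold)
    also have "\<dots> = mfps_nth (f * (g * h)) m"
      by (simp add: times_mfps_def sum_distrib_left case_prod_unfold)
    finally show "mfps_nth (f * g * h) m = mfps_nth (f * (g * h)) m" .
  qed
  have "mfps_nth (0 :: ('a, 'b) mfps) 0 \<noteq> mfps_nth (1 :: ('a, 'b) mfps) 0"
    by (simp add: zero_mfps_def one_mfps_def)
  then show "(0 :: ('a, 'b) mfps) \<noteq> 1" by metis
qed

end

text \<open>
  Inverses of units, and 0 elsewhere. The division on the library's univariate power series
  refers to the inverse of the lowest coefficient of the denominator.
\<close>

instantiation mfps :: (type, comm_ring_1) inverse
begin

definition "inverse f = (if \<exists>g :: ('a, 'b) mfps. f * g = 1 then THE g. f * g = 1 else 0)"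
definition "f div g = f * inverse (g :: ('a, 'b) mfps)"

instance ..

end

lemma inverse_one_mfps [simp]: "inverse (1 :: ('i, 'a::comm_ring_1) mfps) = 1"
  by (simp add: inverse_mfps_def)

text \<open>The fractions in the theorem have denominators with constant term 1 and are honest quotients.\<close>

lemma fps_divide_mfps:
  fixes f g :: "('i, 'a::comm_ring_1) mfps fps"
  assumes "fps_nth g 0 = 1"
  shows "f / g * g = f"
proof -
  have sub: "subdegree g = 0" using assms by simp
  then have uf: "unit_factor g = g" by simp
  have "g * inverse g = 1"
    unfolding fps_inverse_def by (rule fps_right_inverse) (simp add: assms)
  then have "f * inverse g * g = f"
    by (metis mult.assoc mult.commute mult.right_neutral)
  then show ?thesis by (simp add: fps_divide_def sub uf)
qed

definition mfps_const :: "'a \<Rightarrow> ('i, 'a::comm_ring_1) mfps" where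
  "mfps_const a = Abs_mfps (\<lambda>m. if m = 0 then a else 0)"


section \<open>The trace of an operator on a finite-dimensional subspace\<close>

context vector_space
begin

definition trace_on :: "'b set \<Rightarrow> ('b \<Rightarrow> 'b) \<Rightarrow> 'a" where
  "trace_on W f =
     (let B = (SOME B. B \<subseteq> W \<and> independent B \<and> span B = W)
      in \<Sum>b\<in>B. representation B (f b) b)"

lemma trace_basis_change:
  assumes B: "independent B" "span B = W" "finite B"
    and C: "independent C" "span C = W" "finite C"
    and f: "Vector_Spaces.linear scale scale f" "f ` W \<subseteq> W"
  shows "(\<Sum>b\<in>B. representation B (f b) b) = (\<Sum>c\<in>C. representation C (f c) c)"
proof -
  interpret f: Vector_Spaces.linear scale scale f by fact
  have BW: "b \<in> W" if "b \<in> B" for b using that B(2) span_base by blast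
  have CW: "c \<in> W" if "c \<in> C" for c using that C(2) span_base by blast
  have fW: "f w \<in> W" if "w \<in> W" for w using that f(2) by blast
  have 1: "representation B w b = (\<Sum>c\<in>C. representation C w c * representation B c b)"
    if "w \<in> W" for w b
  proof -
    have "w = (\<Sum>c\<in>C. scale (representation C w c) c)"
      using sum_representation_eq[OF C(1), of w C] that C by simp
    then have "representation B w b = representation B (\<Sum>c\<in>C. scale (representation C w c) c) b"
      by simp
    also have "\<dots> = (\<Sum>c\<in>C. representation B (scale (representation C w c) c) b)"
      by (subst representation_sum) (use B CW in \<open>auto intro!: span_scale\<close>)
    also have "\<dots> = (\<Sum>c\<in>C. representation C w c * representation B c b)"
      by (rule sum.cong[OF refl], subst representation_scale) (use B CW in auto)
    finally show ?thesis .
  qed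
  have 2: "representation C (f c) d = (\<Sum>b\<in>B. representation B c b * representation C (f b) d)"
    if "c \<in> C" for c d
  proof -
    have "c = (\<Sum>b\<in>B. scale (representation B c b) b)"
      using sum_representation_eq[OF B(1), of c B] that B CW by simp
    then have "f c = (\<Sum>b\<in>B. scale (representation B c b) (f b))"
      by (metis (no_types, lifting) f.scale f.sum sum.cong)
    then have "representation C (f c) d = representation C (\<Sum>b\<in>B. scale (representation B c b) (f b)) d"
      by simp
    also have "\<dots> = (\<Sum>b\<in>B. representation C (scale (representation B c b) (f b)) d)"
      by (subst representation_sum) (use C BW fW in \<open>auto intro!: span_scale\<close>)
    also have "\<dots> = (\<Sum>b\<in>B. representation B c b * representation C (f b) d)"
      by (rule sum.cong[OF refl], subst representation_scale) (use C BW fW in auto)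
    finally show ?thesis .
  qed
  have "(\<Sum>b\<in>B. representation B (f b) b) =
        (\<Sum>b\<in>B. \<Sum>c\<in>C. representation C (f b) c * representation B c b)"
    by (rule sum.cong[OF refl], rule 1) (use BW fW in auto)
  also have "\<dots> = (\<Sum>c\<in>C. \<Sum>b\<in>B. representation B c b * representation C (f b) c)"
    by (subst sum.swap) (simp add: mult.commute)
  also have "\<dots> = (\<Sum>c\<in>C. representation C (f c) c)"
    by (rule sum.cong[OF refl], rule 2[symmetric])
  finally show ?thesis .
qed

lemma trace_on_eq:
  assumes B: "independent B" "span B = W" "finite B"
    and f: "Vector_Spaces.linear scale scale f" "f ` W \<subseteq> W"
  shows "local.trace_on W f = (\<Sum>b\<in>B. representation B (f b) b)"
proof -
  let ?P = "\<lambda>C. C \<subseteq> W \<and> independent C \<and> span C = W"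
  define C where "C = (SOME C. ?P C)"
  have "?P B" using B span_superset by blast
  then have C: "?P C" unfolding C_def by (rule someI)
  then have "finite C" using independent_span_bound[OF B(3), of C] B(2) by simp
  then show ?thesis
    using trace_basis_change[OF B, of C f] C f
    unfolding trace_on_def C_def[symmetric] by (simp add: Let_def)
qed

end


section \<open>The algebra \<open>\<complex>[\<Delta>\<^sub>1\<^sup>n]\<close> and its bigraded character\<close>

text \<open>All indices start from 0: the variables \<open>x\<^sub>1, \<dots>, x\<^sub>n\<close> are \<open>X 0, \<dots>, X (n - 1)\<close>.\<close>

datatype pvar = T | X nat

type_synonym mpol = "(pvar \<Rightarrow>\<^sub>0 nat) \<Rightarrow>\<^sub>0 complex"

definition pol_var :: "pvar \<Rightarrow> mpol" where
  "pol_var v = Poly_Mapping.single (Poly_Mapping.single v 1) 1"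

definition pol_scale :: "complex \<Rightarrow> mpol \<Rightarrow> mpol" where
  "pol_scale c p = Poly_Mapping.single 0 c * p"

interpretation mpol: vector_space pol_scale
  by unfold_locales
    (simp_all add: pol_scale_def distrib_left distrib_right single_add mult_single mult.assoc[symmetric])

definition cube_algebra :: "nat \<Rightarrow> mpol set" where
  "cube_algebra n =
     mpol.span {pol_var T ^ d * (\<Prod>i<n. pol_var (X i) ^ c i) | d c. \<forall>i<n. c i \<le> d}"

definition bigraded_piece :: "nat \<Rightarrow> nat \<Rightarrow> nat \<Rightarrow> mpol set" where
  "bigraded_piece n d e =
     {p \<in> cube_algebra n. \<forall>m\<in>Poly_Mapping.keys p.
        Poly_Mapping.lookup m T = d \<and> (\<Sum>i<n. Poly_Mapping.lookup m (X i)) = e}"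

definition wreath :: "nat \<Rightarrow> nat \<Rightarrow> complex mat set" where
  "wreath k n =
     {\<sigma> \<in> carrier_mat n n.
        (\<forall>i<n. \<exists>!j. j < n \<and> \<sigma> $$ (i, j) \<noteq> 0) \<and>
        (\<forall>j<n. \<exists>!i. i < n \<and> \<sigma> $$ (i, j) \<noteq> 0) \<and>
        (\<forall>i<n. \<forall>j<n. \<sigma> $$ (i, j) \<noteq> 0 \<longrightarrow> (\<sigma> $$ (i, j)) ^ k = 1)}"

definition perm_of :: "complex mat \<Rightarrow> nat \<Rightarrow> nat" where
  "perm_of \<sigma> i = (if i < dim_row \<sigma> then THE j. j < dim_col \<sigma> \<and> \<sigma> $$ (i, j) \<noteq> 0 else i)"

definition entry :: "complex mat \<Rightarrow> nat \<Rightarrow> complex" where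
  "entry \<sigma> i = \<sigma> $$ (i, perm_of \<sigma> i)"

text \<open>
  The algebra endomorphism of \<open>\<complex>[t, x\<^sub>1, \<dots>, x\<^sub>n]\<close> with \<open>t \<mapsto> t\<close> and
  \<open>x\<^sub>i \<mapsto> u(\<sigma>, i) x\<^bsub>\<sigma>\<^sub>i\<^esub>\<close>, where \<open>n\<close> is the size of \<open>\<sigma>\<close>. It is only applied to polynomials in
  these variables.
\<close>

definition act :: "complex mat \<Rightarrow> mpol \<Rightarrow> mpol" where
  "act \<sigma> p = (\<Sum>m\<in>Poly_Mapping.keys p.
     pol_scale (Poly_Mapping.lookup p m)
       (pol_var T ^ Poly_Mapping.lookup m T *
        (\<Prod>i<dim_row \<sigma>.
           pol_scale (entry \<sigma> i) (pol_var (X (perm_of \<sigma> i))) ^ Poly_Mapping.lookup m (X i))))"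

text \<open>The outer variable is \<open>t\<close>, the inner one \<open>q\<close>.\<close>

definition cube_character :: "nat \<Rightarrow> complex mat \<Rightarrow> complex fps fps" where
  "cube_character n \<sigma> =
     Abs_fps (\<lambda>d. Abs_fps (\<lambda>e. mpol.trace_on (bigraded_piece n d e) (act \<sigma>)))"


section \<open>Partitions, conjugacy classes and tableaux\<close>

definition partitions :: "nat \<Rightarrow> nat list set" where
  "partitions n = {l. sorted_wrt (\<ge>) l \<and> 0 \<notin> set l \<and> sum_list l = n}"

definition multipartitions :: "nat \<Rightarrow> nat \<Rightarrow> nat list list set" where
  "multipartitions k n =
     {L. length L = k \<and> (\<forall>l\<in>set L. l \<in> partitions (sum_list l)) \<and> sum_list (map sum_list L) = n}"

definition unity_root :: "nat \<Rightarrow> nat \<Rightarrow> complex" where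
  "unity_root k j = exp (2 * of_real pi * \<i> * of_nat j / of_nat k)"

definition cycles_of :: "complex mat \<Rightarrow> nat set set" where
  "cycles_of \<sigma> = {orbit (perm_of \<sigma>) i | i. i < dim_row \<sigma>}"

definition cycle_type :: "nat \<Rightarrow> complex mat \<Rightarrow> nat list list" where
  "cycle_type k \<sigma> =
     map (\<lambda>j. rev (sorted_list_of_multiset
              (image_mset card (mset_set {C \<in> cycles_of \<sigma>. (\<Prod>i\<in>C. entry \<sigma> i) = unity_root k j}))))
       [0..<k]"

definition conj_class :: "nat \<Rightarrow> nat \<Rightarrow> nat list list \<Rightarrow> complex mat set" where
  "conj_class k n L = {\<sigma> \<in> wreath k n. cycle_type k \<sigma> = L}"

definition Zcoeff :: "nat \<Rightarrow> nat \<Rightarrow> nat list list \<Rightarrow> complex" where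
  "Zcoeff k n L = fact n * of_nat k ^ n / of_nat (card (conj_class k n L))"

text \<open>A cell is a pair (row, column); in the French convention rows are counted from the bottom.\<close>

definition cells :: "nat list \<Rightarrow> (nat \<times> nat) set" where
  "cells l = {(r, c). r < length l \<and> c < l ! r}"

definition ssyt :: "nat list \<Rightarrow> (nat \<times> nat \<Rightarrow> nat) set" where
  "ssyt l =
     {S \<in> extensional (cells l).
        (\<forall>r c c'. c < c' \<and> (r, c) \<in> cells l \<and> (r, c') \<in> cells l \<longrightarrow> S (r, c) \<le> S (r, c')) \<and>
        (\<forall>r r' c. r < r' \<and> (r, c) \<in> cells l \<and> (r', c) \<in> cells l \<longrightarrow> S (r, c) < S (r', c))}"

definition mcells :: "nat list list \<Rightarrow> (nat \<times> nat \<times> nat) set" where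
  "mcells L = {(i, r, c). i < length L \<and> (r, c) \<in> cells (L ! i)}"

text \<open>For a single partition \<open>l\<close>, the set SYT(\<open>l\<close>) is \<open>SYT [l]\<close>.\<close>

definition SYT :: "nat list list \<Rightarrow> (nat \<times> nat \<times> nat \<Rightarrow> nat) set" where
  "SYT L =
     {S \<in> extensional (mcells L).
        bij_betw S (mcells L) {1..sum_list (map sum_list L)} \<and>
        (\<forall>i r c c'. c < c' \<and> (i, r, c) \<in> mcells L \<and> (i, r, c') \<in> mcells L
            \<longrightarrow> S (i, r, c) < S (i, r, c')) \<and>
        (\<forall>i r r' c. r < r' \<and> (i, r, c) \<in> mcells L \<and> (i, r', c) \<in> mcells L
            \<longrightarrow> S (i, r, c) < S (i, r', c))}"

definition cell_of :: "nat list list \<Rightarrow> (nat \<times> nat \<times> nat \<Rightarrow> nat) \<Rightarrow> nat \<Rightarrow> nat \<times> nat \<times> nat" where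
  "cell_of L S i = the_inv_into (mcells L) S i"

definition comp_of :: "nat list list \<Rightarrow> (nat \<times> nat \<times> nat \<Rightarrow> nat) \<Rightarrow> nat \<Rightarrow> nat" where
  "comp_of L S i = fst (cell_of L S i)"

definition col_of :: "nat list list \<Rightarrow> (nat \<times> nat \<times> nat \<Rightarrow> nat) \<Rightarrow> nat \<Rightarrow> nat" where
  "col_of L S i = snd (snd (cell_of L S i))"

definition strictly_right ::
    "nat list list \<Rightarrow> (nat \<times> nat \<times> nat \<Rightarrow> nat) \<Rightarrow> nat \<Rightarrow> nat \<Rightarrow> bool" where
  "strictly_right L S j i \<longleftrightarrow>
     comp_of L S i < comp_of L S j \<or>
     comp_of L S j = comp_of L S i \<and> col_of L S i < col_of L S j"

text \<open>
  The subtractions below never truncate: in the first case the component weakly increases, and in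
  the second one every component index is smaller than \<open>k = length L\<close>. The sequence starts at
  index 1; the value at 0 is a dummy.
\<close>

fun wseq :: "nat list list \<Rightarrow> (nat \<times> nat \<times> nat \<Rightarrow> nat) \<Rightarrow> nat \<Rightarrow> nat" where
  "wseq L S 0 = 0"
| "wseq L S (Suc 0) = comp_of L S 1"
| "wseq L S (Suc (Suc i)) =
     (if strictly_right L S (Suc (Suc i)) (Suc i)
      then wseq L S (Suc i) + comp_of L S (Suc (Suc i)) - comp_of L S (Suc i)
      else wseq L S (Suc i) + length L + comp_of L S (Suc (Suc i)) - comp_of L S (Suc i))"

definition wcomaj :: "nat list list \<Rightarrow> (nat \<times> nat \<times> nat \<Rightarrow> nat) \<Rightarrow> nat" where
  "wcomaj L S = (\<Sum>i = 1..sum_list (map sum_list L). wseq L S i)"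

definition wdes :: "nat list list \<Rightarrow> (nat \<times> nat \<times> nat \<Rightarrow> nat) \<Rightarrow> nat" where
  "wdes L S = Max (wseq L S ` {1..sum_list (map sum_list L)})"

definition descents :: "nat list \<Rightarrow> (nat \<times> nat \<times> nat \<Rightarrow> nat) \<Rightarrow> nat set" where
  "descents l S = {i. 1 \<le> i \<and> i < sum_list l \<and> col_of [l] S (i + 1) \<le> col_of [l] S i}"

definition des :: "nat list \<Rightarrow> (nat \<times> nat \<times> nat \<Rightarrow> nat) \<Rightarrow> nat" where
  "des l S = card (descents l S)"

definition comaj :: "nat list \<Rightarrow> (nat \<times> nat \<times> nat \<Rightarrow> nat) \<Rightarrow> nat" where
  "comaj l S = (\<Sum>i\<in>descents l S. sum_list l - i)"


section \<open>Symmetric functions in several alphabets and the Frobenius characteristic\<close>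

text \<open>
  The variable \<open>(i, j)\<close> is the \<open>j\<close>-th variable of the alphabet \<open>X\<^sup>i\<close>, with \<open>j\<close> counted from 0.
  The coefficients are power series in \<open>q\<close>.
\<close>

type_synonym symf = "(nat \<times> nat, complex fps) mfps"

definition power_sum :: "nat \<Rightarrow> nat \<Rightarrow> symf" where
  "power_sum l i = Abs_mfps (\<lambda>m. of_nat (card {j. Poly_Mapping.single (i, j) l = m}))"

definition schur :: "nat list \<Rightarrow> nat \<Rightarrow> symf" where
  "schur l i = Abs_mfps (\<lambda>m. of_nat (card
     {S \<in> ssyt l. (\<Sum>b\<in>cells l. Poly_Mapping.single (i, S b) 1) = m}))"

text \<open>The value \<open>s\<^sub>l(y\<^sub>0, \<dots>, y\<^bsub>N-1\<^esub>)\<close> of a Schur function at finitely many elements of a ring.\<close>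

definition schur_eval :: "nat list \<Rightarrow> nat \<Rightarrow> (nat \<Rightarrow> 'a::comm_ring_1) \<Rightarrow> 'a" where
  "schur_eval l N y = (\<Sum>S\<in>{S \<in> ssyt l. \<forall>b\<in>cells l. S b < N}. \<Prod>b\<in>cells l. y (S b))"

definition schur_multi :: "nat list list \<Rightarrow> symf" where
  "schur_multi L = (\<Prod>i<length L. schur (L ! i) i)"

definition Pbar :: "nat list list \<Rightarrow> symf" where
  "Pbar L = (\<Prod>r<length L. \<Prod>l<length (L ! r). \<Sum>j<length L.
     mfps_const (fps_const (cnj (unity_root (length L) r ^ j))) * power_sum (L ! r ! l) j)"

text \<open>The series whose \<open>t\<^sup>d\<close>-coefficient is the given series in \<open>q\<close>, seen as a scalar.\<close>

definition scalar_series :: "complex fps fps \<Rightarrow> symf fps" where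
  "scalar_series c = Abs_fps (\<lambda>d. mfps_const (fps_nth c d))"

definition frobenius :: "nat \<Rightarrow> nat \<Rightarrow> (complex mat \<Rightarrow> complex fps fps) \<Rightarrow> symf fps" where
  "frobenius k n \<chi> =
     scalar_series (fps_const (fps_const (1 / (fact n * of_nat k ^ n)))) *
     (\<Sum>\<sigma>\<in>wreath k n. scalar_series (\<chi> \<sigma>) * fps_const (Pbar (cycle_type k \<sigma>)))"

definition q_int :: "nat \<Rightarrow> 'a::comm_ring_1 \<Rightarrow> 'a" where
  "q_int N y = (\<Sum>m<N. y ^ m)"

abbreviation tvar :: "symf fps" where
  "tvar \<equiv> fps_X"

abbreviation qvar :: "symf fps" where
  "qvar \<equiv> fps_const (mfps_const fps_X)"

end

theory Submission
  imports Defs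
begin

text \<open>
  Monomials in \<open>x\<^sub>1, \<dots>, x\<^sub>n\<close> of \<open>t\<close>-degree \<open>d\<close> are words with letters in \<open>{0..d}\<close>, and the trace of \<open>\<sigma>\<close> only
  sees the words that are constant on its cycles. The power sums in \<open>Pbar\<close> likewise sum over
  words in the variables \<open>x\<^bsub>j,i\<^esub>\<close> that are constant on the cycles. Averaging over the diagonal
  part of the wreath product keeps only the pairs of words in which the exponent \<open>f\<close> is congruent
  to the alphabet index \<open>j\<close> modulo \<open>k\<close>, and averaging over the permutations turns words into
  multisets. So the coefficient of \<open>t\<^sup>d\<close> is the complete homogeneous symmetric function of
  degree \<open>n\<close> in the products \<open>q\<^sup>f x\<^bsub>j,i\<^esub>\<close> with \<open>f \<le> d\<close> and \<open>f \<equiv> j\<close>. The Cauchy identity, applied to one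
  residue class at a time, expands it in Schur functions, with coefficients
  \<open>\<Prod>\<^sub>j s\<^bsub>\<lambda>\<^sup>j\<^esub>(q\<^sup>j, q\<^bsup>j+k\<^esup>, \<dots>)\<close>. Standardisation writes a tuple of semistandard tableaux with such values as a
  standard one together with a weakly increasing sequence of values, whose least choice is the
  sequence \<open>wseq\<close>; the excess over it is \<open>k\<close> times a partition, which gives the denominator.
\<close>

section \<open>Complete homogeneous symmetric functions and words fixed by a permutation\<close>

text \<open>The symmetric functions have infinitely many variables, so expanding their power sums
  gives sums over infinitely many words. The proof therefore works after setting all but the first
  \<open>N\<close> variables of every alphabet to zero; this is multiplicative, and the results for
  all \<open>N\<close> together determine a power series. The complex conjugate in
  \<open>Pbar\<close> turns the average over the diagonal entries into an orthogonality relation: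
  the action contributes \<open>z ^ f\<close>, the power sums contribute \<open>cnj (z ^ j)\<close>,
  and the mean over the \<open>k\<close>-th roots of unity is 1 or 0. The average over permutations
  is orbit counting for words under rearrangement, and it consumes the factor \<open>n!\<close>. The
  Cauchy identity is reached by removing one variable at a time, with the branching rule for one set
  of variables and the Pieri rule for the other. In the denominator, \<open>1 - t\<close> arises
  because the coefficient of \<open>t ^ r\<close> counts all fillings with values at most
  \<open>r\<close>, while each other factor belongs to one column length \<open>j\<close> of the
  partition of excesses. The first formula of the theorem needs only the trace as a product over
  cycles and the grouping of the wreath product by cycle type.\<close>

definition hsym :: "'i set \<Rightarrow> ('i \<Rightarrow> 'a::comm_ring_1) \<Rightarrow> nat \<Rightarrow> 'a" where
  "hsym A w n = (\<Sum>M | set_mset M \<subseteq> A \<and> size M = n. \<Prod>a\<in>#M. w a)"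

lemma finite_multisets_size:
  assumes "finite A"
  shows "finite {M. set_mset M \<subseteq> A \<and> size M = n}"
proof (rule finite_subset)
  show "{M. set_mset M \<subseteq> A \<and> size M = n} \<subseteq> mset ` {xs. set xs \<subseteq> A \<and> length xs = n}"
  proof
    fix M assume M: "M \<in> {M. set_mset M \<subseteq> A \<and> size M = n}"
    obtain xs where "mset xs = M" using ex_mset by blast
    with M show "M \<in> mset ` {xs. set xs \<subseteq> A \<and> length xs = n}" by auto
  qed
  show "finite (mset ` {xs. set xs \<subseteq> A \<and> length xs = n})"
    using assms by (simp add: finite_lists_length_eq)
qed

lemma hsym_cong:
  assumes "\<And>a. a \<in> A \<Longrightarrow> w a = w' a"
  shows "hsym A w n = hsym A w' n"
  unfolding hsym_def using assms
  by (intro sum.cong refl arg_cong[of _ _ prod_mset] image_mset_cong) auto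

text \<open>A multiset on a disjoint union is determined by its restrictions to the two pieces;
  \<open>i\<close> is the size of the first restriction.\<close>

lemma hsym_Un:
  assumes "finite A" "finite B" "A \<inter> B = {}"
  shows "hsym (A \<union> B) w n = (\<Sum>i=0..n. hsym A w i * hsym B w (n - i))"
proof -
  let ?S = "\<lambda>A n. {M. set_mset M \<subseteq> A \<and> size M = n}"
  have split: "filter_mset (\<lambda>a. a \<in> A) M + filter_mset (\<lambda>a. a \<in> B) M = M"
    if "set_mset M \<subseteq> A \<union> B" for M
  proof -
    have "filter_mset (\<lambda>a. a \<in> B) M = filter_mset (\<lambda>a. a \<notin> A) M"
      by (rule filter_mset_cong) (use that assms(3) in auto)
    then show ?thesis by simp
  qed
  have restr: "filter_mset (\<lambda>a. a \<in> A) (M + N) = M \<and> filter_mset (\<lambda>a. a \<in> B) (M + N) = N"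
    if "set_mset M \<subseteq> A" "set_mset N \<subseteq> B" for M N
  proof -
    have "filter_mset (\<lambda>a. a \<in> A) M = M" "filter_mset (\<lambda>a. a \<in> B) N = N"
      using that by (auto simp: filter_mset_eq_conv)
    moreover have "filter_mset (\<lambda>a. a \<in> A) N = {#}" "filter_mset (\<lambda>a. a \<in> B) M = {#}"
      using that assms(3) by (auto simp: filter_mset_eq_conv)
    ultimately show ?thesis by simp
  qed
  have "hsym (A \<union> B) w n =
      (\<Sum>(i, M, N)\<in>Sigma {0..n} (\<lambda>i. ?S A i \<times> ?S B (n - i)). (\<Prod>a\<in>#M. w a) * (\<Prod>a\<in>#N. w a))"
    unfolding hsym_def
  proof (rule sum.reindex_bij_witness[of _ "\<lambda>(i, M, N). M + N"
        "\<lambda>M. (size (filter_mset (\<lambda>a. a \<in> A) M), filter_mset (\<lambda>a. a \<in> A) M, filter_mset (\<lambda>a. a \<in> B) M)"],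
      goal_cases)
    case (1 M) then show ?case using split by auto
  next
    case (2 M)
    then have *: "size (filter_mset (\<lambda>a. a \<in> A) M) + size (filter_mset (\<lambda>a. a \<in> B) M) = n"
      by (metis (mono_tags, lifting) mem_Collect_eq size_union split)
    then show ?case by auto
  next
    case (3 p) then show ?case using restr by auto
  next
    case (4 p) then show ?case by auto
  next
    case (5 M)
    then have "(\<Prod>a\<in>#M. w a) =
        (\<Prod>a\<in>#filter_mset (\<lambda>a. a \<in> A) M + filter_mset (\<lambda>a. a \<in> B) M. w a)"
      by (simp only: split mem_Collect_eq)
    then show ?case by (simp only: prod.case image_mset_union prod_mset.union)
  qed
  also have "\<dots> = (\<Sum>i=0..n. \<Sum>(M, N)\<in>?S A i \<times> ?S B (n - i). (\<Prod>a\<in>#M. w a) * (\<Prod>a\<in>#N. w a))"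
    by (subst sum.Sigma[symmetric])
      (use assms in \<open>auto intro!: finite_cartesian_product finite_multisets_size\<close>)
  also have "\<dots> = (\<Sum>i=0..n. hsym A w i * hsym B w (n - i))"
    unfolding hsym_def by (simp add: sum_product sum.cartesian_product)
  finally show ?thesis .
qed

lemma hsym_empty:
  fixes w :: "'i \<Rightarrow> 'a::comm_ring_1"
  shows "hsym {} w n = (if n = 0 then 1 else 0)"
proof -
  have "{M. set_mset M \<subseteq> {} \<and> size M = n} = (if n = 0 then {{#} :: 'i multiset} else {})" by auto
  then have "hsym {} w n = (\<Sum>M\<in>(if n = 0 then {{#}} else {}). \<Prod>a\<in>#M. w a)"
    unfolding hsym_def by (rule arg_cong)
  then show ?thesis by auto
qed

lemma hsym_singleton:
  fixes w :: "'i \<Rightarrow> 'a::comm_ring_1"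
  shows "hsym {a} w n = w a ^ n"
proof -
  have "{M. set_mset M \<subseteq> {a} \<and> size M = n} = {replicate_mset n a}"
  proof (rule Set.set_eqI, rule iffI)
    fix M assume "M \<in> {M. set_mset M \<subseteq> {a} \<and> size M = n}"
    then show "M \<in> {replicate_mset n a}" using set_mset_subset_singletonD[of M a] by force
  qed auto
  then show ?thesis by (simp add: hsym_def)
qed

lemma hsym_reindex:
  assumes "inj_on g A"
  shows "hsym (g ` A) w n = hsym A (\<lambda>a. w (g a)) n"
  unfolding hsym_def
proof (rule sum.reindex_bij_witness[of _ "image_mset g" "image_mset (the_inv_into A g)"], goal_cases)
  case (1 M)
  then have "image_mset (\<lambda>x. g (the_inv_into A g x)) M = image_mset (\<lambda>x. x) M"
    by (intro image_mset_cong) (use f_the_inv_into_f[OF assms] in auto)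
  then show ?case by (simp add: multiset.map_comp comp_def)
next
  case (2 M)
  then show ?case using assms by (auto simp: the_inv_into_f_f)
next
  case (3 M)
  then have "image_mset (\<lambda>x. the_inv_into A g (g x)) M = image_mset (\<lambda>x. x) M"
    by (intro image_mset_cong) (use the_inv_into_f_f[OF assms] in auto)
  then show ?case by (simp add: multiset.map_comp comp_def)
next
  case (4 M)
  then show ?case by auto
next
  case (5 M)
  then have "image_mset (\<lambda>x. w (g (the_inv_into A g x))) M = image_mset w M"
    by (intro image_mset_cong) (use f_the_inv_into_f[OF assms] in auto)
  then show ?case by (simp add: multiset.map_comp comp_def)
qed

text \<open>Generating functions turn the convolution of \<open>hsym_Un\<close> into a product,
  which allows several residue classes to be split off at once.\<close>

lemma hsym_UN:
  assumes "finite I" "\<And>i. i \<in> I \<Longrightarrow> finite (A i)" "\<And>i j. i \<in> I \<Longrightarrow> j \<in> I \<Longrightarrow> i \<noteq> j \<Longrightarrow> A i \<inter> A j = {}"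
  shows "Abs_fps (hsym (\<Union>i\<in>I. A i) w) = (\<Prod>i\<in>I. Abs_fps (hsym (A i) w))"
  using assms
proof (induction I rule: finite_induct)
  case empty
  then show ?case by (auto simp: fps_eq_iff hsym_empty)
next
  case (insert i I)
  have "A i \<inter> (\<Union>i\<in>I. A i) = {}" using insert by fastforce
  then have "Abs_fps (hsym (\<Union>i\<in>insert i I. A i) w) = Abs_fps (hsym (A i) w) * Abs_fps (hsym (\<Union>i\<in>I. A i) w)"
    using insert by (auto simp: fps_eq_iff fps_mult_nth hsym_Un)
  then show ?case using insert by auto
qed

text \<open>Orbit counting for the symmetric group acting on the positions of words. The words with
  a given multiset of letters form one orbit, so the sizes of their stabilisers add up to
  \<open>n!\<close>; hence each multiset is counted \<open>n!\<close> times, whatever the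
  multiplicities of its letters.\<close>

lemma sum_fixed_words:
  assumes A: "finite A"
  shows "(\<Sum>\<pi> | \<pi> permutes {..<n}. \<Sum>w | w \<in> {..<n} \<rightarrow>\<^sub>E A \<and> (\<forall>i<n. w (\<pi> i) = w i). \<Prod>i<n. wt (w i)) =
    (of_nat (fact n) :: 'a::comm_ring_1) * hsym A wt n"
proof -
  let ?W = "{..<n} \<rightarrow>\<^sub>E A"
  let ?P = "{\<pi>. \<pi> permutes {..<n}}"
  let ?M = "{M. set_mset M \<subseteq> A \<and> size M = n}"
  define content where "content w = image_mset w (mset_set {..<n})" for w :: "nat \<Rightarrow> 'b"
  have finW: "finite ?W" using A by (simp add: finite_PiE)
  have finP: "finite ?P" by (simp add: finite_permutations)
  have content: "content w \<in> ?M" if "w \<in> ?W" for w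
    using that by (auto simp: content_def PiE_def)
  have stab: "(\<Sum>w | w \<in> ?W \<and> content w = M. \<Sum>\<pi>\<in>?P. of_bool (\<forall>i<n. w (\<pi> i) = w i)) = (of_nat (fact n) :: 'a)"
    if M: "M \<in> ?M" for M
  proof -
    obtain xs where xs: "mset xs = M" using ex_mset by blast
    with M have len: "length xs = n" by auto
    define w0 where "w0 = restrict (nth xs) {..<n}"
    have c0: "content w0 = M"
    proof -
      have "content w0 = image_mset (nth xs) (mset_set {..<n})"
        unfolding content_def w0_def by (intro image_mset_cong) auto
      also have "\<dots> = mset (map (nth xs) [0..<length xs])"
        using len by (simp add: lessThan_atLeast0)
      also have "\<dots> = M" using xs by (simp only: map_nth)
      finally show ?thesis .
    qed
    have w0: "w0 \<in> ?W"
      using M xs len by (auto simp: w0_def)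
    \<comment> \<open>The permutations that fix \<open>w\<close> correspond to those that carry the
      reference word \<open>w0\<close> to \<open>w\<close>, as a stabiliser does to its coset: if
      \<open>w\<close> is \<open>w0 \<circ> \<tau>\<close>, then composition with
      \<open>\<tau>\<close> is the bijection.\<close>
    have transport: "(\<Sum>\<pi>\<in>?P. of_bool (\<forall>i<n. w (\<pi> i) = w i)) =
        (\<Sum>\<pi>\<in>?P. of_bool (\<forall>i<n. w0 (\<pi> i) = w i) :: 'a)"
      if w: "w \<in> ?W" "content w = M" for w
    proof -
      have "image_mset w (mset_set {..<n}) = image_mset w0 (mset_set {..<n})"
        using w c0 by (simp add: content_def)
      then obtain \<tau> where \<tau>: "\<tau> permutes {..<n}" "\<forall>i\<in>{..<n}. w i = w0 (\<tau> i)"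
        by (rule image_mset_eq_implies_permutes[OF finite_lessThan])
      have inv: "Hilbert_Choice.inv \<tau> permutes {..<n}" using \<tau>(1) by (rule permutes_inv)
      show ?thesis
      proof (rule sum.reindex_bij_witness[of _ "\<lambda>\<pi>. Hilbert_Choice.inv \<tau> \<circ> \<pi>" "\<lambda>\<pi>. \<tau> \<circ> \<pi>"], goal_cases)
        case (1 a)
        then show ?case using permutes_inv_o[OF \<tau>(1)] by (simp flip: comp_assoc)
      next
        case (3 a)
        then show ?case using permutes_inv_o[OF \<tau>(1)] by (simp flip: comp_assoc)
      next
        case (5 a)
        then have "a i < n" if "i < n" for i using that permutes_in_image[of a "{..<n}" i] by auto
        then show ?case using \<tau>(2) by auto
      qed (use \<tau>(1) inv permutes_compose in auto)
    qed
    have "(\<Sum>w | w \<in> ?W \<and> content w = M. \<Sum>\<pi>\<in>?P. of_bool (\<forall>i<n. w (\<pi> i) = w i)) =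
        (\<Sum>w | w \<in> ?W \<and> content w = M. \<Sum>\<pi>\<in>?P. of_bool (\<forall>i<n. w0 (\<pi> i) = w i) :: 'a)"
      by (rule sum.cong[OF refl], rule transport) auto
    also have "\<dots> = (\<Sum>\<pi>\<in>?P. \<Sum>w | w \<in> ?W \<and> content w = M. of_bool (\<forall>i<n. w0 (\<pi> i) = w i) :: 'a)"
      by (rule sum.swap)
    \<comment> \<open>After the exchange of sums each \<open>\<pi>\<close> contributes exactly one
      word, namely \<open>w0 \<circ> \<pi>\<close>, and this word has content \<open>M\<close>
      again.\<close>
    also have "\<dots> = (\<Sum>\<pi>\<in>?P. 1)"
    proof (rule sum.cong[OF refl])
      fix \<pi> assume \<pi>: "\<pi> \<in> ?P"
      let ?w = "restrict (w0 \<circ> \<pi>) {..<n}"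
      have in': "\<pi> i < n" if "i < n" for i using \<pi> that permutes_in_image[of \<pi> "{..<n}" i] by auto
      have "content ?w = image_mset (w0 \<circ> \<pi>) (mset_set {..<n})"
        unfolding content_def by (intro image_mset_cong) auto
      also have "\<dots> = image_mset w0 (image_mset \<pi> (mset_set {..<n}))" by (simp add: multiset.map_comp)
      also have "image_mset \<pi> (mset_set {..<n}) = mset_set {..<n}" using \<pi> by (auto intro: permutes_image_mset)
      finally have "content ?w = content w0" unfolding content_def .
      then have "content ?w = M" using c0 by (rule trans)
      moreover have "?w \<in> ?W" using w0 in' by (auto simp: PiE_iff)
      ultimately have eq: "{w. (w \<in> ?W \<and> content w = M) \<and> (\<forall>i<n. w0 (\<pi> i) = w i)} = {?w}"
        by (auto simp: PiE_iff extensional_def fun_eq_iff)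
      have "(\<Sum>w | w \<in> ?W \<and> content w = M. of_bool (\<forall>i<n. w0 (\<pi> i) = w i) :: 'a) =
          (\<Sum>w | (w \<in> ?W \<and> content w = M) \<and> (\<forall>i<n. w0 (\<pi> i) = w i). 1)"
        by (rule sum.mono_neutral_cong_right) (use finW in auto)
      then show "(\<Sum>w | w \<in> ?W \<and> content w = M. of_bool (\<forall>i<n. w0 (\<pi> i) = w i) :: 'a) = 1"
        unfolding eq by simp
    qed
    also have "\<dots> = of_nat (fact n)" by (simp add: card_permutations[of "{..<n}" n])
    finally show ?thesis .
  qed
  have wt: "(\<Prod>i<n. wt (w i)) = (\<Prod>a\<in>#content w. wt a)" for w :: "nat \<Rightarrow> 'b"
    by (simp add: content_def multiset.map_comp comp_def prod_unfold_prod_mset)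
  have "(\<Sum>\<pi>\<in>?P. \<Sum>w | w \<in> ?W \<and> (\<forall>i<n. w (\<pi> i) = w i). \<Prod>i<n. wt (w i)) =
      (\<Sum>\<pi>\<in>?P. \<Sum>w\<in>?W. (\<Prod>i<n. wt (w i)) * of_bool (\<forall>i<n. w (\<pi> i) = w i))"
    by (rule sum.cong[OF refl], rule sum.mono_neutral_cong_left) (use finW in auto)
  also have "\<dots> = (\<Sum>w\<in>?W. (\<Prod>a\<in>#content w. wt a) * (\<Sum>\<pi>\<in>?P. of_bool (\<forall>i<n. w (\<pi> i) = w i)))"
    by (subst sum.swap) (simp add: sum_distrib_left wt)
  also have "\<dots> = (\<Sum>M\<in>?M. \<Sum>w | w \<in> ?W \<and> content w = M.
      (\<Prod>a\<in>#content w. wt a) * (\<Sum>\<pi>\<in>?P. of_bool (\<forall>i<n. w (\<pi> i) = w i)))"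
    by (rule sum.group[symmetric]) (use finW finite_multisets_size[OF A] content in blast)+
  also have "\<dots> = (\<Sum>M\<in>?M. (\<Prod>a\<in>#M. wt a) * of_nat (fact n))"
    by (rule sum.cong[OF refl], subst stab[symmetric]) (auto simp: sum_distrib_left intro!: sum.cong)
  finally show ?thesis by (simp add: hsym_def sum_distrib_left mult.commute)
qed

section \<open>The Cauchy identity\<close>

text \<open>Partitions padded with zeros. Every row index is legal, so interlacing and the
  reflection of rows can be written without a case distinction on lengths.\<close>

definition shape :: "(nat \<Rightarrow> nat) \<Rightarrow> bool" where
  "shape f \<longleftrightarrow> antimono f \<and> (\<exists>K. \<forall>i\<ge>K. f i = 0)"

definition psize :: "(nat \<Rightarrow> nat) \<Rightarrow> nat" where
  "psize f = (\<Sum>i | f i \<noteq> 0. f i)"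

text \<open>Equivalently, \<open>\<nu>\<close> lies inside \<open>f\<close> and the difference of
  the two diagrams is a horizontal strip, with at most one cell in each column.\<close>

definition interlace :: "(nat \<Rightarrow> nat) \<Rightarrow> (nat \<Rightarrow> nat) \<Rightarrow> bool" (infix "\<prec>" 50) where
  "\<nu> \<prec> f \<longleftrightarrow> (\<forall>i. \<nu> i \<le> f i \<and> f (Suc i) \<le> \<nu> i)"

definition diagram :: "(nat \<Rightarrow> nat) \<Rightarrow> (nat \<times> nat) set" where
  "diagram f = {(r, c). c < f r}"

definition shape_ssyt :: "(nat \<Rightarrow> nat) \<Rightarrow> nat \<Rightarrow> (nat \<times> nat \<Rightarrow> nat) set" where
  "shape_ssyt f N = {S \<in> extensional (diagram f).
     (\<forall>r c c'. c < c' \<and> c' < f r \<longrightarrow> S (r, c) \<le> S (r, c')) \<and>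
     (\<forall>r r' c. r < r' \<and> c < f r \<and> c < f r' \<longrightarrow> S (r, c) < S (r', c)) \<and>
     (\<forall>r c. c < f r \<longrightarrow> S (r, c) < N)}"

definition schur_sum :: "(nat \<Rightarrow> nat) \<Rightarrow> nat \<Rightarrow> (nat \<Rightarrow> 'a::comm_ring_1) \<Rightarrow> 'a" where
  "schur_sum f N y = (\<Sum>S\<in>shape_ssyt f N. \<Prod>b\<in>diagram f. y (S b))"

lemma psize_eq:
  assumes "\<And>i. i \<ge> K \<Longrightarrow> f i = 0"
  shows "psize f = (\<Sum>i<K. f i)"
  unfolding psize_def
proof (rule sum.mono_neutral_left)
  show "{i. f i \<noteq> 0} \<subseteq> {..<K}" 
  proof
    fix i assume "i \<in> {i. f i \<noteq> 0}"
    then have "f i \<noteq> 0" by simp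
    with assms[of i] show "i \<in> {..<K}" by (cases "K \<le> i") simp_all
  qed
qed auto

lemma interlaceD:
  assumes "\<nu> \<prec> f" shows "\<nu> i \<le> f i" "f (Suc i) \<le> \<nu> i"
  using assms by (auto simp: interlace_def)

lemma interlace_antimono: "\<nu> \<prec> f \<Longrightarrow> antimono \<nu>" "\<nu> \<prec> f \<Longrightarrow> antimono f"
  unfolding interlace_def by (auto simp: antimono_iff_le_Suc intro: le_trans)

lemma interlace_shape_left:
  assumes "\<nu> \<prec> f" "shape f" shows "shape \<nu>"
proof -
  obtain K where "\<forall>i\<ge>K. f i = 0" using assms by (auto simp: shape_def)
  then have "\<forall>i\<ge>K. \<nu> i = 0" using interlaceD(1)[OF assms(1)] by (metis le_zero_eq)
  then show ?thesis using interlace_antimono[OF assms(1)] by (auto simp: shape_def)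
qed

lemma interlace_shape_right:
  assumes "\<nu> \<prec> f" "shape \<nu>" shows "shape f"
proof -
  obtain K where K: "\<forall>i\<ge>K. \<nu> i = 0" using assms by (auto simp: shape_def)
  have "f i = 0" if "i \<ge> Suc K" for i
    using that interlaceD(2)[OF assms(1), of "i - 1"] K by (cases i) simp_all
  then show ?thesis using interlace_antimono[OF assms(1)] by (auto simp: shape_def)
qed

lemma psize_mono:
  assumes "\<nu> \<prec> f" "shape f" shows "psize \<nu> \<le> psize f"
proof -
  obtain K where K: "\<forall>i\<ge>K. f i = 0" using assms by (auto simp: shape_def)
  then have "\<forall>i\<ge>K. \<nu> i = 0" using interlaceD(1)[OF assms(1)] by (metis le_zero_eq)
  then show ?thesis using K assms(1)
    by (simp add: psize_eq[of K] interlace_def sum_mono)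
qed

lemma finite_below_shape:
  assumes "shape f" shows "finite {\<nu>. \<forall>i. \<nu> i \<le> f i}"
proof -
  obtain K where K: "\<forall>i\<ge>K. f i = 0" using assms by (auto simp: shape_def)
  have "f i \<le> f 0" for i using assms by (auto simp: shape_def antimono_def)
  then have "{\<nu>. \<forall>i. \<nu> i \<le> f i} \<subseteq> {e. \<forall>i. (i \<in> {..<K} \<longrightarrow> e i \<in> {..f 0}) \<and> (i \<notin> {..<K} \<longrightarrow> e i = 0)}"
    using K by (auto intro: le_trans) (metis le_zero_eq not_le)
  then show ?thesis by (rule finite_subset) (rule finite_set_of_finite_funs, auto)
qed

lemma finite_interlace_left: "shape f \<Longrightarrow> finite {\<nu>. \<nu> \<prec> f}"
  by (rule finite_subset[OF _ finite_below_shape]) (auto simp: interlace_def)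

lemma shape_le_psize:
  assumes "shape f" shows "f i \<le> psize f"
proof -
  obtain K where K: "\<forall>i\<ge>K. f i = 0" using assms by (auto simp: shape_def)
  show ?thesis
  proof (cases "i < K")
    case True
    then show ?thesis using K by (simp add: psize_eq[of K] member_le_sum)
  next
    case False
    then show ?thesis using K by simp
  qed
qed

lemma finite_interlace_right:
  assumes "shape \<mu>" shows "finite {f. \<mu> \<prec> f \<and> psize f = s}"
proof -
  \<comment> \<open>Interlacing bounds each row of \<open>f\<close> after the first by the preceding
    row of \<open>\<mu>\<close>, and the size bounds the first row. The maximum with
    \<open>\<mu> 0\<close> only serves to make \<open>g\<close> itself a shape.\<close>
  define g where "g = (\<lambda>i. case i of 0 \<Rightarrow> max s (\<mu> 0) | Suc j \<Rightarrow> \<mu> j)"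
  obtain K where K: "\<forall>i\<ge>K. \<mu> i = 0" using assms by (auto simp: shape_def)
  have "antimono g" using assms
    by (auto simp: g_def antimono_iff_le_Suc shape_def split: nat.splits)
  moreover have "\<forall>i\<ge>Suc K. g i = 0" using K by (auto simp: g_def split: nat.splits)
  ultimately have "shape g" unfolding shape_def by blast
  moreover have "{f. \<mu> \<prec> f \<and> psize f = s} \<subseteq> {\<nu>. \<forall>i. \<nu> i \<le> g i}"
  proof clarify
    fix f i assume f: "\<mu> \<prec> f" and s: "s = psize f"
    show "f i \<le> g i"
    proof (cases i)
      case 0
      then show ?thesis using shape_le_psize[OF interlace_shape_right[OF f assms], of 0] s
        by (simp add: g_def)
    next
      case (Suc j)
      then show ?thesis using f by (simp add: g_def interlace_def)
    qed
  qed
  ultimately show ?thesis using finite_below_shape finite_subset by blast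
qed

lemma finite_diagram: "shape f \<Longrightarrow> finite (diagram f)"
proof -
  assume f: "shape f"
  then obtain K where K: "\<forall>i\<ge>K. f i = 0" by (auto simp: shape_def)
  have "diagram f \<subseteq> {..<K} \<times> {..<psize f}"
    using K shape_le_psize[OF f]
    by (auto simp: diagram_def) (metis not_le not_less_zero, meson order_less_le_trans)
  then show ?thesis by (rule finite_subset) auto
qed

lemma card_diagram:
  assumes "shape f" shows "card (diagram f) = psize f"
proof -
  obtain K where K: "\<forall>i\<ge>K. f i = 0" using assms by (auto simp: shape_def)
  have "diagram f = Sigma {..<K} (\<lambda>r. {..<f r})"
    using K by (auto simp: diagram_def) (metis not_le not_less_zero)
  then show ?thesis using K by (simp add: psize_eq[of K])
qed

lemma finite_shape_ssyt:
  assumes "shape f" shows "finite (shape_ssyt f N)"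
proof (rule finite_subset)
  show "shape_ssyt f N \<subseteq> diagram f \<rightarrow>\<^sub>E {..<N}"
    by (auto simp: shape_ssyt_def PiE_def diagram_def)
  show "finite (diagram f \<rightarrow>\<^sub>E {..<N})"
    using finite_diagram[OF assms] by (simp add: finite_PiE)
qed

lemma shape_zero_iff: "shape f \<Longrightarrow> psize f = 0 \<longleftrightarrow> f = (\<lambda>_. 0)"
  using shape_le_psize[of f] by (auto simp: psize_def)

lemma shape_ssyt_0: "shape_ssyt f 0 = (if f = (\<lambda>_. 0) then {\<lambda>_. undefined} else {})"
proof (cases "f = (\<lambda>_. 0)")
  case True
  then show ?thesis by (auto simp: shape_ssyt_def diagram_def extensional_def)
next
  case False
  then obtain r where "0 < f r" by auto
  then show ?thesis using False by (auto simp: shape_ssyt_def)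
qed

lemma schur_sum_0: "schur_sum f 0 y = (if f = (\<lambda>_. 0) then 1 else 0)"
  by (auto simp: schur_sum_def shape_ssyt_0 diagram_def)

text \<open>Branching rule. The cells with the largest entry \<open>N\<close> form a horizontal
  strip because columns increase strictly; deleting them leaves a tableau with entries below
  \<open>N\<close> on a shape that interlaces with \<open>f\<close>.\<close>

lemma schur_sum_Suc:
  assumes f: "shape f"
  shows "schur_sum f (Suc N) y = (\<Sum>\<nu> | \<nu> \<prec> f. y N ^ (psize f - psize \<nu>) * schur_sum \<nu> N y)"
proof -
  \<comment> \<open>\<open>inner S\<close> gives the row lengths of the part with entries below
    \<open>N\<close>; \<open>ext\<close> puts the entry \<open>N\<close> back into the cells of the
    strip.\<close>
  define inner where "inner S = (\<lambda>r. card {c. c < f r \<and> S (r, c) < N})" for S :: "nat \<times> nat \<Rightarrow> nat"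
  define ext where "ext \<nu> S = (\<lambda>b. if b \<in> diagram \<nu> then S b else if b \<in> diagram f then N else undefined)"
    for \<nu> and S :: "nat \<times> nat \<Rightarrow> nat"
  have inner_iff: "c < inner S r \<longleftrightarrow> c < f r \<and> S (r, c) < N" if S: "S \<in> shape_ssyt f (Suc N)" for S r c
  proof -
    let ?C = "{c. c < f r \<and> S (r, c) < N}"
    have down: "c \<in> ?C" if "c' \<in> ?C" "c < c'" for c c'
      using S that by (auto simp: shape_ssyt_def) (meson order_le_less_trans)
    have fin: "finite ?C" by simp
    show ?thesis
    proof
      assume "c < inner S r"
      then have "\<not> ?C \<subseteq> {..<c}" using card_mono[of "{..<c}" ?C] by (auto simp: inner_def)
      then obtain c' where "c' \<in> ?C" "c \<le> c'" by (auto simp: subset_eq not_less)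
      then have "c \<in> ?C" using down[of c' c] by (cases "c = c'") auto
      then show "c < f r \<and> S (r, c) < N" by simp
    next
      assume "c < f r \<and> S (r, c) < N"
      then have "d \<in> ?C" if "d \<le> c" for d using down[of c d] that by (cases "d = c") auto
      then have "{..c} \<subseteq> ?C" by (simp add: subset_eq)
      then have "card {..c} \<le> card ?C" by (rule card_mono[OF fin])
      then show "c < inner S r" by (simp add: inner_def)
    qed
  qed
  have outer: "S b = N"
    if S: "S \<in> shape_ssyt f (Suc N)" and b: "b \<in> diagram f" "b \<notin> diagram (inner S)" for S b
  proof (cases b)
    case (Pair r c)
    have "S (r, c) < Suc N" using S b Pair by (auto simp: shape_ssyt_def diagram_def)
    moreover have "\<not> S (r, c) < N" using inner_iff[OF S] b Pair by (auto simp: diagram_def)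
    ultimately show ?thesis using Pair by simp
  qed
  have cells_sub: "diagram \<nu> \<subseteq> diagram f" if "\<nu> \<prec> f" for \<nu>
    using that by (auto simp: diagram_def interlace_def intro: less_le_trans)
  \<comment> \<open>A cell of \<open>f\<close> with another cell of \<open>f\<close> higher in its
    column cannot belong to the horizontal strip. This keeps the columns strict when the strip is
    filled with \<open>N\<close>.\<close>
  have gap: "c < \<nu> r" if "\<nu> \<prec> f" "c < f r'" "r < r'" for \<nu> c r r'
  proof -
    have "f r' \<le> f (Suc r)" using that f by (auto simp: shape_def antimono_def)
    then show ?thesis using that by (meson interlace_def order_less_le_trans)
  qed
  have "schur_sum f (Suc N) y = (\<Sum>(\<nu>, S)\<in>Sigma {\<nu>. \<nu> \<prec> f} (\<lambda>\<nu>. shape_ssyt \<nu> N).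
      y N ^ (psize f - psize \<nu>) * (\<Prod>b\<in>diagram \<nu>. y (S b)))"
    unfolding schur_sum_def
  proof (rule sum.reindex_bij_witness[of _ "\<lambda>(\<nu>, S). ext \<nu> S" "\<lambda>S. (inner S, restrict S (diagram (inner S)))"],
      goal_cases)
    case (1 S)
    have "restrict S (diagram (inner S)) b = S b" if "b \<in> diagram (inner S)" for b using that by simp
    moreover have "S b = N" if "b \<in> diagram f" "b \<notin> diagram (inner S)" for b
      using outer 1 that by simp
    moreover have "S b = undefined" if "b \<notin> diagram f" for b
      by (rule extensional_arb[OF _ that]) (use 1 in \<open>simp add: shape_ssyt_def\<close>)
    ultimately show ?case by (auto simp: ext_def fun_eq_iff)
  next
    case (2 S)
    have "inner S i \<le> f i" for i
      using inner_iff[OF 2, of "f i" i] by (simp add: not_less[symmetric])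
    moreover have "f (Suc i) \<le> inner S i" for i
    proof (rule ccontr)
      assume "\<not> ?thesis"
      then have lt: "inner S i < f (Suc i)" by simp
      also have "\<dots> \<le> f i" using f by (auto simp: shape_def antimono_def)
      finally have lt': "inner S i < f i" .
      then have "S (i, inner S i) < S (Suc i, inner S i)" "S (Suc i, inner S i) < Suc N"
        using 2 lt by (auto simp: shape_ssyt_def)
      then have "S (i, inner S i) < N" by simp
      then have "inner S i < inner S i" using inner_iff[OF 2, of "inner S i" i] lt' by simp
      then show False by simp
    qed
    ultimately have "inner S \<prec> f" by (simp add: interlace_def)
    moreover have "restrict S (diagram (inner S)) \<in> shape_ssyt (inner S) N"
    proof -
      have "S (r, c) \<le> S (r, c')" if "c < c'" "c' < inner S r" for r c c'
        using 2 that inner_iff[OF 2, of c' r] by (auto simp: shape_ssyt_def)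
      moreover have "S (r, c) < S (r', c)" if "r < r'" "c < inner S r" "c < inner S r'" for r r' c
        using 2 that inner_iff[OF 2, of c r] inner_iff[OF 2, of c r'] by (auto simp: shape_ssyt_def)
      moreover have "S (r, c) < N" if "c < inner S r" for r c
        using that inner_iff[OF 2] by simp
      ultimately show ?thesis by (simp add: shape_ssyt_def diagram_def)
    qed
    ultimately show ?case by simp
  next
    case (3 p)
    then obtain \<nu> S where p: "p = (\<nu>, S)" and \<nu>: "\<nu> \<prec> f" and S: "S \<in> shape_ssyt \<nu> N" by auto
    have "{c. c < f r \<and> ext \<nu> S (r, c) < N} = {..<\<nu> r}" for r
      using S \<nu> by (auto simp: ext_def diagram_def shape_ssyt_def interlace_def split: if_splits intro: less_le_trans)
    then have "inner (ext \<nu> S) = \<nu>" by (simp add: inner_def)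
    moreover have "restrict (ext \<nu> S) (diagram \<nu>) = S"
      using S by (auto simp: ext_def shape_ssyt_def extensional_def)
    ultimately show ?case by (simp add: p)
  next
    case (4 p)
    then obtain \<nu> S where p: "p = (\<nu>, S)" and \<nu>: "\<nu> \<prec> f" and S: "S \<in> shape_ssyt \<nu> N" by auto
    have le: "S (r, c) \<le> N" if "c < \<nu> r" for r c
      using S that by (auto simp: shape_ssyt_def less_imp_le)
    have "ext \<nu> S (r, c) \<le> ext \<nu> S (r, c')" if "c < c'" "c' < f r" for r c c'
      using S that le[of c r] by (auto simp: ext_def diagram_def shape_ssyt_def)
    moreover have "ext \<nu> S (r, c) < ext \<nu> S (r', c)" if "r < r'" "c < f r" "c < f r'" for r r' c
      using S that gap[OF \<nu> that(3,1)] by (auto simp: ext_def diagram_def shape_ssyt_def)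
    moreover have "ext \<nu> S (r, c) < Suc N" if "c < f r" for r c
      using S that le by (auto simp: ext_def diagram_def shape_ssyt_def le_imp_less_Suc)
    moreover have "ext \<nu> S \<in> extensional (diagram f)"
      using cells_sub[OF \<nu>] by (auto simp: ext_def extensional_def)
    ultimately show ?case by (auto simp: p shape_ssyt_def)
  next
    case (5 S)
    let ?\<nu> = "inner S"
    have sub: "diagram ?\<nu> \<subseteq> diagram f"
      using inner_iff[OF 5] by (auto simp: diagram_def)
    have fin: "finite (diagram f)" by (rule finite_diagram[OF f])
    have out: "S b = N" if "b \<in> diagram f - diagram ?\<nu>" for b
      using outer 5 that by simp
    have le: "?\<nu> i \<le> f i" for i
      using inner_iff[OF 5, of "f i" i] by (simp add: not_less[symmetric])
    have anti: "antimono ?\<nu>"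
      unfolding antimono_iff_le_Suc
    proof
      fix n
      have "c < ?\<nu> n" if "c < ?\<nu> (Suc n)" for c
      proof -
        have c: "c < f (Suc n)" "S (Suc n, c) < N" using that inner_iff[OF 5] by auto
        moreover have "f (Suc n) \<le> f n" using f by (auto simp: shape_def antimono_def)
        moreover from calculation have "S (n, c) < S (Suc n, c)" using 5 by (auto simp: shape_ssyt_def)
        ultimately show ?thesis using inner_iff[OF 5] by auto
      qed
      then show "?\<nu> (Suc n) \<le> ?\<nu> n" by (metis not_le order_less_irrefl)
    qed
    obtain K where K: "\<forall>i\<ge>K. f i = 0" using f by (auto simp: shape_def)
    have "?\<nu> i = 0" if "i \<ge> K" for i using le[of i] K that by simp
    with anti have sh: "shape ?\<nu>" by (auto simp: shape_def)
    have "(\<Prod>b\<in>diagram f. y (S b)) = (\<Prod>b\<in>diagram f - diagram ?\<nu>. y (S b)) * (\<Prod>b\<in>diagram ?\<nu>. y (S b))"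
      by (rule prod.subset_diff[OF sub fin])
    also have "(\<Prod>b\<in>diagram f - diagram ?\<nu>. y (S b)) = (\<Prod>b\<in>diagram f - diagram ?\<nu>. y N)"
      by (rule prod.cong[OF refl]) (simp add: out)
    also have "\<dots> = y N ^ (psize f - psize ?\<nu>)"
      using sub fin f sh by (simp add: card_Diff_subset finite_subset card_diagram)
    finally show ?case by simp
  qed
  also have "\<dots> = (\<Sum>\<nu> | \<nu> \<prec> f. \<Sum>S\<in>shape_ssyt \<nu> N. y N ^ (psize f - psize \<nu>) * (\<Prod>b\<in>diagram \<nu>. y (S b)))"
    by (rule sum.Sigma[symmetric])
      (use finite_interlace_left[OF f] finite_shape_ssyt interlace_shape_left[OF _ f] in auto)
  also have "\<dots> = (\<Sum>\<nu> | \<nu> \<prec> f. y N ^ (psize f - psize \<nu>) * schur_sum \<nu> N y)"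
    by (simp add: schur_sum_def sum_distrib_left)
  finally show ?thesis .
qed

lemma hsym_scale: "hsym A (\<lambda>a. c * w a) n = c ^ n * hsym A w n"
proof -
  have "(\<Prod>a\<in>#M. c * w a) = c ^ size M * (\<Prod>a\<in>#M. w a)" for M
    by (induction M) (simp_all add: mult_ac)
  then show ?thesis by (simp add: hsym_def sum_distrib_left)
qed

text \<open>
  The local rule: at a fixed \<open>\<mu>\<close> and \<open>\<nu>\<close>, reflecting every part of \<open>f\<close> but the first one in the interval
  that interlacing allows for it turns a common upper neighbour into a common lower one.
\<close>

lemma interlace_toggle_size:
  assumes sh: "shape \<mu>" "shape \<nu>" "shape f" "shape \<rho>"
    and 0: "f 0 = m + max (\<mu> 0) (\<nu> 0)"
    and Suc: "\<And>i. f (Suc i) + \<rho> i = min (\<mu> i) (\<nu> i) + max (\<mu> (Suc i)) (\<nu> (Suc i))"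
  shows "psize f + psize \<rho> = m + psize \<mu> + psize \<nu>"
proof -
  obtain K1 where K1: "\<forall>i\<ge>K1. \<mu> i = 0" using sh(1) by (auto simp: shape_def)
  obtain K2 where K2: "\<forall>i\<ge>K2. \<nu> i = 0" using sh(2) by (auto simp: shape_def)
  obtain K3 where K3: "\<forall>i\<ge>K3. f i = 0" using sh(3) by (auto simp: shape_def)
  obtain K4 where K4: "\<forall>i\<ge>K4. \<rho> i = 0" using sh(4) by (auto simp: shape_def)
  define K where "K = K1 + K2 + K3 + K4"
  have z: "\<mu> i = 0" "\<nu> i = 0" "f i = 0" "\<rho> i = 0" if "i \<ge> K" for i
    using K1 K2 K3 K4 that by (auto simp: K_def)
  have "psize f + psize \<rho> = (\<Sum>i<Suc K. f i) + (\<Sum>i<K. \<rho> i)"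
    using z by (simp add: psize_eq[of "Suc K" f] psize_eq[of K \<rho>])
  also have "\<dots> = f 0 + (\<Sum>i<K. f (Suc i) + \<rho> i)"
    by (simp add: sum.lessThan_Suc_shift sum.distrib del: sum.lessThan_Suc)
  also have "\<dots> = m + ((\<Sum>i<K. min (\<mu> i) (\<nu> i)) + (max (\<mu> 0) (\<nu> 0) + (\<Sum>i<K. max (\<mu> (Suc i)) (\<nu> (Suc i)))))"
    by (simp add: 0 Suc sum.distrib)
  also have "max (\<mu> 0) (\<nu> 0) + (\<Sum>i<K. max (\<mu> (Suc i)) (\<nu> (Suc i))) = (\<Sum>i<Suc K. max (\<mu> i) (\<nu> i))"
    by (simp add: sum.lessThan_Suc_shift del: sum.lessThan_Suc)
  also have "\<dots> = (\<Sum>i<K. max (\<mu> i) (\<nu> i))" using z[of K] by simp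
  also have "m + ((\<Sum>i<K. min (\<mu> i) (\<nu> i)) + \<dots>) = m + (\<Sum>i<K. min (\<mu> i) (\<nu> i) + max (\<mu> i) (\<nu> i))"
    by (simp add: sum.distrib)
  also have "(\<Sum>i<K. min (\<mu> i) (\<nu> i) + max (\<mu> i) (\<nu> i)) = (\<Sum>i<K. \<mu> i + \<nu> i)"
    by (rule sum.cong[OF refl]) (simp add: min_def max_def)
  finally show ?thesis using z by (simp add: psize_eq[of K \<mu>] psize_eq[of K \<nu>] sum.distrib)
qed

text \<open>Pieri rule, by induction on the number of variables. Branching splits \<open>y N\<close>
  off each \<open>schur_sum f (Suc N) y\<close>; the local rule then trades the pair of
  \<open>f\<close> and \<open>\<nu>\<close> for a number \<open>m\<close> and a shape
  \<open>\<rho>\<close> below both \<open>\<mu>\<close> and \<open>\<nu>\<close>. The sum over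
  \<open>\<nu>\<close> is the induction hypothesis at \<open>\<rho>\<close>, the sum over
  \<open>\<rho>\<close> is the branching of \<open>\<mu>\<close>, and \<open>m\<close> counts the
  copies of \<open>y N\<close> in a monomial of the complete homogeneous factor.\<close>

lemma schur_sum_pieri:
  fixes y :: "nat \<Rightarrow> 'a::comm_ring_1"
  assumes "shape \<mu>"
  shows "hsym {..<N} y b * schur_sum \<mu> N y =
    (\<Sum>f | \<mu> \<prec> f \<and> psize f = psize \<mu> + b. schur_sum f N y)"
  using assms
proof (induction N arbitrary: b \<mu>)
  case 0
  have "{f. \<mu> \<prec> f \<and> psize f = psize \<mu> + b \<and> f = (\<lambda>_. 0)} =
      (if b = 0 \<and> \<mu> = (\<lambda>_. 0) then {\<lambda>_. 0} else {})"
    by (auto simp: interlace_def psize_def)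
  moreover have "(\<Sum>f | \<mu> \<prec> f \<and> psize f = psize \<mu> + b. schur_sum f 0 y) =
      (\<Sum>f | \<mu> \<prec> f \<and> psize f = psize \<mu> + b \<and> f = (\<lambda>_. 0). 1)"
    by (rule sum.mono_neutral_cong_right) (use finite_interlace_right[OF 0] in \<open>auto simp: schur_sum_0\<close>)
  ultimately show ?case by (simp add: hsym_empty schur_sum_0)
next
  case (Suc N)
  note \<mu> = \<open>shape \<mu>\<close>
  \<comment> \<open>Interlacing puts no upper bound on the first row of \<open>f\<close>, so that
    row cannot be reflected; its surplus over the least admissible length is recorded
    instead.\<close>
  let ?m = "\<lambda>f \<nu>. f 0 - max (\<mu> 0) (\<nu> 0) :: nat"
  let ?up = "{f. \<mu> \<prec> f \<and> psize f = psize \<mu> + b}"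
  let ?low = "Sigma {..b} (\<lambda>m. Sigma {\<rho>. \<rho> \<prec> \<mu>} (\<lambda>\<rho>. {\<nu>. \<rho> \<prec> \<nu> \<and> psize \<nu> = psize \<rho> + (b - m)}))"
  \<comment> \<open>The interval for row \<open>Suc i\<close> runs from
    \<open>max (\<mu> (Suc i)) (\<nu> (Suc i))\<close> to \<open>min (\<mu> i) (\<nu> i)\<close>.
    The reflected value becomes row \<open>i\<close>, and \<open>upper\<close> reverses this with
    the surplus \<open>m\<close> as additional input.\<close>
  define lower where "lower = (\<lambda>f \<nu> i. min (\<mu> i) (\<nu> i) + max (\<mu> (Suc i)) (\<nu> (Suc i)) - f (Suc i))"
  define upper where "upper = (\<lambda>m \<rho> \<nu> i. case i of 0 \<Rightarrow> m + max (\<mu> 0) (\<nu> 0)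
      | Suc i \<Rightarrow> min (\<mu> i) (\<nu> i) + max (\<mu> (Suc i)) (\<nu> (Suc i)) - \<rho> i)"
  have up: "lower f \<nu> \<prec> \<mu> \<and> lower f \<nu> \<prec> \<nu> \<and> ?m f \<nu> \<le> b \<and>
      psize \<nu> = psize (lower f \<nu>) + (b - (?m f \<nu>)) \<and>
      upper (?m f \<nu>) (lower f \<nu>) \<nu> = f \<and>
      psize f - psize \<nu> = (?m f \<nu>) + (psize \<mu> - psize (lower f \<nu>))"
    if "\<mu> \<prec> f" "psize f = psize \<mu> + b" "\<nu> \<prec> f" for f \<nu>
  proof -
    note I = interlaceD[OF that(1)] interlaceD[OF that(3)]
    have sum: "f (Suc i) + lower f \<nu> i = min (\<mu> i) (\<nu> i) + max (\<mu> (Suc i)) (\<nu> (Suc i))" for i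
      using I(1)[of "Suc i"] I(2)[of i] I(3)[of "Suc i"] I(4)[of i] by (simp add: lower_def)
    have "lower f \<nu> i \<le> min (\<mu> i) (\<nu> i) \<and> max (\<mu> (Suc i)) (\<nu> (Suc i)) \<le> lower f \<nu> i" for i
      using sum[of i] I(1)[of "Suc i"] I(2)[of i] I(3)[of "Suc i"] I(4)[of i] by linarith
    then have a: "lower f \<nu> \<prec> \<mu>" "lower f \<nu> \<prec> \<nu>"
      by (simp_all add: interlace_def)
    have 0: "f 0 = (?m f \<nu>) + max (\<mu> 0) (\<nu> 0)"
      using I(1)[of 0] I(3)[of 0] by simp
    have sh: "shape f" "shape \<nu>" "shape (lower f \<nu>)"
      using interlace_shape_right[OF that(1) \<mu>] interlace_shape_left[OF that(3)] interlace_shape_left[OF a(1) \<mu>]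
      by auto
    have size: "psize f + psize (lower f \<nu>) = (?m f \<nu>) + psize \<mu> + psize \<nu>"
      by (rule interlace_toggle_size[OF \<mu> sh(2,1,3) 0 sum])
    have mono: "psize (lower f \<nu>) \<le> psize \<mu>" "psize (lower f \<nu>) \<le> psize \<nu>"
      using psize_mono[OF a(1) \<mu>] psize_mono[OF a(2) sh(2)] by auto
    have "upper (?m f \<nu>) (lower f \<nu>) \<nu> i = f i" for i
      using 0 sum[of "i - 1"] by (cases i) (simp_all add: upper_def)
    then show ?thesis using a size mono that(2) by auto
  qed
  have low: "\<mu> \<prec> upper m \<rho> \<nu> \<and> \<nu> \<prec> upper m \<rho> \<nu> \<and> psize (upper m \<rho> \<nu>) = psize \<mu> + b \<and>
      upper m \<rho> \<nu> 0 - max (\<mu> 0) (\<nu> 0) = m \<and> lower (upper m \<rho> \<nu>) \<nu> = \<rho>"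
    if "\<rho> \<prec> \<mu>" "\<rho> \<prec> \<nu>" "psize \<nu> = psize \<rho> + (b - m)" "m \<le> b" for m \<rho> \<nu>
  proof -
    note I = interlaceD[OF that(1)] interlaceD[OF that(2)]
    have sum: "upper m \<rho> \<nu> (Suc i) + \<rho> i = min (\<mu> i) (\<nu> i) + max (\<mu> (Suc i)) (\<nu> (Suc i))" for i
      using I(1)[of i] I(2)[of i] I(3)[of i] I(4)[of i] by (simp add: upper_def)
    have 0: "upper m \<rho> \<nu> 0 = m + max (\<mu> 0) (\<nu> 0)" by (simp add: upper_def)
    have "upper m \<rho> \<nu> (Suc i) \<le> min (\<mu> i) (\<nu> i) \<and> max (\<mu> (Suc i)) (\<nu> (Suc i)) \<le> upper m \<rho> \<nu> (Suc i)" for i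
      using sum[of i] I(1)[of i] I(2)[of i] I(3)[of i] I(4)[of i] by linarith
    moreover have "max (\<mu> i) (\<nu> i) \<le> upper m \<rho> \<nu> i" for i
      using calculation[of "i - 1"] 0 by (cases i) auto
    ultimately have a: "\<mu> \<prec> upper m \<rho> \<nu>" "\<nu> \<prec> upper m \<rho> \<nu>"
      by (simp_all add: interlace_def)
    have sh: "shape (upper m \<rho> \<nu>)" "shape \<rho>" "shape \<nu>"
      using interlace_shape_right[OF a(1) \<mu>] interlace_shape_left[OF that(1) \<mu>]
        interlace_shape_right[OF that(2)] by auto
    have size: "psize (upper m \<rho> \<nu>) + psize \<rho> = m + psize \<mu> + psize \<nu>"
      by (rule interlace_toggle_size[OF \<mu> sh(3,1,2) 0 sum])
    have "lower (upper m \<rho> \<nu>) \<nu> i = \<rho> i" for i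
      using sum[of i] by (simp add: lower_def)
    then show ?thesis using a size that(3,4) 0 by auto
  qed
  have shape_low: "shape \<rho>" if "\<rho> \<prec> \<mu>" for \<rho> using interlace_shape_left[OF that \<mu>] .
  have shape_up: "shape f" if "\<mu> \<prec> f" for f using interlace_shape_right[OF that \<mu>] .
  have "(\<Sum>f\<in>?up. schur_sum f (Suc N) y) =
      (\<Sum>f\<in>?up. \<Sum>\<nu> | \<nu> \<prec> f. y N ^ (psize f - psize \<nu>) * schur_sum \<nu> N y)"
    by (rule sum.cong[OF refl], rule schur_sum_Suc) (use shape_up in auto)
  also have "\<dots> = (\<Sum>(f, \<nu>)\<in>Sigma ?up (\<lambda>f. {\<nu>. \<nu> \<prec> f}). y N ^ (psize f - psize \<nu>) * schur_sum \<nu> N y)"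
    by (rule sum.Sigma) (use finite_interlace_right[OF \<mu>] finite_interlace_left shape_up in auto)
  also have "\<dots> = (\<Sum>(m, \<rho>, \<nu>)\<in>?low. y N ^ (m + (psize \<mu> - psize \<rho>)) * schur_sum \<nu> N y)"
  proof (rule sum.reindex_bij_witness[of _ "\<lambda>(m, \<rho>, \<nu>). (upper m \<rho> \<nu>, \<nu>)"
        "\<lambda>(f, \<nu>). (?m f \<nu>, lower f \<nu>, \<nu>)"], goal_cases)
    case (1 p)
    then obtain f \<nu> where p: "p = (f, \<nu>)" "\<mu> \<prec> f" "psize f = psize \<mu> + b" "\<nu> \<prec> f" by auto
    show ?case using up[OF p(2-4)] by (simp add: p)
  next
    case (2 p)
    then obtain f \<nu> where p: "p = (f, \<nu>)" "\<mu> \<prec> f" "psize f = psize \<mu> + b" "\<nu> \<prec> f" by auto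
    show ?case using up[OF p(2-4)] by (simp add: p)
  next
    case (3 p)
    then obtain m \<rho> \<nu> where p: "p = (m, \<rho>, \<nu>)" "\<rho> \<prec> \<mu>" "\<rho> \<prec> \<nu>" "psize \<nu> = psize \<rho> + (b - m)" "m \<le> b"
      by (cases p) auto
    show ?case using low[OF p(2-5)] by (simp add: p)
  next
    case (4 p)
    then obtain m \<rho> \<nu> where p: "p = (m, \<rho>, \<nu>)" "\<rho> \<prec> \<mu>" "\<rho> \<prec> \<nu>" "psize \<nu> = psize \<rho> + (b - m)" "m \<le> b"
      by (cases p) auto
    show ?case using low[OF p(2-5)] by (simp add: p)
  next
    case (5 p)
    then obtain f \<nu> where p: "p = (f, \<nu>)" "\<mu> \<prec> f" "psize f = psize \<mu> + b" "\<nu> \<prec> f" by auto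
    have "psize f - psize \<nu> = (?m f \<nu>) + (psize \<mu> - psize (lower f \<nu>))"
      using up[OF p(2-4)] by (elim conjE)
    then show ?case by (simp only: p(1) prod.case)
  qed
  also have "\<dots> = (\<Sum>m\<le>b. \<Sum>(\<rho>, \<nu>)\<in>Sigma {\<rho>. \<rho> \<prec> \<mu>} (\<lambda>\<rho>. {\<nu>. \<rho> \<prec> \<nu> \<and> psize \<nu> = psize \<rho> + (b - m)}).
      y N ^ (m + (psize \<mu> - psize \<rho>)) * schur_sum \<nu> N y)"
    by (subst sum.Sigma)
      (use finite_interlace_left[OF \<mu>] finite_interlace_right shape_low in \<open>auto intro!: finite_SigmaI\<close>)
  also have "\<dots> = (\<Sum>m\<le>b. \<Sum>\<rho> | \<rho> \<prec> \<mu>. \<Sum>\<nu> | \<rho> \<prec> \<nu> \<and> psize \<nu> = psize \<rho> + (b - m).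
      y N ^ (m + (psize \<mu> - psize \<rho>)) * schur_sum \<nu> N y)"
    by (rule sum.cong[OF refl], rule sum.Sigma[symmetric])
      (use finite_interlace_left[OF \<mu>] finite_interlace_right shape_low in auto)
  also have "\<dots> = (\<Sum>m\<le>b. \<Sum>\<rho> | \<rho> \<prec> \<mu>. y N ^ (m + (psize \<mu> - psize \<rho>)) * (hsym {..<N} y (b - m) * schur_sum \<rho> N y))"
    by (rule sum.cong[OF refl], rule sum.cong[OF refl])
      (use Suc.IH shape_low in \<open>simp add: sum_distrib_left\<close>)
  also have "\<dots> = (\<Sum>m\<le>b. y N ^ m * hsym {..<N} y (b - m)) * schur_sum \<mu> (Suc N) y"
    unfolding schur_sum_Suc[OF \<mu>] sum_product by (simp add: power_add mult_ac)
  also have "(\<Sum>m\<le>b. y N ^ m * hsym {..<N} y (b - m)) = hsym {..<Suc N} y b"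
    using hsym_Un[of "{N}" "{..<N}" y b] by (simp add: lessThan_Suc hsym_singleton atLeast0AtMost)
  finally show ?case by simp
qed

definition shapes :: "nat \<Rightarrow> (nat \<Rightarrow> nat) set" where
  "shapes n = {f. shape f \<and> psize f = n}"

lemma finite_shapes: "finite (shapes n)"
proof (rule finite_subset)
  show "shapes n \<subseteq> {f. \<forall>i. (i \<in> {..<n} \<longrightarrow> f i \<in> {..n}) \<and> (i \<notin> {..<n} \<longrightarrow> f i = 0)}"
  proof clarify
    fix f i assume f: "f \<in> shapes n"
    then have sh: "shape f" and n: "n = psize f" by (auto simp: shapes_def)
    \<comment> \<open>A nonzero row \<open>i\<close> forces the rows \<open>0\<close> to
      \<open>i\<close> to be at least 1, hence a size of at least \<open>Suc i\<close>.\<close>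
    have "f i = 0" if "n \<le> i"
    proof (rule ccontr)
      assume "f i \<noteq> 0"
      obtain K where K: "\<forall>j\<ge>K. f j = 0" using sh by (auto simp: shape_def)
      have "i < K" using K \<open>f i \<noteq> 0\<close> by (cases "i < K") auto
      have "Suc i = (\<Sum>j\<le>i. 1)" by simp
      also have "\<dots> \<le> (\<Sum>j\<le>i. f j)"
      proof (rule sum_mono)
        fix j assume "j \<in> {..i}"
        then have "f i \<le> f j" using sh by (simp add: shape_def antimono_def)
        then show "1 \<le> f j" using \<open>f i \<noteq> 0\<close> by simp
      qed
      also have "\<dots> \<le> (\<Sum>j<K. f j)" by (rule sum_mono2) (use \<open>i < K\<close> in auto)
      also have "\<dots> = n" using K n by (simp add: psize_eq[of K])
      finally show False using that by simp
    qed
    then show "(i \<in> {..<n} \<longrightarrow> f i \<in> {..n}) \<and> (i \<notin> {..<n} \<longrightarrow> f i = 0)"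
      using shape_le_psize[OF sh, of i] n by auto
  qed
  show "finite {f. \<forall>i. (i \<in> {..<n} \<longrightarrow> f i \<in> {..n}) \<and> (i \<notin> {..<n} \<longrightarrow> f i = (0::nat))}"
    by (rule finite_set_of_finite_funs) auto
qed

text \<open>Branching removes \<open>x N\<close> from the first factor. The sum over
  \<open>f\<close> above a fixed \<open>\<nu>\<close> is then a Pieri sum in the variables
  \<open>y\<close>, and what it produces, \<open>x N ^ b\<close> times a complete homogeneous
  function, is the contribution of the row of products \<open>x N * y j\<close>.\<close>

lemma cauchy_shapes:
  fixes x y :: "nat \<Rightarrow> 'a::comm_ring_1"
  shows "(\<Sum>f\<in>shapes n. schur_sum f N x * schur_sum f M y) =
    hsym ({..<N} \<times> {..<M}) (\<lambda>(i, j). x i * y j) n"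
proof (induction N arbitrary: n)
  case 0
  have one: "schur_sum (\<lambda>_. 0) M y = 1"
  proof -
    have "shape_ssyt (\<lambda>_. 0) M = {\<lambda>_. undefined}"
      by (auto simp: shape_ssyt_def diagram_def extensional_def)
    then show ?thesis by (simp add: schur_sum_def diagram_def)
  qed
  show ?case
  proof (cases "n = 0")
    case True
    have "psize (\<lambda>_. 0) = 0" by (simp add: psize_def)
    moreover have "shape (\<lambda>_. 0)" by (simp add: shape_def antimono_def)
    ultimately have "shapes 0 = {\<lambda>_. 0}" using shape_zero_iff by (auto simp: shapes_def)
    then show ?thesis using True one by (simp add: hsym_empty schur_sum_0)
  next
    case False
    have "f \<noteq> (\<lambda>_. 0)" if "f \<in> shapes n" for f
      using that False by (auto simp: shapes_def psize_def)
    then have "(\<Sum>f\<in>shapes n. schur_sum f 0 x * schur_sum f M y) = 0"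
      by (intro sum.neutral) (auto simp: schur_sum_0)
    then show ?thesis using False by (simp add: hsym_empty)
  qed
next
  case (Suc N)
  let ?D = "Sigma (shapes n) (\<lambda>f. {\<nu>. \<nu> \<prec> f})"
  let ?E = "Sigma {..n} (\<lambda>b. Sigma (shapes (n - b)) (\<lambda>\<nu>. {f. \<nu> \<prec> f \<and> psize f = psize \<nu> + b}))"
  have sh: "shape f" if "f \<in> shapes m" for f m using that by (simp add: shapes_def)
  have "(\<Sum>f\<in>shapes n. schur_sum f (Suc N) x * schur_sum f M y) =
      (\<Sum>f\<in>shapes n. \<Sum>\<nu> | \<nu> \<prec> f. x N ^ (n - psize \<nu>) * schur_sum \<nu> N x * schur_sum f M y)"
    by (rule sum.cong[OF refl]) (simp add: shapes_def schur_sum_Suc sum_distrib_right)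
  also have "\<dots> = (\<Sum>(f, \<nu>)\<in>?D. x N ^ (n - psize \<nu>) * schur_sum \<nu> N x * schur_sum f M y)"
    by (rule sum.Sigma) (use finite_shapes finite_interlace_left sh in auto)
  also have "\<dots> = (\<Sum>(b, \<nu>, f)\<in>?E. x N ^ b * schur_sum \<nu> N x * schur_sum f M y)"
    by (rule sum.reindex_bij_witness[of _ "\<lambda>(b, \<nu>, f). (f, \<nu>)" "\<lambda>(f, \<nu>). (n - psize \<nu>, \<nu>, f)"])
      (auto simp: shapes_def dest: interlace_shape_left interlace_shape_right psize_mono)
  also have "\<dots> = (\<Sum>b\<le>n. \<Sum>(\<nu>, f)\<in>Sigma (shapes (n - b)) (\<lambda>\<nu>. {f. \<nu> \<prec> f \<and> psize f = psize \<nu> + b}).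
      x N ^ b * schur_sum \<nu> N x * schur_sum f M y)"
    by (subst sum.Sigma) (use finite_shapes finite_interlace_right sh in \<open>auto intro!: finite_SigmaI\<close>)
  also have "\<dots> = (\<Sum>b\<le>n. \<Sum>\<nu>\<in>shapes (n - b). \<Sum>f | \<nu> \<prec> f \<and> psize f = psize \<nu> + b.
      x N ^ b * schur_sum \<nu> N x * schur_sum f M y)"
    by (rule sum.cong[OF refl], rule sum.Sigma[symmetric])
      (use finite_shapes finite_interlace_right sh in auto)
  also have "\<dots> = (\<Sum>b\<le>n. \<Sum>\<nu>\<in>shapes (n - b). x N ^ b * schur_sum \<nu> N x * (hsym {..<M} y b * schur_sum \<nu> M y))"
    by (rule sum.cong[OF refl], rule sum.cong[OF refl]) (simp add: schur_sum_pieri[OF sh] sum_distrib_left)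
  also have "\<dots> = (\<Sum>b\<le>n. x N ^ b * hsym {..<M} y b * (\<Sum>\<nu>\<in>shapes (n - b). schur_sum \<nu> N x * schur_sum \<nu> M y))"
    by (simp add: sum_distrib_left mult_ac)
  also have "\<dots> = (\<Sum>b\<le>n. hsym ({N} \<times> {..<M}) (\<lambda>(i, j). x i * y j) b *
      hsym ({..<N} \<times> {..<M}) (\<lambda>(i, j). x i * y j) (n - b))"
  proof (rule sum.cong[OF refl])
    fix b
    have "hsym ({N} \<times> {..<M}) (\<lambda>(i, j). x i * y j) b = hsym (Pair N ` {..<M}) (\<lambda>(i, j). x i * y j) b"
      by (rule arg_cong[of _ _ "\<lambda>A. hsym A _ b"]) auto
    also have "\<dots> = hsym {..<M} (\<lambda>j. x N * y j) b"
      by (subst hsym_reindex) (auto simp: inj_on_def)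
    finally have "hsym ({N} \<times> {..<M}) (\<lambda>(i, j). x i * y j) b = x N ^ b * hsym {..<M} y b"
      by (simp add: hsym_scale)
    then show "x N ^ b * hsym {..<M} y b * (\<Sum>\<nu>\<in>shapes (n - b). schur_sum \<nu> N x * schur_sum \<nu> M y) =
        hsym ({N} \<times> {..<M}) (\<lambda>(i, j). x i * y j) b * hsym ({..<N} \<times> {..<M}) (\<lambda>(i, j). x i * y j) (n - b)"
      by (simp add: Suc.IH)
  qed
  also have "\<dots> = hsym ({N} \<times> {..<M} \<union> {..<N} \<times> {..<M}) (\<lambda>(i, j). x i * y j) n"
    by (subst hsym_Un) (auto simp: atLeast0AtMost)
  also have "{N} \<times> {..<M} \<union> {..<N} \<times> {..<M} = {..<Suc N} \<times> {..<M}" by auto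
  finally show ?case .
qed

section \<open>Partitions as lists and as padded functions\<close>

definition shape_of :: "nat list \<Rightarrow> nat \<Rightarrow> nat" where
  "shape_of l = (\<lambda>r. if r < length l then l ! r else 0)"

lemma cells_eq_diagram: "cells l = diagram (shape_of l)"
  by (auto simp: cells_def diagram_def shape_of_def split: if_splits)

lemma psize_shape_of: "psize (shape_of l) = sum_list l"
proof -
  have "psize (shape_of l) = (\<Sum>i<length l. shape_of l i)"
    by (rule psize_eq) (simp add: shape_of_def)
  also have "\<dots> = (\<Sum>i<length l. l ! i)" by (rule sum.cong[OF refl]) (simp add: shape_of_def)
  finally show ?thesis by (simp add: sum_list_sum_nth lessThan_atLeast0)
qed

lemma shape_shape_of:
  assumes "l \<in> partitions n" shows "shape (shape_of l)"
proof -
  have "shape_of l (Suc i) \<le> shape_of l i" for i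
    using assms sorted_wrt_nth_less[of "(\<ge>)" l i "Suc i"] by (auto simp: shape_of_def partitions_def)
  then have "antimono (shape_of l)" by (simp add: antimono_iff_le_Suc)
  moreover have "\<forall>i\<ge>length l. shape_of l i = 0" by (simp add: shape_of_def)
  ultimately show ?thesis unfolding shape_def by fast
qed

lemma schur_eval_eq: "schur_eval l N y = schur_sum (shape_of l) N y"
proof -
  let ?f = "shape_of l"
  have row: "c < c' \<and> (r, c) \<in> diagram ?f \<and> (r, c') \<in> diagram ?f \<longleftrightarrow> c < c' \<and> c' < ?f r" for r c c'
    by (auto simp: diagram_def)
  have col: "r < r' \<and> (r, c) \<in> diagram ?f \<and> (r', c) \<in> diagram ?f \<longleftrightarrow> r < r' \<and> c < ?f r \<and> c < ?f r'" for r r' c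
    by (auto simp: diagram_def)
  have bound: "(\<forall>b\<in>diagram ?f. S b < N) \<longleftrightarrow> (\<forall>r c. c < ?f r \<longrightarrow> S (r, c) < N)" for S
    by (auto simp: diagram_def)
  have "{S \<in> ssyt l. \<forall>b\<in>cells l. S b < N} = shape_ssyt ?f N"
    by (simp only: ssyt_def shape_ssyt_def cells_eq_diagram row col bound mem_Collect_eq conj_assoc)
  then show ?thesis by (simp add: schur_eval_def schur_sum_def cells_eq_diagram)
qed

lemma shape_of_map:
  assumes "\<forall>i\<ge>K. f i = 0" shows "shape_of (map f [0..<K]) = f"
  using assms by (auto simp: shape_of_def fun_eq_iff)

lemma bij_betw_shape_of: "bij_betw shape_of (partitions n) (shapes n)"
  unfolding bij_betw_def
proof
  show "inj_on shape_of (partitions n)"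
  proof (rule inj_onI)
    fix l l' assume l: "l \<in> partitions n" and l': "l' \<in> partitions n" and eq: "shape_of l = shape_of l'"
    have pos: "shape_of l i \<noteq> 0 \<longleftrightarrow> i < length l" if "l \<in> partitions n" for l i
      using that nth_mem[of i l] by (cases "l ! i = 0") (auto simp: shape_of_def partitions_def)
    have len: "length l = length l'"
      using pos[OF l] pos[OF l'] eq by (metis linorder_neqE_nat order_less_irrefl)
    show "l = l'"
    proof (rule nth_equalityI[OF len])
      fix i assume "i < length l"
      then show "l ! i = l' ! i" using fun_cong[OF eq, of i] len by (simp add: shape_of_def)
    qed
  qed
  show "shape_of ` partitions n = shapes n"
  proof
    show "shape_of ` partitions n \<subseteq> shapes n"
      using shape_shape_of by (auto simp: shapes_def psize_shape_of) (auto simp: partitions_def)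
    show "shapes n \<subseteq> shape_of ` partitions n"
    proof
      fix f assume f: "f \<in> shapes n"
      then have sh: "shape f" and n: "psize f = n" by (auto simp: shapes_def)
      obtain K0 where K0: "\<forall>i\<ge>K0. f i = 0" using sh by (auto simp: shape_def)
      \<comment> \<open>Cutting at the first zero row keeps exactly the positive parts, as
        \<open>partitions\<close> demands.\<close>
      define K where "K = (LEAST K. f K = 0)"
      have "f K = 0" unfolding K_def by (rule LeastI[of _ K0]) (use K0 in simp)
      have anti: "f j \<le> f i" if "i \<le> j" for i j using sh that by (simp add: shape_def antimono_def)
      have "f i = 0" if "i \<ge> K" for i using anti[OF that] \<open>f K = 0\<close> by simp
      then have K: "\<forall>i\<ge>K. f i = 0" by simp
      have pos: "f i \<noteq> 0" if "i < K" for i using that not_less_Least unfolding K_def by blast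
      have eq: "shape_of (map f [0..<K]) = f" by (rule shape_of_map[OF K])
      have "sum_list (map f [0..<K]) = n"
        using n psize_shape_of[of "map f [0..<K]"] by (simp add: eq)
      moreover have "sorted_wrt (\<ge>) (map f [0..<K])"
        by (simp add: sorted_wrt_iff_nth_less anti)
      moreover have "0 \<notin> set (map f [0..<K])" using pos by force
      ultimately have "map f [0..<K] \<in> partitions n" by (simp add: partitions_def)
      then show "f \<in> shape_of ` partitions n" using eq by (metis image_eqI)
    qed
  qed
qed

lemma finite_partitions: "finite (partitions n)"
  using bij_betw_finite[OF bij_betw_shape_of] finite_shapes by blast

lemma cauchy_identity:
  fixes x y :: "nat \<Rightarrow> 'a::comm_ring_1"
  shows "(\<Sum>l\<in>partitions n. schur_eval l N x * schur_eval l M y) =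
    hsym ({..<N} \<times> {..<M}) (\<lambda>(i, j). x i * y j) n"
  unfolding schur_eval_eq cauchy_shapes[symmetric]
  by (rule sum.reindex_bij_betw[OF bij_betw_shape_of])

section \<open>Restriction to finitely many variables\<close>

abbreviation (input) lookup where "lookup \<equiv> Poly_Mapping.lookup"
abbreviation (input) keys where "keys \<equiv> Poly_Mapping.keys"
abbreviation (input) single where "single \<equiv> Poly_Mapping.single"

lemma mfps_nth_simps [simp]:
  "mfps_nth 0 m = 0" "mfps_nth 1 m = (if m = 0 then 1 else 0)"
  "mfps_nth (f + g) m = mfps_nth f m + mfps_nth g m"
  "mfps_nth (f - g) m = mfps_nth f m - mfps_nth g m"
  "mfps_nth (- f) m = - mfps_nth f m"
  by (simp_all add: zero_mfps_def one_mfps_def plus_mfps_def minus_mfps_def uminus_mfps_def)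

lemma mfps_nth_mult: "mfps_nth (f * g) m = (\<Sum>(a, b)\<in>factorisations m. mfps_nth f a * mfps_nth g b)"
  by (simp add: times_mfps_def)

lemma mfps_nth_sum: "mfps_nth (\<Sum>x\<in>A. f x) m = (\<Sum>x\<in>A. mfps_nth (f x) m)"
  by (induction A rule: infinite_finite_induct) auto

definition mfps_monom :: "('i \<Rightarrow>\<^sub>0 nat) \<Rightarrow> ('i, 'a::comm_ring_1) mfps" where
  "mfps_monom a = Abs_mfps (\<lambda>m. if m = a then 1 else 0)"

lemma mfps_monom_0 [simp]: "mfps_monom 0 = 1"
  by (rule mfps_eqI) (simp add: mfps_monom_def)

lemma mfps_nth_const_mult:
  fixes m :: "'i \<Rightarrow>\<^sub>0 nat"
  shows "mfps_nth (mfps_const c * f) m = c * mfps_nth f m"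
proof -
  have "mfps_nth (mfps_const c * f) m = (\<Sum>(a, b)\<in>{(0 :: 'i \<Rightarrow>\<^sub>0 nat, m)}. mfps_nth (mfps_const c) a * mfps_nth f b)"
    unfolding mfps_nth_mult
    by (rule sum.mono_neutral_right[OF finite_factorisations])
      (auto simp: factorisations_def mfps_const_def split: if_splits)
  then show ?thesis by (simp add: mfps_const_def)
qed

lemma mfps_monom_mult:
  fixes a b :: "'i \<Rightarrow>\<^sub>0 nat"
  shows "mfps_monom a * mfps_monom b = mfps_monom (a + b)"
proof (rule mfps_eqI)
  fix m :: "'i \<Rightarrow>\<^sub>0 nat"
  have "mfps_nth (mfps_monom a * mfps_monom b) m =
      (\<Sum>p\<in>factorisations m. if p = (a, b) then 1 else 0)"
    unfolding mfps_nth_mult by (rule sum.cong[OF refl]) (simp add: mfps_monom_def split: prod.splits)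
  also have "\<dots> = (if (a, b) \<in> factorisations m then 1 else 0)"
    by (rule sum.delta[OF finite_factorisations])
  finally show "mfps_nth (mfps_monom a * mfps_monom b) m = mfps_nth (mfps_monom (a + b)) m"
    by (auto simp: factorisations_def mfps_monom_def)
qed

lemma mfps_monom_sum: "mfps_monom (\<Sum>x\<in>A. f x) = (\<Prod>x\<in>A. mfps_monom (f x))"
  by (induction A rule: infinite_finite_induct) (simp_all flip: mfps_monom_mult)

lemma mfps_monom_single_power: "mfps_monom (single v 1) ^ l = mfps_monom (single v l)"
  by (induction l) (simp_all add: mfps_monom_mult flip: single_add)

lemma mfps_const_simps:
  "mfps_const 0 = 0" "mfps_const 1 = 1"
  "mfps_const (a + b) = mfps_const a + mfps_const b"
  "mfps_const (a - b) = mfps_const a - mfps_const b"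
  "mfps_const (a * b) = mfps_const a * mfps_const b"
proof -
  show "mfps_const (a * b) = mfps_const a * mfps_const b"
    by (rule mfps_eqI) (simp add: mfps_nth_const_mult, simp add: mfps_const_def)
qed (auto intro!: mfps_eqI simp: mfps_const_def)

lemma mfps_const_power: "mfps_const (a ^ n) = mfps_const a ^ n"
  by (induction n) (simp_all add: mfps_const_simps)

lemma mfps_const_sum: "mfps_const (\<Sum>x\<in>A. f x) = (\<Sum>x\<in>A. mfps_const (f x))"
  by (induction A rule: infinite_finite_induct) (auto simp: mfps_const_simps)

lemma mfps_const_prod: "mfps_const (\<Prod>x\<in>A. f x) = (\<Prod>x\<in>A. mfps_const (f x))"
  by (induction A rule: infinite_finite_induct) (auto simp: mfps_const_simps)

lemma mfps_const_of_nat: "mfps_const (of_nat n) = of_nat n"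
  by (induction n) (simp_all add: mfps_const_simps)

section \<open>Setting all but finitely many variables to zero\<close>

definition in_first :: "nat \<Rightarrow> (nat \<times> nat \<Rightarrow>\<^sub>0 nat) \<Rightarrow> bool" where
  "in_first N m \<longleftrightarrow> (\<forall>v\<in>keys m. snd v < N)"

text \<open>The substitution of zero for all variables of index at least \<open>N\<close>, in every
  alphabet at the same time. It is a ring homomorphism that turns power sums and Schur functions
  into polynomials, for which sums over words are finite.\<close>

definition trunc :: "nat \<Rightarrow> (nat \<times> nat, 'a::comm_ring_1) mfps \<Rightarrow> (nat \<times> nat, 'a) mfps" where
  "trunc N f = Abs_mfps (\<lambda>m. if in_first N m then mfps_nth f m else 0)"

lemma mfps_nth_trunc: "mfps_nth (trunc N f) m = (if in_first N m then mfps_nth f m else 0)"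
  by (simp add: trunc_def)

text \<open>A monomial involves finitely many variables, so a large enough \<open>N\<close> leaves
  its coefficient untouched.\<close>

lemma trunc_eqI:
  assumes "\<And>N. trunc N f = trunc N g" shows "f = g"
proof (rule mfps_eqI)
  fix m :: "nat \<times> nat \<Rightarrow>\<^sub>0 nat"
  have "finite (snd ` keys m)" by simp
  then obtain N where N: "\<forall>i\<in>snd ` keys m. i < N" using finite_nat_set_iff_bounded by auto
  then have "in_first N m" by (simp add: in_first_def)
  then show "mfps_nth f m = mfps_nth g m"
    using arg_cong[OF assms[of N], of "\<lambda>f. mfps_nth f m"] by (simp add: mfps_nth_trunc)
qed

text \<open>Exponents are natural numbers and cannot cancel. For this reason a product of monomials
  survives truncation exactly when both factors do, which makes \<open>trunc\<close>
  multiplicative.\<close>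

lemma keys_add_nat: "keys (a + b) = keys a \<union> keys (b :: 'i \<Rightarrow>\<^sub>0 nat)"
  by (auto simp: in_keys_iff lookup_add)

lemma in_first_add: "in_first N (a + b) \<longleftrightarrow> in_first N a \<and> in_first N b"
  by (auto simp: in_first_def keys_add_nat)

lemma trunc_mult: "trunc N (f * g) = trunc N f * trunc N g"
proof (rule mfps_eqI)
  fix m
  show "mfps_nth (trunc N (f * g)) m = mfps_nth (trunc N f * trunc N g) m"
  proof (cases "in_first N m")
    case True
    then show ?thesis
      unfolding mfps_nth_trunc mfps_nth_mult
      by (auto intro!: sum.cong simp: factorisations_def in_first_add)
  next
    case False
    then have "mfps_nth (trunc N f) a * mfps_nth (trunc N g) b = 0" if "(a, b) \<in> factorisations m" for a b
      using that by (auto simp: factorisations_def in_first_add mfps_nth_trunc)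
    then have "mfps_nth (trunc N f * trunc N g) m = 0"
      unfolding mfps_nth_mult by (intro sum.neutral) auto
    then show ?thesis using False by (simp add: mfps_nth_trunc)
  qed
qed

lemma trunc_simps:
  "trunc N 0 = 0" "trunc N 1 = 1" "trunc N (mfps_const c) = mfps_const c"
  "trunc N (f + g) = trunc N f + trunc N g"
  by (auto intro!: mfps_eqI simp: mfps_nth_trunc mfps_const_def in_first_def)

lemma trunc_sum: "trunc N (\<Sum>x\<in>A. f x) = (\<Sum>x\<in>A. trunc N (f x))"
  by (induction A rule: infinite_finite_induct) (auto simp: trunc_simps)

lemma trunc_prod: "trunc N (\<Prod>x\<in>A. f x) = (\<Prod>x\<in>A. trunc N (f x))"
  by (induction A rule: infinite_finite_induct) (auto simp: trunc_simps trunc_mult)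

definition xvar :: "nat \<Rightarrow> nat \<Rightarrow> symf" where
  "xvar j i = mfps_monom (single (j, i) 1)"

text \<open>For positive \<open>l\<close> the monomials of different variables are distinct, so each
  coefficient is 0 or 1; for \<open>l = 0\<close> they would all be the constant monomial. Cycle
  lengths are positive.\<close>

lemma trunc_power_sum:
  assumes "l > 0"
  shows "trunc N (power_sum l j) = (\<Sum>i<N. xvar j i ^ l)"
proof (rule mfps_eqI)
  fix m :: "nat \<times> nat \<Rightarrow>\<^sub>0 nat"
  have inj: "single (j, i) l = single (j, i') l \<longleftrightarrow> i = i'" for i i'
    using assms by (auto dest!: arg_cong[of _ _ keys])
  have R: "mfps_nth (\<Sum>i<N. xvar j i ^ l) m = (\<Sum>i<N. if m = single (j, i) l then 1 else 0)"
    by (simp only: xvar_def mfps_monom_single_power mfps_nth_sum) (simp add: mfps_monom_def)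
  show "mfps_nth (trunc N (power_sum l j)) m = mfps_nth (\<Sum>i<N. xvar j i ^ l) m"
  proof (cases "\<exists>i. m = single (j, i) l")
    case True
    then obtain i where m: "m = single (j, i) l" by blast
    have "in_first N m \<longleftrightarrow> i < N" using assms by (simp add: m in_first_def)
    moreover have "mfps_nth (power_sum l j) m = 1"
      by (simp add: m power_sum_def inj)
    moreover have "mfps_nth (\<Sum>i<N. xvar j i ^ l) m = (if i < N then 1 else 0)"
      unfolding R by (simp add: m inj)
    ultimately show ?thesis by (simp add: mfps_nth_trunc)
  next
    case False
    then have "{i. single (j, i) l = m} = {}" by auto
    then have "mfps_nth (power_sum l j) m = 0" by (simp add: power_sum_def)
    moreover have "mfps_nth (\<Sum>i<N. xvar j i ^ l) m = 0"
      unfolding R using False by (intro sum.neutral) auto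
    ultimately show ?thesis by (simp add: mfps_nth_trunc)
  qed
qed

lemma in_first_sum:
  assumes "finite A"
  shows "in_first N (\<Sum>x\<in>A. f x) \<longleftrightarrow> (\<forall>x\<in>A. in_first N (f x))"
  using assms by (induction A rule: finite_induct) (auto simp: in_first_add in_first_def[of _ 0])

lemma finite_cells: "finite (cells l)"
proof -
  have "cells l = Sigma {..<length l} (\<lambda>r. {..<l ! r})" by (auto simp: cells_def)
  then show ?thesis by simp
qed

lemma finite_bounded_ssyt: "finite {S \<in> ssyt l. \<forall>b\<in>cells l. S b < N}"
proof (rule finite_subset)
  show "{S \<in> ssyt l. \<forall>b\<in>cells l. S b < N} \<subseteq> cells l \<rightarrow>\<^sub>E {..<N}"
    by (auto simp: ssyt_def PiE_def)
  show "finite (cells l \<rightarrow>\<^sub>E {..<N})" using finite_cells by (simp add: finite_PiE)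
qed

text \<open>The monomial of a tableau survives exactly when all entries are below \<open>N\<close>,
  and only finitely many tableaux of the given shape meet this bound.\<close>

lemma trunc_schur: "trunc N (schur l i) = schur_eval l N (xvar i)"
proof (rule mfps_eqI)
  fix m :: "nat \<times> nat \<Rightarrow>\<^sub>0 nat"
  let ?c = "\<lambda>S :: nat \<times> nat \<Rightarrow> nat. \<Sum>b\<in>cells l. single (i, S b) (1::nat)"
  let ?F = "{S \<in> ssyt l. \<forall>b\<in>cells l. S b < N}"
  have single: "in_first N (single (i, s) (1::nat)) \<longleftrightarrow> s < N" for s
    by (simp add: in_first_def)
  have first: "in_first N (?c S) \<longleftrightarrow> (\<forall>b\<in>cells l. S b < N)" for S
    by (simp only: in_first_sum[OF finite_cells] single)
  have "mfps_nth (schur_eval l N (xvar i)) m = (\<Sum>S\<in>?F. if m = ?c S then 1 else 0)"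
    unfolding schur_eval_def xvar_def mfps_monom_sum[symmetric] mfps_nth_sum
    by (rule sum.cong[OF refl]) (simp add: mfps_monom_def)
  also have "\<dots> = of_nat (card {S \<in> ?F. ?c S = m})"
    using finite_bounded_ssyt[of l N] by (simp add: sum.If_cases Int_def eq_commute)
  also have "\<dots> = mfps_nth (trunc N (schur l i)) m"
  proof (cases "in_first N m")
    case True
    then have "{S \<in> ?F. ?c S = m} = {S \<in> ssyt l. ?c S = m}" using first by auto
    then show ?thesis using True by (simp add: mfps_nth_trunc schur_def)
  next
    case False
    then have e: "{S \<in> ?F. ?c S = m} = {}" using first by auto
    show ?thesis unfolding e using False by (simp add: mfps_nth_trunc)
  qed
  finally show "mfps_nth (trunc N (schur l i)) m = mfps_nth (schur_eval l N (xvar i)) m" by simp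
qed

section \<open>Standardisation\<close>

text \<open>
  The possible excesses of a value sequence over the minimal one, divided by \<open>k\<close>
  and listed from the largest entry down.
\<close>

definition excess :: "nat \<Rightarrow> nat \<Rightarrow> nat \<Rightarrow> nat \<Rightarrow> (nat \<Rightarrow> nat) set" where
  "excess A k n r = {d. antimono d \<and> d n = 0 \<and> A + k * d 0 \<le> r}"

lemma finite_excess:
  assumes "k > 0" shows "finite (excess A k n r)"
proof (rule finite_subset)
  show "excess A k n r \<subseteq> {d. \<forall>i. (i \<in> {..<n} \<longrightarrow> d i \<in> {..r}) \<and> (i \<notin> {..<n} \<longrightarrow> d i = 0)}"
  proof clarify
    fix d i assume "d \<in> excess A k n r"
    then have d: "antimono d" "d n = 0" "A + k * d 0 \<le> r" by (auto simp: excess_def)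
    have "d i \<le> d 0" using d(1) by (simp add: antimono_def)
    also have "\<dots> \<le> k * d 0" using assms by simp
    also have "\<dots> \<le> r" using d(3) by simp
    finally have "d i \<le> r" .
    moreover have "d i \<le> d n" if "n \<le> i" using d(1) that by (simp add: antimono_def)
    ultimately show "(i \<in> {..<n} \<longrightarrow> d i \<in> {..r}) \<and> (i \<notin> {..<n} \<longrightarrow> d i = 0)"
      using d(2) by simp
  qed
  show "finite {d. \<forall>i. (i \<in> {..<n} \<longrightarrow> d i \<in> {..r}) \<and> (i \<notin> {..<n} \<longrightarrow> d i = (0::nat))}"
    by (rule finite_set_of_finite_funs) auto
qed

text \<open>The case distinction is whether \<open>d n\<close> vanishes. If it does not, then all of
  \<open>d 0\<close> to \<open>d n\<close> are positive and 1 can be subtracted from each of them,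
  which lowers the bound \<open>r\<close> by \<open>k\<close>. In terms of partitions this removes a
  column of full height \<open>Suc n\<close>.\<close>

lemma excess_Suc:
  assumes "k > 0"
  shows "excess A k (Suc n) r = excess A k n r \<union>
    (if r < k then {} else (\<lambda>d i. if i < Suc n then Suc (d i) else 0) ` excess A k (Suc n) (r - k))"
    (is "_ = _ \<union> ?R")
proof
  show "excess A k (Suc n) r \<subseteq> excess A k n r \<union> ?R"
  proof
    fix d assume "d \<in> excess A k (Suc n) r"
    then have d: "antimono d" "d (Suc n) = 0" "A + k * d 0 \<le> r" by (auto simp: excess_def)
    have mono: "d j \<le> d i" if "i \<le> j" for i j using d(1) that by (simp add: antimono_def)
    show "d \<in> excess A k n r \<union> ?R"
    proof (cases "d n = 0")
      case True
      then show ?thesis using d by (simp add: excess_def)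
    next
      case False
      have pos: "d i \<noteq> 0" if "i < Suc n" for i using mono[of i n] False that by simp
      have zero: "d i = 0" if "\<not> i < Suc n" for i using mono[of "Suc n" i] d(2) that by simp
      define e where "e i = d i - 1" for i
      have kd: "k * d 0 = k * e 0 + k" using pos[of 0] by (cases "d 0") (auto simp: e_def)
      then have "k \<le> r" using d(3) by linarith
      have "A + k * e 0 \<le> r - k" using d(3) kd by linarith
      moreover have "antimono e" using mono by (auto simp: antimono_def e_def diff_le_mono)
      moreover have "e (Suc n) = 0" using d(2) by (simp add: e_def)
      ultimately have "e \<in> excess A k (Suc n) (r - k)" by (simp add: excess_def)
      moreover have "d = (\<lambda>i. if i < Suc n then Suc (e i) else 0)"
        using pos zero by (auto simp: e_def fun_eq_iff)
      ultimately show ?thesis using \<open>k \<le> r\<close> by auto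
    qed
  qed
  show "excess A k n r \<union> ?R \<subseteq> excess A k (Suc n) r"
  proof
    fix d assume "d \<in> excess A k n r \<union> ?R"
    then consider "d \<in> excess A k n r"
      | e where "k \<le> r" "e \<in> excess A k (Suc n) (r - k)" "d = (\<lambda>i. if i < Suc n then Suc (e i) else 0)"
      by (auto split: if_splits)
    then show "d \<in> excess A k (Suc n) r"
    proof cases
      case 1
      then have "antimono d" "d n = 0" by (auto simp: excess_def)
      then have "d (Suc n) = 0" using antimonoD[of d n "Suc n"] by simp
      then show ?thesis using 1 by (simp add: excess_def)
    next
      case 2
      then have "antimono e" "A + k * e 0 \<le> r - k" by (auto simp: excess_def)
      then have "antimono d" using 2(3) by (auto simp: antimono_def)
      moreover have "A + k * d 0 \<le> r" using \<open>A + k * e 0 \<le> r - k\<close> 2 by simp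
      ultimately show ?thesis using 2(3) by (simp add: excess_def)
    qed
  qed
qed

definition excess_series :: "'a::comm_ring_1 \<Rightarrow> nat \<Rightarrow> nat \<Rightarrow> nat \<Rightarrow> 'a fps" where
  "excess_series q A k n = Abs_fps (\<lambda>r. \<Sum>d\<in>excess A k n r. q ^ (k * (\<Sum>i<n. d i)))"

lemma excess_series_0:
  assumes "k > 0"
  shows "excess_series q A k 0 * (1 - fps_X) = fps_X ^ A"
proof (rule fps_ext)
  fix r
  have ex: "excess A k 0 r = (if A \<le> r then {\<lambda>_. 0} else {})" for r
  proof -
    have "d = (\<lambda>_. 0)" if "antimono d" "d 0 = 0" for d :: "nat \<Rightarrow> nat"
    proof
      fix i
      have "d i \<le> d 0" using that(1) by (simp add: antimono_def)
      then show "d i = 0" using that(2) by simp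
    qed
    then show ?thesis by (auto simp: excess_def antimono_def)
  qed
  have "fps_nth (excess_series q A k 0) r = (if A \<le> r then 1 else 0)" for r
    by (simp add: excess_series_def ex)
  then show "fps_nth (excess_series q A k 0 * (1 - fps_X)) r = fps_nth (fps_X ^ A) r"
    by (auto simp: right_diff_distrib fps_X_power_nth)
qed

text \<open>Generating function form of \<open>excess_Suc\<close>: a removed column costs
  \<open>k\<close> in the exponent of \<open>t\<close> and \<open>k * Suc n\<close> in that of
  \<open>q\<close>.\<close>

lemma excess_series_Suc:
  assumes k: "k > 0"
  shows "excess_series q A k (Suc n) * (1 - fps_X ^ k * fps_const (q ^ (k * Suc n))) = excess_series q A k n"
proof (rule fps_ext)
  fix r
  let ?h = "\<lambda>d i. if i < Suc n then Suc (d i) else (0::nat)"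
  let ?w = "\<lambda>d. q ^ (k * (\<Sum>i<Suc n. d i))"
  let ?R = "if r < k then {} else ?h ` excess A k (Suc n) (r - k)"
  have inj: "inj_on ?h (excess A k (Suc n) (r - k))"
  proof (rule inj_onI)
    fix d e assume d: "d \<in> excess A k (Suc n) (r - k)" and e: "e \<in> excess A k (Suc n) (r - k)" and eq: "?h d = ?h e"
    show "d = e"
    proof
      fix i
      show "d i = e i"
      proof (cases "i < Suc n")
        case True then show ?thesis using fun_cong[OF eq, of i] by simp
      next
        case False
        then have "d i \<le> d (Suc n)" "e i \<le> e (Suc n)"
          using d e antimonoD[of d "Suc n" i] antimonoD[of e "Suc n" i] by (auto simp: excess_def)
        then show ?thesis using d e by (simp add: excess_def)
      qed
    qed
  qed
  have disj: "excess A k n r \<inter> ?R = {}"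
    by (auto simp: excess_def dest: fun_cong[of _ _ n])
  have "fps_nth (excess_series q A k (Suc n)) r = (\<Sum>d\<in>excess A k n r. ?w d) + (\<Sum>d\<in>?R. ?w d)"
    unfolding excess_series_def fps_nth_Abs_fps excess_Suc[OF k, of A n r]
    by (rule sum.union_disjoint) (use disj finite_excess[OF k] in auto)
  also have "(\<Sum>d\<in>excess A k n r. ?w d) = fps_nth (excess_series q A k n) r"
    unfolding excess_series_def fps_nth_Abs_fps
    by (rule sum.cong[OF refl]) (simp add: excess_def)
  also have "(\<Sum>d\<in>?R. ?w d) = (if r < k then 0 else
      q ^ (k * Suc n) * fps_nth (excess_series q A k (Suc n)) (r - k))"
  proof (cases "r < k")
    case False
    have "(\<Sum>i<Suc n. ?h d i) = Suc n + (\<Sum>i<Suc n. d i)" for d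
      by (simp add: sum_Suc)
    then have w: "?w (?h d) = q ^ (k * Suc n) * ?w d" for d
      by (simp only: distrib_left power_add)
    have "(\<Sum>d\<in>?R. ?w d) = (\<Sum>d\<in>excess A k (Suc n) (r - k). ?w (?h d))"
      using False by (simp only: if_False sum.reindex[OF inj] o_def)
    also have "\<dots> = q ^ (k * Suc n) * fps_nth (excess_series q A k (Suc n)) (r - k)"
      unfolding w by (simp add: excess_series_def sum_distrib_left)
    finally show ?thesis using False by simp
  qed simp
  finally have rec: "fps_nth (excess_series q A k (Suc n)) r = fps_nth (excess_series q A k n) r +
     (if r < k then 0 else q ^ (k * Suc n) * fps_nth (excess_series q A k (Suc n)) (r - k))" .
  have "fps_nth (excess_series q A k (Suc n) * (fps_X ^ k * fps_const (q ^ (k * Suc n)))) r =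
      fps_nth (fps_const (q ^ (k * Suc n)) * (fps_X ^ k * excess_series q A k (Suc n))) r"
    by (simp only: mult_ac)
  also have "\<dots> = (if r < k then 0 else q ^ (k * Suc n) * fps_nth (excess_series q A k (Suc n)) (r - k))"
    by (simp only: fps_mult_left_const_nth fps_X_power_mult_nth) simp
  finally show "fps_nth (excess_series q A k (Suc n) * (1 - fps_X ^ k * fps_const (q ^ (k * Suc n)))) r =
      fps_nth (excess_series q A k n) r"
    using rec by (simp only: right_diff_distrib fps_sub_nth mult_1_right) simp
qed

lemma excess_series_closed:
  assumes "k > 0"
  shows "excess_series q A k n * ((1 - fps_X) * (\<Prod>j=1..n. 1 - fps_X ^ k * fps_const (q ^ (k * j)))) = fps_X ^ A"
proof (induction n)
  case 0
  then show ?case using excess_series_0[OF assms] by simp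
next
  case (Suc n)
  have "excess_series q A k (Suc n) * ((1 - fps_X) * (\<Prod>j=1..Suc n. 1 - fps_X ^ k * fps_const (q ^ (k * j)))) =
      excess_series q A k (Suc n) * (1 - fps_X ^ k * fps_const (q ^ (k * Suc n))) *
      ((1 - fps_X) * (\<Prod>j=1..n. 1 - fps_X ^ k * fps_const (q ^ (k * j))))"
    by (simp add: prod.cl_ivl_Suc mult_ac)
  also have "\<dots> = fps_X ^ A" unfolding excess_series_Suc[OF assms] by (rule Suc.IH)
  finally show ?case .
qed

section \<open>Lexicographic order encoded in numbers, and ranks with respect to an injective
  key\<close>

lemma lex_le:
  fixes s s' k :: nat
  assumes "s < k" "s' < k"
  shows "k * a + s \<le> k * b + s' \<longleftrightarrow> a < b \<or> a = b \<and> s \<le> s'"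
proof -
  consider "a < b" | "a = b" | "b < a" by linarith
  then show ?thesis
  proof cases
    case 1
    then have "k * Suc a \<le> k * b" by (intro mult_le_mono) auto
    then show ?thesis using 1 assms by simp
  next
    case 3
    then have "k * Suc b \<le> k * a" by (intro mult_le_mono) auto
    then show ?thesis using 3 assms by simp
  qed simp
qed

lemma lex_less:
  fixes s s' k :: nat
  assumes "s < k" "s' < k"
  shows "k * a + s < k * b + s' \<longleftrightarrow> a < b \<or> a = b \<and> s < s'"
  using lex_le[OF assms(2,1), of b a] by (auto simp: not_le[symmetric])

lemma rank_bij:
  fixes \<kappa> :: "'b \<Rightarrow> nat"
  assumes A: "finite A" and inj: "inj_on \<kappa> A"
  defines "R \<equiv> \<lambda>b. card {a \<in> A. \<kappa> a \<le> \<kappa> b}"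
  shows "bij_betw R A {1..card A}" "a \<in> A \<Longrightarrow> b \<in> A \<Longrightarrow> R a < R b \<longleftrightarrow> \<kappa> a < \<kappa> b"
proof -
  have less: "R a < R b" if "a \<in> A" "b \<in> A" "\<kappa> a < \<kappa> b" for a b
    unfolding R_def
  proof (rule psubset_card_mono)
    have "b \<in> {c \<in> A. \<kappa> c \<le> \<kappa> b}" "b \<notin> {c \<in> A. \<kappa> c \<le> \<kappa> a}" using that by auto
    moreover have "{c \<in> A. \<kappa> c \<le> \<kappa> a} \<subseteq> {c \<in> A. \<kappa> c \<le> \<kappa> b}" using that by auto
    ultimately show "{c \<in> A. \<kappa> c \<le> \<kappa> a} \<subset> {c \<in> A. \<kappa> c \<le> \<kappa> b}" by blast
  qed (use A in auto)
  have iff: "R a < R b \<longleftrightarrow> \<kappa> a < \<kappa> b" if "a \<in> A" "b \<in> A" for a b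
  proof
    assume lt: "R a < R b"
    show "\<kappa> a < \<kappa> b"
    proof (rule ccontr)
      assume "\<not> \<kappa> a < \<kappa> b"
      then have "R b \<le> R a" using less[OF that(2,1)] inj that by (cases "\<kappa> a = \<kappa> b") (auto dest: inj_onD)
      then show False using lt by simp
    qed
  qed (use less that in auto)
  then show "a \<in> A \<Longrightarrow> b \<in> A \<Longrightarrow> R a < R b \<longleftrightarrow> \<kappa> a < \<kappa> b" .
  have "inj_on R A"
  proof (rule inj_onI)
    fix a b assume ab: "a \<in> A" "b \<in> A" "R a = R b"
    then have "\<kappa> a = \<kappa> b" using iff[of a b] iff[of b a] by simp
    then show "a = b" using inj ab by (simp add: inj_on_def)
  qed
  moreover have "R ` A \<subseteq> {1..card A}"
  proof
    fix x assume "x \<in> R ` A"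
    then obtain b where b: "b \<in> A" "x = R b" by auto
    have "{b} \<subseteq> {a \<in> A. \<kappa> a \<le> \<kappa> b}" using b by auto
    then have "card {b} \<le> R b" unfolding R_def by (rule card_mono[rotated]) (use A in simp)
    moreover have "R b \<le> card A" unfolding R_def by (rule card_mono) (use A in auto)
    ultimately show "x \<in> {1..card A}" using b by simp
  qed
  ultimately show "bij_betw R A {1..card A}"
    by (simp add: bij_betw_def card_image card_subset_eq)
qed

text \<open>Counterpart of \<open>rank_bij\<close>: a labelling by \<open>1\<close> to
  \<open>n\<close> whose order agrees with the key must be the rank, since the elements with key at
  most that of \<open>b\<close> carry exactly the labels \<open>1\<close> to \<open>T b\<close>.
  This recovers a standard tableau from its filling.\<close>

lemma rank_unique:
  fixes \<kappa> T :: "'b \<Rightarrow> nat"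
  assumes T: "bij_betw T A {1..n}" and mono: "\<And>a b. a \<in> A \<Longrightarrow> b \<in> A \<Longrightarrow> T a < T b \<Longrightarrow> \<kappa> a < \<kappa> b"
    and b: "b \<in> A"
  shows "card {a \<in> A. \<kappa> a \<le> \<kappa> b} = T b"
proof -
  have le: "\<kappa> a \<le> \<kappa> b \<longleftrightarrow> T a \<le> T b" if "a \<in> A" for a
  proof -
    consider "T a < T b" | "T a = T b" | "T b < T a" by linarith
    then show ?thesis
    proof cases
      case 1
      then show ?thesis using mono[of a b] that b by simp
    next
      case 2
      then have "a = b" using T that b by (auto simp: bij_betw_def inj_on_def)
      then show ?thesis by simp
    next
      case 3
      then show ?thesis using mono[of b a] that b by simp
    qed
  qed
  have Tb: "T b \<in> {1..n}" using T b by (auto simp: bij_betw_def)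
  have "T ` {a \<in> A. \<kappa> a \<le> \<kappa> b} = {1..T b}"
  proof
    show "T ` {a \<in> A. \<kappa> a \<le> \<kappa> b} \<subseteq> {1..T b}"
      using T le by (auto simp: bij_betw_def)
    show "{1..T b} \<subseteq> T ` {a \<in> A. \<kappa> a \<le> \<kappa> b}"
    proof
      fix x assume x: "x \<in> {1..T b}"
      then have "x \<in> T ` A" using T Tb by (auto simp: bij_betw_def)
      then obtain a where "a \<in> A" "x = T a" by auto
      then show "x \<in> T ` {a \<in> A. \<kappa> a \<le> \<kappa> b}" using le x by auto
    qed
  qed
  moreover have "inj_on T {a \<in> A. \<kappa> a \<le> \<kappa> b}"
    using T by (auto simp: bij_betw_def intro: inj_on_subset)
  ultimately show ?thesis using card_image by fastforce
qed

lemma card_cells: "card (cells l) = sum_list l"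
proof -
  have "cells l = Sigma {..<length l} (\<lambda>r. {..<l ! r})" by (auto simp: cells_def)
  then show ?thesis by (simp add: sum_list_sum_nth lessThan_atLeast0)
qed

lemma mcells_Sigma: "mcells L = Sigma {..<length L} (\<lambda>i. cells (L ! i))"
  by (auto simp: mcells_def)

lemma finite_mcells: "finite (mcells L)"
  unfolding mcells_Sigma using finite_cells by auto

lemma card_mcells: "card (mcells L) = sum_list (map sum_list L)"
  unfolding mcells_Sigma using finite_cells by (simp add: card_cells sum_list_sum_nth lessThan_atLeast0)

section \<open>Minimality of the value sequence of a standard tableau\<close>

context
  fixes L :: "nat list list" and k n :: nat
  defines "k \<equiv> length L" and "n \<equiv> sum_list (map sum_list L)"
begin

lemma cell_of:
  assumes "S \<in> SYT L"
  shows "i \<in> {1..n} \<Longrightarrow> cell_of L S i \<in> mcells L" "i \<in> {1..n} \<Longrightarrow> S (cell_of L S i) = i"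
    "b \<in> mcells L \<Longrightarrow> cell_of L S (S b) = b" "b \<in> mcells L \<Longrightarrow> S b \<in> {1..n}"
proof -
  have bij: "bij_betw S (mcells L) {1..n}" using assms by (simp add: SYT_def n_def)
  then have inj: "inj_on S (mcells L)" and im: "S ` mcells L = {1..n}" by (auto simp: bij_betw_def)
  show "i \<in> {1..n} \<Longrightarrow> cell_of L S i \<in> mcells L"
    unfolding cell_of_def using the_inv_into_into[OF inj] im by blast
  show "i \<in> {1..n} \<Longrightarrow> S (cell_of L S i) = i"
    unfolding cell_of_def using f_the_inv_into_f[OF inj] im by blast
  show "b \<in> mcells L \<Longrightarrow> cell_of L S (S b) = b"
    unfolding cell_of_def by (rule the_inv_into_f_f[OF inj])
  show "b \<in> mcells L \<Longrightarrow> S b \<in> {1..n}" using im by blast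
qed

lemma comp_of_less:
  assumes "S \<in> SYT L" "i \<in> {1..n}" shows "comp_of L S i < k"
  using cell_of(1)[OF assms] by (auto simp: comp_of_def mcells_def k_def split: prod.splits)

text \<open>
  The entries of \<open>wseq\<close> are the least values that increase weakly, have the component of the label
  as their residue, and only repeat when the next label lies further to the right.
\<close>

lemma wseq_step:
  assumes S: "S \<in> SYT L" and i: "1 \<le> i" "i < n" and m: "wseq L S i = k * m + comp_of L S i"
  shows "wseq L S (Suc i) = k * (if strictly_right L S (Suc i) i then m else Suc m) + comp_of L S (Suc i)"
proof -
  obtain i' where i': "i = Suc i'" using i by (cases i) auto
  have "comp_of L S i < k" using comp_of_less[OF S] i by simp
  then show ?thesis using m unfolding i' by (auto simp: strictly_right_def k_def)
qed

lemma wseq_mod: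
  assumes S: "S \<in> SYT L" and i: "i \<in> {1..n}"
  shows "\<exists>m. wseq L S i = k * m + comp_of L S i"
proof -
  have "1 \<le> i \<Longrightarrow> i \<le> n \<Longrightarrow> \<exists>m. wseq L S i = k * m + comp_of L S i" for i
  proof (induction i)
    case (Suc i)
    show ?case
    proof (cases "i = 0")
      case True
      then show ?thesis by (auto intro: exI[of _ 0])
    next
      case False
      then obtain m where m: "wseq L S i = k * m + comp_of L S i" using Suc by auto
      show ?thesis using wseq_step[OF S _ _ m] False Suc.prems by auto
    qed
  qed simp
  then show ?thesis using i by simp
qed

text \<open>Both values are written as \<open>k\<close> times a quotient plus the component. By
  \<open>wseq_step\<close> the quotient grows exactly when the next label is not strictly to the
  right, which is the least growth that the rule allows; adding multiples of \<open>k\<close> thus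
  respects the rule precisely when the multiples do not decrease.\<close>

lemma wseq_compatible:
  assumes S: "S \<in> SYT L" and i: "1 \<le> i" "i < n"
  shows "(wseq L S i + k * d \<le> wseq L S (Suc i) + k * d' \<and>
    (wseq L S i + k * d = wseq L S (Suc i) + k * d' \<longrightarrow> strictly_right L S (Suc i) i)) \<longleftrightarrow> d \<le> d'"
proof -
  obtain m where m: "wseq L S i = k * m + comp_of L S i" using wseq_mod[OF S, of i] i by auto
  note m' = wseq_step[OF S i m]
  let ?s = "comp_of L S i" and ?s' = "comp_of L S (Suc i)"
  have s: "?s < k" "?s' < k" using comp_of_less[OF S] i by auto
  show ?thesis
  proof (cases "strictly_right L S (Suc i) i")
    case True
    then have "?s \<le> ?s'" by (auto simp: strictly_right_def)
    moreover have "wseq L S i + k * d = k * (m + d) + ?s" "wseq L S (Suc i) + k * d' = k * (m + d') + ?s'"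
      using m m' True by (auto simp: distrib_left)
    ultimately show ?thesis using True lex_le[OF s, of "m + d" "m + d'"] by auto
  next
    case False
    then have le: "?s' \<le> ?s" by (auto simp: strictly_right_def)
    have e: "wseq L S i + k * d = k * (m + d) + ?s" "wseq L S (Suc i) + k * d' = k * (Suc m + d') + ?s'"
      using m m' False by (auto simp: distrib_left)
    have "wseq L S i + k * d < wseq L S (Suc i) + k * d' \<longleftrightarrow> d \<le> d'"
      unfolding e lex_less[OF s] using le by auto
    then show ?thesis using False by auto
  qed
qed

lemma wseq_mono:
  assumes S: "S \<in> SYT L" and i: "1 \<le> i" "i < n"
  shows "wseq L S i \<le> wseq L S (Suc i)"
  using wseq_compatible[OF assms, of 0 0] by simp

text \<open>The sequence increases weakly, so its maximum sits at the last label. This ties the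
  bound on the values of a filling to the first entry of the excess.\<close>

lemma wdes_eq:
  assumes S: "S \<in> SYT L" and n: "n \<ge> 1"
  shows "wdes L S = wseq L S n"
proof -
  have mono: "wseq L S i \<le> wseq L S j" if "1 \<le> i" "i \<le> j" "j \<le> n" for i j
    using that(2,3)
  proof (induction j rule: dec_induct)
    case (step j)
    then have "wseq L S i \<le> wseq L S j" by simp
    also have "\<dots> \<le> wseq L S (Suc j)" using wseq_mono[OF S, of j] that(1) step by simp
    finally show ?case .
  qed simp
  show ?thesis unfolding wdes_def n_def[symmetric]
    by (rule Max_eqI) (use n mono in auto)
qed

end

text \<open>An admissible next value \<open>x\<close> has its residue prescribed, so only its
  quotient is free, and the rule for repetitions bounds that quotient from below by the one in
  \<open>wseq\<close> plus \<open>e\<close>. Along the labels this shows that every filling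
  dominates the minimal sequence by multiples of \<open>k\<close>.\<close>

lemma wseq_least:
  assumes S: "S \<in> SYT L" and i: "1 \<le> i" "i < sum_list (map sum_list L)"
    and x: "x mod length L = comp_of L S (Suc i)"
    and le: "wseq L S i + length L * e \<le> x"
    and eq: "wseq L S i + length L * e = x \<longrightarrow> strictly_right L S (Suc i) i"
  shows "\<exists>e'\<ge>e. x = wseq L S (Suc i) + length L * e'"
proof -
  let ?k = "length L" and ?s = "comp_of L S i" and ?s' = "comp_of L S (Suc i)"
  obtain m where m: "wseq L S i = ?k * m + ?s" using wseq_mod[OF S, of i] i by auto
  note m' = wseq_step[OF S i m]
  have s: "?s < ?k" "?s' < ?k" using comp_of_less[OF S] i by auto
  define a where "a = x div ?k"
  have xa: "x = ?k * a + ?s'" unfolding a_def x[symmetric] by simp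
  have w: "wseq L S i + ?k * e = ?k * (m + e) + ?s" using m by (simp add: distrib_left)
  define m' where "m' = (if strictly_right L S (Suc i) i then m else Suc m)"
  have "m' + e \<le> a"
  proof (cases "strictly_right L S (Suc i) i")
    case True
    then show ?thesis using le lex_le[OF s, of "m + e" a] unfolding w xa m'_def by auto
  next
    case False
    then have "?s' \<le> ?s" by (auto simp: strictly_right_def)
    moreover have "wseq L S i + ?k * e < x" using False le eq by auto
    ultimately show ?thesis using False lex_less[OF s, of "m + e" a] unfolding w xa m'_def by auto
  qed
  then have "e \<le> a - m'" "a = m' + (a - m')" by auto
  moreover have "x = wseq L S (Suc i) + ?k * (a - m')"
    unfolding wseq_step[OF S i m] m'_def[symmetric] using xa \<open>a = m' + (a - m')\<close>
    by (metis add.assoc add.commute distrib_left)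
  ultimately show ?thesis by blast
qed

text \<open>Tuples of semistandard tableaux in one alphabet of values: component \<open>i\<close>
  uses only values congruent to \<open>i\<close> modulo \<open>k\<close>, so that the entry
  \<open>s\<close> of its tableau appears as \<open>i + k * s\<close>.\<close>

definition fillings :: "nat list list \<Rightarrow> nat \<Rightarrow> (nat \<times> nat \<times> nat \<Rightarrow> nat) set" where
  "fillings L r = {V \<in> extensional (mcells L).
     (\<forall>i u c c'. c < c' \<and> (i, u, c) \<in> mcells L \<and> (i, u, c') \<in> mcells L \<longrightarrow> V (i, u, c) \<le> V (i, u, c')) \<and>
     (\<forall>i u u' c. u < u' \<and> (i, u, c) \<in> mcells L \<and> (i, u', c) \<in> mcells L \<longrightarrow> V (i, u, c) < V (i, u', c)) \<and>
     (\<forall>b\<in>mcells L. V b mod length L = fst b \<and> V b \<le> r)}"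

lemma fillingsD:
  assumes "V \<in> fillings L r"
  shows "c < c' \<Longrightarrow> (i, u, c) \<in> mcells L \<Longrightarrow> (i, u, c') \<in> mcells L \<Longrightarrow> V (i, u, c) \<le> V (i, u, c')"
    and "u < u' \<Longrightarrow> (i, u, c) \<in> mcells L \<Longrightarrow> (i, u', c) \<in> mcells L \<Longrightarrow> V (i, u, c) < V (i, u', c)"
    and "b \<in> mcells L \<Longrightarrow> V b mod length L = fst b"
    and "b \<in> mcells L \<Longrightarrow> V b \<le> r"
  using assms unfolding fillings_def by blast+

text \<open>The order by value, with ties broken from left to right, encoded in a single number. The
  multiplier exceeds every column index, so the lexicographic comparison applies.\<close>

definition read_key :: "nat list list \<Rightarrow> (nat \<times> nat \<times> nat \<Rightarrow> nat) \<Rightarrow> nat \<times> nat \<times> nat \<Rightarrow> nat" where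
  "read_key L V b = Suc (\<Sum>a\<in>mcells L. snd (snd a)) * V b + snd (snd b)"

lemma read_key_less:
  assumes "a \<in> mcells L" "b \<in> mcells L"
  shows "read_key L V a < read_key L V b \<longleftrightarrow> V a < V b \<or> V a = V b \<and> snd (snd a) < snd (snd b)"
proof -
  have "snd (snd a) < Suc (\<Sum>a\<in>mcells L. snd (snd a))" if "a \<in> mcells L" for a
    unfolding less_Suc_eq_le by (rule member_le_sum) (use that finite_mcells in auto)
  then show ?thesis unfolding read_key_def using assms by (intro lex_less) auto
qed

section \<open>The bijection between fillings and standard tableaux with an excess\<close>

context
  fixes L :: "nat list list" and k n r :: nat
  assumes k_def: "k = length L" and n_def: "n = sum_list (map sum_list L)" and k: "k > 0" and n: "n \<ge> 1"
begin

text \<open>Label \<open>i\<close> receives the excess \<open>d (n - i)\<close>. The reversal makes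
  a decreasing \<open>d\<close> add more to larger labels, and index \<open>n\<close>, where
  \<open>d\<close> must vanish, stands for a label 0 that does not occur.\<close>

definition filling_of :: "(nat \<times> nat \<times> nat \<Rightarrow> nat) \<Rightarrow> (nat \<Rightarrow> nat) \<Rightarrow> nat \<times> nat \<times> nat \<Rightarrow> nat" where
  "filling_of S d = restrict (\<lambda>b. wseq L S (S b) + k * d (n - S b)) (mcells L)"

definition tab_of :: "(nat \<times> nat \<times> nat \<Rightarrow> nat) \<Rightarrow> nat \<times> nat \<times> nat \<Rightarrow> nat" where
  "tab_of V = restrict (\<lambda>b. card {a \<in> mcells L. read_key L V a \<le> read_key L V b}) (mcells L)"

definition excess_of :: "(nat \<times> nat \<times> nat \<Rightarrow> nat) \<Rightarrow> (nat \<times> nat \<times> nat \<Rightarrow> nat) \<Rightarrow> nat \<Rightarrow> nat" where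
  "excess_of S V = (\<lambda>m. if m < n then (V (cell_of L S (n - m)) - wseq L S (n - m)) div k else 0)"

lemmas cell = cell_of[where L = L, folded n_def]

lemma SYT_bij: "S \<in> SYT L \<Longrightarrow> bij_betw S (mcells L) {1..n}"
  by (simp add: SYT_def n_def)

lemma wseq_mod': 
  assumes "S \<in> SYT L" "i \<in> {1..n}" shows "wseq L S i mod k = comp_of L S i"
proof -
  obtain m where "wseq L S i = k * m + comp_of L S i" using wseq_mod[of S L i] assms by (auto simp: k_def n_def)
  moreover have "comp_of L S i < k" using comp_of_less[of S L i] assms by (simp add: k_def n_def)
  ultimately show ?thesis by simp
qed

text \<open>It suffices to compare consecutive labels. Their values increase weakly; if the values
  agree, then so do the residues and hence the components, and strictly to the right then means a
  larger column.\<close>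

lemma filling_of_key:
  assumes S: "S \<in> SYT L" and d: "antimono d" and a: "a \<in> mcells L" and b: "b \<in> mcells L" and ab: "S a < S b"
  shows "read_key L (filling_of S d) a < read_key L (filling_of S d) b"
proof -
  let ?V = "filling_of S d" and ?c = "cell_of L S"
  have V: "?V (?c i) = wseq L S i + k * d (n - i)" if "i \<in> {1..n}" for i
    using cell(1,2)[OF S that] by (simp add: filling_of_def)
  have step: "read_key L ?V (?c i) < read_key L ?V (?c (Suc i))" if i: "1 \<le> i" "i < n" for i
  proof -
    have in': "i \<in> {1..n}" "Suc i \<in> {1..n}" using i by auto
    have "d (n - i) \<le> d (n - Suc i)" using d by (rule antimonoD) simp
    then have c: "?V (?c i) \<le> ?V (?c (Suc i))"
      "?V (?c i) = ?V (?c (Suc i)) \<longrightarrow> strictly_right L S (Suc i) i"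
      using wseq_compatible[OF S, of i "d (n - i)" "d (n - Suc i)"] i V[OF in'(1)] V[OF in'(2)]
      by (auto simp: k_def n_def)
    show ?thesis
    proof (cases "?V (?c i) = ?V (?c (Suc i))")
      case True
      then have "wseq L S i mod k = wseq L S (Suc i) mod k"
        using V[OF in'(1)] V[OF in'(2)] by (metis mod_mult_self2)
      then have "comp_of L S i = comp_of L S (Suc i)" using wseq_mod'[OF S] in' by simp
      then have "col_of L S i < col_of L S (Suc i)" using c True by (auto simp: strictly_right_def)
      then show ?thesis using True cell(1)[OF S] in' by (simp add: read_key_less col_of_def)
    next
      case False
      then show ?thesis using c cell(1)[OF S] in' by (simp add: read_key_less)
    qed
  qed
  have mono: "read_key L ?V (?c i) < read_key L ?V (?c j)" if "1 \<le> i" "Suc i \<le> j" "j \<le> n" for i j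
    using that(2,3)
  proof (induction j rule: dec_induct)
    case base
    then show ?case using step[of i] that(1) by simp
  next
    case (step j)
    then have "read_key L ?V (?c i) < read_key L ?V (?c j)" by simp
    also have "\<dots> < read_key L ?V (?c (Suc j))" using step.hyps step.prems that(1)
      by (intro \<open>\<And>i. 1 \<le> i \<Longrightarrow> i < n \<Longrightarrow> _ i < _ i\<close>) auto
    finally show ?case .
  qed
  have "S a \<in> {1..n}" "S b \<in> {1..n}" using cell(4)[OF S] a b by auto
  then show ?thesis using mono[of "S a" "S b"] ab cell(3)[OF S] a b by simp
qed

lemma wseq_le_wdes:
  assumes S: "S \<in> SYT L" and i: "i \<in> {1..n}" shows "wseq L S i \<le> wdes L S"
  unfolding wdes_def n_def[symmetric] by (rule Max_ge) (use i in auto)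

text \<open>The reading key yields both tableau conditions: within a column the second coordinate of
  the key is constant, so the value itself has to grow.\<close>

lemma filling_of_in:
  assumes S: "S \<in> SYT L" and d: "d \<in> excess (wdes L S) k n r"
  shows "filling_of S d \<in> fillings L r"
proof -
  let ?V = "filling_of S d"
  have anti: "antimono d" and dr: "wdes L S + k * d 0 \<le> r" using d by (auto simp: excess_def)
  note key = filling_of_key[OF S anti]
  have row: "?V (i, u, c) \<le> ?V (i, u, c')"
    if "c < c'" "(i, u, c) \<in> mcells L" "(i, u, c') \<in> mcells L" for i u c c'
  proof -
    have "S (i, u, c) < S (i, u, c')" using S that unfolding SYT_def by blast
    then show ?thesis using key[OF that(2,3)] that by (auto simp: read_key_less)
  qed
  have col: "?V (i, u, c) < ?V (i, u', c)"
    if "u < u'" "(i, u, c) \<in> mcells L" "(i, u', c) \<in> mcells L" for i u u' c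
  proof -
    have "S (i, u, c) < S (i, u', c)" using S that unfolding SYT_def by blast
    then show ?thesis using key[OF that(2,3)] that by (auto simp: read_key_less)
  qed
  have val: "?V b mod k = fst b \<and> ?V b \<le> r" if b: "b \<in> mcells L" for b
  proof -
    have Sb: "S b \<in> {1..n}" using cell(4)[OF S b] .
    have V: "?V b = wseq L S (S b) + k * d (n - S b)" using b by (simp add: filling_of_def)
    have "?V b mod k = comp_of L S (S b)" unfolding V using wseq_mod'[OF S Sb] by simp
    also have "\<dots> = fst b" using cell(3)[OF S b] by (simp add: comp_of_def)
    finally have "?V b mod k = fst b" .
    moreover have "d (n - S b) \<le> d 0" using anti by (rule antimonoD) simp
    then have "k * d (n - S b) \<le> k * d 0" by simp
    then have "?V b \<le> r" unfolding V using wseq_le_wdes[OF S Sb] dr by linarith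
    ultimately show ?thesis by simp
  qed
  have "?V \<in> extensional (mcells L)" by (simp add: filling_of_def)
  then show ?thesis unfolding fillings_def k_def[symmetric] using row col val by blast
qed

lemma tab_of_filling_of:
  assumes S: "S \<in> SYT L" and d: "d \<in> excess (wdes L S) k n r"
  shows "tab_of (filling_of S d) = S"
proof (rule extensionalityI)
  show "tab_of (filling_of S d) \<in> extensional (mcells L)" by (simp add: tab_of_def)
  show "S \<in> extensional (mcells L)" using S by (simp add: SYT_def)
  fix b assume b: "b \<in> mcells L"
  have anti: "antimono d" using d by (auto simp: excess_def)
  show "tab_of (filling_of S d) b = S b"
    using rank_unique[OF SYT_bij[OF S] filling_of_key[OF S anti] b] b by (simp add: tab_of_def)
qed

lemma excess_of_filling_of:
  assumes S: "S \<in> SYT L" and d: "d \<in> excess (wdes L S) k n r"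
  shows "excess_of S (filling_of S d) = d"
proof
  fix m
  show "excess_of S (filling_of S d) m = d m"
  proof (cases "m < n")
    case True
    then have i: "n - m \<in> {1..n}" by auto
    then show ?thesis using True cell(1,2)[OF S i] k by (simp add: excess_of_def filling_of_def)
  next
    case False
    then have "d m \<le> d n" using d antimonoD[of d n m] by (simp add: excess_def)
    then show ?thesis using False d by (simp add: excess_of_def excess_def)
  qed
qed

text \<open>The key is injective on the cells of a filling: equal values have equal residues and so
  lie in the same component, and two cells in one column of it cannot carry the same value.\<close>

lemma tab_of_rank:
  assumes V: "V \<in> fillings L r"
  shows "bij_betw (tab_of V) (mcells L) {1..n}"
    "a \<in> mcells L \<Longrightarrow> b \<in> mcells L \<Longrightarrow>
      tab_of V a < tab_of V b \<longleftrightarrow> read_key L V a < read_key L V b"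
proof -
  have inj: "inj_on (read_key L V) (mcells L)"
  proof (rule inj_onI)
    fix a b assume a: "a \<in> mcells L" and b: "b \<in> mcells L" and eq: "read_key L V a = read_key L V b"
    have e: "V a = V b" "snd (snd a) = snd (snd b)"
      using read_key_less[OF a b, of V] read_key_less[OF b a, of V] eq by auto
    have "fst a = fst b" using fillingsD(3)[OF V a] fillingsD(3)[OF V b] e(1) by simp
    obtain i u c where a': "a = (i, u, c)" by (cases a) auto
    obtain u' where b': "b = (i, u', c)" using a' e(2) \<open>fst a = fst b\<close> by (cases b) auto
    have "\<not> u < u'" "\<not> u' < u"
      using fillingsD(2)[OF V, of u u' i c] fillingsD(2)[OF V, of u' u i c] a b e(1) by (auto simp: a' b')
    then show "a = b" using a' b' by simp
  qed
  note rank = rank_bij[OF finite_mcells inj]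
  have "bij_betw (\<lambda>b. card {a \<in> mcells L. read_key L V a \<le> read_key L V b}) (mcells L) {1..n}"
    using rank(1) by (simp only: card_mcells n_def)
  then show "bij_betw (tab_of V) (mcells L) {1..n}"
    by (rule bij_betw_cong[THEN iffD1, rotated]) (simp add: tab_of_def)
  show "a \<in> mcells L \<Longrightarrow> b \<in> mcells L \<Longrightarrow>
      tab_of V a < tab_of V b \<longleftrightarrow> read_key L V a < read_key L V b"
    using rank(2)[of a b] by (simp add: tab_of_def)
qed

lemma tab_of_in:
  assumes V: "V \<in> fillings L r" shows "tab_of V \<in> SYT L"
proof -
  note R = tab_of_rank[OF V]
  have row: "tab_of V (i, u, c) < tab_of V (i, u, c')"
    if "c < c'" "(i, u, c) \<in> mcells L" "(i, u, c') \<in> mcells L" for i u c c'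
  proof -
    have "V (i, u, c) \<le> V (i, u, c')" using fillingsD(1)[OF V] that by blast
    then show ?thesis using that by (simp add: R(2) read_key_less) linarith
  qed
  have col: "tab_of V (i, u, c) < tab_of V (i, u', c)"
    if "u < u'" "(i, u, c) \<in> mcells L" "(i, u', c) \<in> mcells L" for i u u' c
  proof -
    have "V (i, u, c) < V (i, u', c)" using fillingsD(2)[OF V] that by blast
    then show ?thesis using that by (simp add: R(2) read_key_less)
  qed
  have "tab_of V \<in> extensional (mcells L)" by (simp add: tab_of_def)
  then show ?thesis unfolding SYT_def n_def[symmetric] using row col R(1) by blast
qed

text \<open>Induction along the labels. The first minimal value is the bare component, which any
  value with the right residue exceeds by a multiple of \<open>k\<close>; \<open>wseq_least\<close>
  carries this to the next label. Monotonicity of the multiples is then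
  \<open>wseq_compatible\<close>.\<close>

lemma filling_values:
  assumes V: "V \<in> fillings L r"
  defines "S \<equiv> tab_of V"
  shows "\<exists>e. (\<forall>i\<in>{1..n}. V (cell_of L S i) = wseq L S i + k * e i) \<and> (\<forall>i. 1 \<le> i \<and> i < n \<longrightarrow> e i \<le> e (Suc i))"
proof -
  have S: "S \<in> SYT L" unfolding S_def by (rule tab_of_in[OF V])
  define v where "v i = V (cell_of L S i)" for i
  have vmod: "v i mod k = comp_of L S i" if "i \<in> {1..n}" for i
    using fillingsD(3)[OF V cell(1)[OF S that]] by (simp add: v_def k_def comp_of_def)
  have step: "v i \<le> v (Suc i)" "v i = v (Suc i) \<longrightarrow> strictly_right L S (Suc i) i" if i: "1 \<le> i" "i < n" for i
  proof -
    have in': "i \<in> {1..n}" "Suc i \<in> {1..n}" using i by auto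
    note c = cell(1)[OF S in'(1)] cell(1)[OF S in'(2)]
    have "tab_of V (cell_of L S i) < tab_of V (cell_of L S (Suc i))"
      using cell(2)[OF S] in' unfolding S_def by simp
    then have lt: "v i < v (Suc i) \<or> v i = v (Suc i) \<and> col_of L S i < col_of L S (Suc i)"
      using tab_of_rank(2)[OF V c] read_key_less[OF c] by (simp add: v_def col_of_def)
    then show "v i \<le> v (Suc i)" by auto
    show "v i = v (Suc i) \<longrightarrow> strictly_right L S (Suc i) i"
    proof
      assume eq: "v i = v (Suc i)"
      then have "comp_of L S i = comp_of L S (Suc i)" using vmod[OF in'(1)] vmod[OF in'(2)] by simp
      then show "strictly_right L S (Suc i) i" using lt eq by (simp add: strictly_right_def)
    qed
  qed
  have ex: "1 \<le> i \<Longrightarrow> i \<le> n \<Longrightarrow> \<exists>e. v i = wseq L S i + k * e" for i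
  proof (induction i)
    case (Suc i)
    show ?case
    proof (cases "i = 0")
      case True
      have "v 1 mod k = comp_of L S 1" using vmod[of 1] n by simp
      then have "v 1 = comp_of L S 1 + k * (v 1 div k)" by (metis mod_mult_div_eq)
      then show ?thesis using True by auto
    next
      case False
      then obtain e where e: "v i = wseq L S i + k * e" using Suc by auto
      have i: "1 \<le> i" "i < n" using False Suc.prems by auto
      show ?thesis using wseq_least[OF S i[unfolded n_def], of "v (Suc i)" e] vmod[of "Suc i"] step[OF i] i e
        by (auto simp: k_def)
    qed
  qed simp
  \<comment> \<open>Neither the subtraction nor the division loses anything, by the existence
    statement \<open>ex\<close>.\<close>
  define e where "e i = (v i - wseq L S i) div k" for i
  have e: "v i = wseq L S i + k * e i" if "1 \<le> i" "i \<le> n" for i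
    using ex[OF that] k by (auto simp: e_def)
  have "e i \<le> e (Suc i)" if i: "1 \<le> i" "i < n" for i
    using wseq_compatible[OF S, of i "e i" "e (Suc i)"] i step[OF i] e[of i] e[of "Suc i"]
    by (simp add: k_def n_def)
  then show ?thesis using e unfolding v_def by (intro exI[of _ e]) auto
qed

lemma filling_of_inverse:
  assumes V: "V \<in> fillings L r"
  shows "excess_of (tab_of V) V \<in> excess (wdes L (tab_of V)) k n r"
    and "filling_of (tab_of V) (excess_of (tab_of V) V) = V"
proof -
  let ?S = "tab_of V"
  have S: "?S \<in> SYT L" by (rule tab_of_in[OF V])
  obtain e where e': "\<forall>i\<in>{1..n}. V (cell_of L ?S i) = wseq L ?S i + k * e i"
    and mono: "\<forall>i. 1 \<le> i \<and> i < n \<longrightarrow> e i \<le> e (Suc i)"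
    using filling_values[OF V] by (elim exE conjE)
  have e: "V (cell_of L ?S i) = wseq L ?S i + k * e i" if "i \<in> {1..n}" for i using e' that by simp
  have d: "excess_of ?S V m = (if m < n then e (n - m) else 0)" for m
    using e[of "n - m"] k by (simp add: excess_of_def)
  have "excess_of ?S V (Suc m) \<le> excess_of ?S V m" for m
    using mono[rule_format, of "n - Suc m"] by (cases "Suc m < n") (simp_all add: d Suc_diff_Suc)
  then have "antimono (excess_of ?S V)" by (simp add: antimono_iff_le_Suc)
  moreover have "excess_of ?S V n = 0" by (simp add: d)
  moreover have "wdes L ?S + k * excess_of ?S V 0 \<le> r"
  proof -
    \<comment> \<open>The last label has the minimal value \<open>wdes\<close> and the excess of
      index 0, so the bound in \<open>excess\<close> is the bound \<open>r\<close> on the value of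
      its cell.\<close>
    have "wdes L ?S + k * excess_of ?S V 0 = V (cell_of L ?S n)"
      using e[of n] n wdes_eq[OF S, folded n_def] by (simp add: d)
    also have "\<dots> \<le> r" using fillingsD(4)[OF V cell(1)[OF S, of n]] n by simp
    finally show ?thesis .
  qed
  ultimately show "excess_of ?S V \<in> excess (wdes L ?S) k n r" by (simp add: excess_def)
  show "filling_of ?S (excess_of ?S V) = V"
  proof (rule extensionalityI)
    show "filling_of ?S (excess_of ?S V) \<in> extensional (mcells L)" by (simp add: filling_of_def)
    show "V \<in> extensional (mcells L)" using V by (simp add: fillings_def)
    fix b assume b: "b \<in> mcells L"
    have i: "?S b \<in> {1..n}" using cell(4)[OF S b] .
    then have "n - ?S b < n" "n - (n - ?S b) = ?S b" by auto
    then show "filling_of ?S (excess_of ?S V) b = V b"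
      using e[OF i] b cell(3)[OF S b] by (simp add: filling_of_def d)
  qed
qed

lemma sum_filling_of:
  assumes S: "S \<in> SYT L"
  shows "(\<Sum>b\<in>mcells L. filling_of S d b) = wcomaj L S + k * (\<Sum>i<n. d i)"
proof -
  have "(\<Sum>b\<in>mcells L. filling_of S d b) = (\<Sum>b\<in>mcells L. (\<lambda>i. wseq L S i + k * d (n - i)) (S b))"
    by (rule sum.cong[OF refl]) (simp add: filling_of_def)
  also have "\<dots> = (\<Sum>i=1..n. wseq L S i + k * d (n - i))"
    by (rule sum.reindex_bij_betw[OF SYT_bij[OF S]])
  also have "\<dots> = wcomaj L S + k * (\<Sum>i=1..n. d (n - i))"
    by (simp add: wcomaj_def n_def sum.distrib sum_distrib_left)
  also have "(\<Sum>i=1..n. d (n - i)) = (\<Sum>i<n. d i)"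
    by (rule sum.reindex_bij_witness[of _ "\<lambda>i. n - i" "\<lambda>i. n - i"]) auto
  finally show ?thesis .
qed

lemma sum_fillings:
  fixes q :: "'a::comm_ring_1"
  shows "(\<Sum>V\<in>fillings L r. q ^ (\<Sum>b\<in>mcells L. V b)) =
    (\<Sum>(S, d)\<in>Sigma (SYT L) (\<lambda>S. excess (wdes L S) k n r). q ^ wcomaj L S * q ^ (k * (\<Sum>i<n. d i)))"
  by (rule sum.reindex_bij_witness[of _ "\<lambda>(S, d). filling_of S d" "\<lambda>V. (tab_of V, excess_of (tab_of V) V)"])
    (auto simp: filling_of_inverse tab_of_in filling_of_in tab_of_filling_of excess_of_filling_of
       simp flip: sum_filling_of power_add)

end

lemma finite_SYT: "finite (SYT L)"
proof (rule finite_subset)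
  show "SYT L \<subseteq> mcells L \<rightarrow>\<^sub>E {1..sum_list (map sum_list L)}"
    by (auto simp: SYT_def PiE_def bij_betw_def)
  show "finite (mcells L \<rightarrow>\<^sub>E {1..sum_list (map sum_list L)})"
    by (rule finite_PiE[OF finite_mcells]) simp
qed

text \<open>The quotient counts the numbers congruent to \<open>i\<close> modulo \<open>k\<close>
  that do not exceed \<open>r\<close>, hence the variables \<open>q ^ (i + k * s)\<close> available
  in \<open>t\<close>-degree \<open>r\<close>. For \<open>r < i\<close> it is 0.\<close>

lemma residue_bound:
  fixes i k r s :: nat
  assumes "i < k" shows "s < (r + k - i) div k \<longleftrightarrow> i + k * s \<le> r"
proof -
  have "s < (r + k - i) div k \<longleftrightarrow> Suc s * k \<le> r + k - i"
    using less_eq_div_iff_mult_less_eq[of k "Suc s" "r + k - i"] assms by (simp add: Suc_le_eq)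
  also have "\<dots> \<longleftrightarrow> i + k * s \<le> r" using assms by (auto simp: mult.commute)
  finally show ?thesis .
qed

text \<open>The entry \<open>s\<close> in component \<open>i\<close> is replaced by the exponent
  \<open>i + k * s\<close> of the power of \<open>q\<close> that it contributes, so the exponent of
  a whole tuple is the sum of its filling.\<close>

lemma schur_product_fillings:
  fixes q :: "'a::comm_ring_1"
  assumes k: "k = length L"
  shows "(\<Prod>i<k. schur_eval (L ! i) ((r + k - i) div k) (\<lambda>s. q ^ (i + k * s))) =
    (\<Sum>V\<in>fillings L r. q ^ (\<Sum>b\<in>mcells L. V b))"
proof -
  let ?SS = "\<lambda>i. {S \<in> ssyt (L ! i). \<forall>b\<in>cells (L ! i). S b < (r + k - i) div k}"
  define up where "up g = restrict (\<lambda>b. fst b + k * g (fst b) (snd b)) (mcells L)" for g :: "nat \<Rightarrow> nat \<times> nat \<Rightarrow> nat"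
  define down where "down V = (\<lambda>i\<in>{..<k}. \<lambda>b\<in>cells (L ! i). V (i, b) div k)" for V :: "nat \<times> nat \<times> nat \<Rightarrow> nat"
  have mc: "(i, b) \<in> mcells L \<longleftrightarrow> i < k \<and> b \<in> cells (L ! i)" for i b
    by (cases b) (simp add: mcells_def k)
  have up: "up g (i, b) = i + k * g i b" if "i < k" "b \<in> cells (L ! i)" for g i b
    using that by (simp add: up_def mc)
  have down: "down V i b = V (i, b) div k" if "i < k" "b \<in> cells (L ! i)" for V i b
    using that by (simp add: down_def)
  have "(\<Prod>i<k. schur_eval (L ! i) ((r + k - i) div k) (\<lambda>s. q ^ (i + k * s))) =
      (\<Sum>g\<in>PiE {..<k} ?SS. \<Prod>i<k. \<Prod>b\<in>cells (L ! i). q ^ (i + k * g i b))"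
    unfolding schur_eval_def by (rule prod_sum_PiE) (use finite_bounded_ssyt in auto)
  also have "\<dots> = (\<Sum>V\<in>fillings L r. q ^ (\<Sum>b\<in>mcells L. V b))"
  proof (rule sum.reindex_bij_witness[of _ down up], goal_cases)
    case (1 g)
    show ?case
    proof (rule PiE_ext)
      show "down (up g) \<in> PiE {..<k} (\<lambda>_. UNIV)" by (simp add: down_def)
      show "g \<in> PiE {..<k} (\<lambda>_. UNIV)" using 1 by (auto simp: PiE_def)
      fix i assume i: "i \<in> {..<k}"
      have gi: "g i \<in> extensional (cells (L ! i))" using 1 i by (auto simp: ssyt_def)
      show "down (up g) i = g i"
      proof (rule extensionalityI[OF _ gi])
        show "down (up g) i \<in> extensional (cells (L ! i))" using i by (simp add: down_def)
        fix b assume "b \<in> cells (L ! i)"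
        then show "down (up g) i b = g i b" using i by (simp add: down up)
      qed
    qed
  next
    case (2 g)
    have g: "g i \<in> ssyt (L ! i)" "\<And>b. b \<in> cells (L ! i) \<Longrightarrow> g i b < (r + k - i) div k" if "i < k" for i
      using 2 that by (auto simp: PiE_def Pi_def)
    have row: "up g (i, u, c) \<le> up g (i, u, c')"
      if "c < c'" "(i, u, c) \<in> mcells L" "(i, u, c') \<in> mcells L" for i u c c'
    proof -
      have "g i (u, c) \<le> g i (u, c')" using g(1)[of i] that unfolding ssyt_def mc by blast
      then show ?thesis using that by (simp add: mc up)
    qed
    have col: "up g (i, u, c) < up g (i, u', c)"
      if "u < u'" "(i, u, c) \<in> mcells L" "(i, u', c) \<in> mcells L" for i u u' c
    proof -
      have "g i (u, c) < g i (u', c)" using g(1)[of i] that unfolding ssyt_def mc by blast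
      then show ?thesis using that by (auto simp: mc up)
    qed
    have val: "up g b mod length L = fst b \<and> up g b \<le> r" if "b \<in> mcells L" for b
    proof (cases b rule: prod.exhaust)
      case (Pair i b')
      then have i: "i < k" "b' \<in> cells (L ! i)" using that by (auto simp: mc)
      then have "i + k * g i b' \<le> r" using g(2)[OF i] residue_bound[OF i(1)] by simp
      then show ?thesis using i Pair by (simp add: up flip: k)
    qed
    have "up g \<in> extensional (mcells L)" by (simp add: up_def)
    then show ?case unfolding fillings_def using row col val by blast
  next
    case (3 V)
    show ?case
    proof (rule extensionalityI)
      show "up (down V) \<in> extensional (mcells L)" by (simp add: up_def)
      show "V \<in> extensional (mcells L)" using 3 by (simp add: fillings_def)
      fix b assume b: "b \<in> mcells L"
      obtain i b' where [simp]: "b = (i, b')" by (cases b rule: prod.exhaust)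
      have i: "i < k" "b' \<in> cells (L ! i)" using b by (auto simp: mc)
      have "V b mod k = i" using fillingsD(3)[OF 3 b] by (simp add: k)
      then have "i + k * (V b div k) = V b" by (metis mod_mult_div_eq)
      then show "up (down V) b = V b" using i by (simp add: up down)
    qed
  next
    case (4 V)
    have step: "V (i, b) div k \<le> V (i, b') div k" if "V (i, b) \<le> V (i, b')" for i b b'
      using that by (rule div_le_mono)
    \<comment> \<open>Division by \<open>k\<close> could merge distinct values, but cells of one
      component share their residue.\<close>
    have strict: "V (i, b) div k < V (i, b') div k"
      if "V (i, b) < V (i, b')" "(i, b) \<in> mcells L" "(i, b') \<in> mcells L" for i b b'
    proof (rule ccontr)
      assume "\<not> ?thesis"
      then have "k * (V (i, b') div k) \<le> k * (V (i, b) div k)" by simp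
      moreover have "V (i, b) mod k = V (i, b') mod k"
        using fillingsD(3)[OF 4] that by (simp add: k)
      ultimately have "V (i, b') \<le> V (i, b)" 
        using mult_div_mod_eq[of k "V (i, b)"] mult_div_mod_eq[of k "V (i, b')"] by linarith
      then show False using that by simp
    qed
    have "down V i \<in> ?SS i" if i: "i < k" for i
    proof -
      have row: "down V i (u, c) \<le> down V i (u, c')"
        if "c < c'" "(u, c) \<in> cells (L ! i)" "(u, c') \<in> cells (L ! i)" for u c c'
        using fillingsD(1)[OF 4, of c c' i u] that i by (simp add: down mc step)
      have col: "down V i (u, c) < down V i (u', c)"
        if "u < u'" "(u, c) \<in> cells (L ! i)" "(u', c) \<in> cells (L ! i)" for u u' c
        using fillingsD(2)[OF 4, of u u' i c] strict[of i "(u, c)" "(u', c)"] that i by (simp add: down mc)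
      have "down V i \<in> extensional (cells (L ! i))" using i by (simp add: down_def)
      then have "down V i \<in> ssyt (L ! i)" unfolding ssyt_def using row col by blast
      moreover have "down V i b < (r + k - i) div k" if b: "b \<in> cells (L ! i)" for b
      proof -
        have m: "(i, b) \<in> mcells L" using i b by (simp add: mc)
        have "V (i, b) mod k = i" using fillingsD(3)[OF 4 m] by (simp add: k)
        then have "i + k * (V (i, b) div k) = V (i, b)" by (metis mod_mult_div_eq)
        then show ?thesis using fillingsD(4)[OF 4 m] residue_bound[OF i] by (simp add: down i b)
      qed
      ultimately show ?thesis by simp
    qed
    then show ?case by (auto simp: down_def PiE_def)
  next
    case (5 g)
    have "(\<Sum>b\<in>mcells L. up g b) = (\<Sum>i<k. \<Sum>b\<in>cells (L ! i). up g (i, b))"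
      unfolding mcells_Sigma k[symmetric] by (subst sum.Sigma) (use finite_cells in auto)
    also have "\<dots> = (\<Sum>i<k. \<Sum>b\<in>cells (L ! i). i + k * g i b)"
      by (rule sum.cong[OF refl], rule sum.cong[OF refl]) (simp add: up)
    finally show ?case by (simp add: power_sum)
  qed
  finally show ?thesis .
qed

text \<open>For each standard tableau the sum over excesses contributes the same denominator, which
  depends on \<open>k\<close> and \<open>n\<close> only; the numerator retains the minimal
  filling.\<close>

lemma schur_product_series:
  fixes q :: "'a::comm_ring_1"
  assumes "k = length L" "n = sum_list (map sum_list L)" "k > 0" "n \<ge> 1"
  shows "Abs_fps (\<lambda>r. \<Prod>i<k. schur_eval (L ! i) ((r + k - i) div k) (\<lambda>s. q ^ (i + k * s))) *
      ((1 - fps_X) * (\<Prod>j=1..n. 1 - fps_X ^ k * fps_const (q ^ (k * j)))) =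
    (\<Sum>S\<in>SYT L. fps_X ^ wdes L S * fps_const (q ^ wcomaj L S))"
    (is "?F * ?D = _")
proof -
  have "?F = (\<Sum>S\<in>SYT L. fps_const (q ^ wcomaj L S) * excess_series q (wdes L S) k n)"
  proof (rule fps_ext)
    fix r
    have "fps_nth ?F r = (\<Sum>(S, d)\<in>Sigma (SYT L) (\<lambda>S. excess (wdes L S) k n r).
        q ^ wcomaj L S * q ^ (k * (\<Sum>i<n. d i)))"
      unfolding fps_nth_Abs_fps by (rule trans[OF schur_product_fillings[OF assms(1)] sum_fillings[OF assms]])
    also have "\<dots> = (\<Sum>S\<in>SYT L. \<Sum>d\<in>excess (wdes L S) k n r. q ^ wcomaj L S * q ^ (k * (\<Sum>i<n. d i)))"
      by (rule sum.Sigma[symmetric]) (use finite_SYT finite_excess[OF assms(3)] in auto)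
    finally show "fps_nth ?F r = fps_nth (\<Sum>S\<in>SYT L. fps_const (q ^ wcomaj L S) * excess_series q (wdes L S) k n) r"
      by (simp add: fps_sum_nth excess_series_def sum_distrib_left)
  qed
  then have "?F * ?D = (\<Sum>S\<in>SYT L. fps_const (q ^ wcomaj L S) * (excess_series q (wdes L S) k n * ?D))"
    by (simp add: sum_distrib_right mult.assoc)
  also have "\<dots> = (\<Sum>S\<in>SYT L. fps_X ^ wdes L S * fps_const (q ^ wcomaj L S))"
    unfolding excess_series_closed[OF assms(3)] by (simp add: mult.commute)
  finally show ?thesis .
qed

section \<open>The statistics in the case of a single partition\<close>

lemma wseq_single:
  assumes S: "S \<in> SYT [l]" and i: "1 \<le> i" "i \<le> sum_list l"
  shows "wseq [l] S i = card {j \<in> descents l S. j < i}"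
  using i
proof (induction i)
  case (Suc i)
  have comp: "comp_of [l] S j = 0" if "j \<in> {1..sum_list l}" for j
    using comp_of_less[OF S, of j] that by simp
  show ?case
  proof (cases i)
    case 0
    have "{j \<in> descents l S. j < Suc 0} = {}" by (auto simp: descents_def)
    then show ?thesis using 0 comp[of 1] Suc.prems by simp
  next
    case (Suc i')
    then have IH: "wseq [l] S i = card {j \<in> descents l S. j < i}" using Suc.IH Suc.prems by simp
    have c: "comp_of [l] S i = 0" "comp_of [l] S (Suc i) = 0" using comp Suc.prems Suc by auto
    have fin: "finite {j \<in> descents l S. j < i}" by simp
    show ?thesis
    proof (cases "i \<in> descents l S")
      case True
      then have "{j \<in> descents l S. j < Suc i} = insert i {j \<in> descents l S. j < i}" by auto
      moreover have "\<not> strictly_right [l] S (Suc i) i" using True c by (auto simp: strictly_right_def descents_def)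
      ultimately show ?thesis using IH Suc c by simp
    next
      case False
      then have "{j \<in> descents l S. j < Suc i} = {j \<in> descents l S. j < i}" by (auto simp: less_Suc_eq)
      moreover have "strictly_right [l] S (Suc i) i"
        using False c Suc Suc.prems by (auto simp: strictly_right_def descents_def)
      ultimately show ?thesis using IH Suc c by simp
    qed
  qed
qed simp

lemma wdes_single:
  assumes S: "S \<in> SYT [l]" and n: "sum_list l \<ge> 1"
  shows "wdes [l] S = des l S"
proof -
  have "wdes [l] S = wseq [l] S (sum_list l)" using wdes_eq[OF S] n by simp
  also have "\<dots> = card {j \<in> descents l S. j < sum_list l}" using wseq_single[OF S] n by simp
  also have "{j \<in> descents l S. j < sum_list l} = descents l S" by (auto simp: descents_def)
  finally show ?thesis by (simp add: des_def)
qed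

text \<open>Double counting: the value at \<open>i\<close> is the number of descents before
  \<open>i\<close>, so a descent \<open>j\<close> is counted once for each of the
  \<open>n - j\<close> later labels.\<close>

lemma wcomaj_single:
  assumes S: "S \<in> SYT [l]"
  shows "wcomaj [l] S = comaj l S"
proof -
  let ?n = "sum_list l"
  have fin: "finite (descents l S)" by (rule finite_subset[of _ "{..<?n}"]) (auto simp: descents_def)
  have "wcomaj [l] S = (\<Sum>i=1..?n. card {j \<in> descents l S. j < i})"
    unfolding wcomaj_def by (rule sum.cong) (auto simp: wseq_single[OF S])
  also have "\<dots> = (\<Sum>i=1..?n. \<Sum>j\<in>descents l S. of_bool (j < i))"
    using fin by (simp add: Int_def conj_commute)
  also have "\<dots> = (\<Sum>j\<in>descents l S. \<Sum>i=1..?n. of_bool (j < i))" by (rule sum.swap)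
  also have "\<dots> = (\<Sum>j\<in>descents l S. ?n - j)"
  proof (rule sum.cong[OF refl])
    fix j
    have "{1..?n} \<inter> {i. j < i} = {Suc j..?n}" by auto
    then show "(\<Sum>i=1..?n. of_bool (j < i)) = ?n - j" by simp
  qed
  finally show ?thesis by (simp add: comaj_def)
qed

section \<open>The wreath product and its cycles\<close>

context
  fixes \<pi> :: "nat \<Rightarrow> nat" and n :: nat
  assumes perm: "\<pi> permutes {..<n}"
begin

lemma orbit_self: "i \<in> orbit \<pi> i"
  by (rule permutation_self_in_orbit) (use perm permutation_permutes in blast)

lemma orbit_eq: "j \<in> orbit \<pi> i \<Longrightarrow> orbit \<pi> j = orbit \<pi> i"
  by (rule orbit_cyclic_eq3[OF cyclic_on_orbit[OF perm]]) auto

lemma orbit_bounded: "i < n \<Longrightarrow> orbit \<pi> i \<subseteq> {..<n}"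
  using permutes_orbit_subset[OF perm] by auto

lemma orbit_fibre:
  assumes "C \<in> orbit \<pi> ` {..<n}" shows "{i \<in> {..<n}. orbit \<pi> i = C} = C"
proof -
  obtain i where i: "i < n" "C = orbit \<pi> i" using assms by auto
  show ?thesis
  proof
    show "{i \<in> {..<n}. orbit \<pi> i = C} \<subseteq> C" using orbit_self by auto
    show "C \<subseteq> {i \<in> {..<n}. orbit \<pi> i = C}"
      using orbit_eq[of _ i] orbit_bounded[OF i(1)] by (auto simp: i(2))
  qed
qed

lemma prod_over_orbits:
  fixes h :: "nat \<Rightarrow> 'a::comm_monoid_mult"
  shows "(\<Prod>C\<in>orbit \<pi> ` {..<n}. \<Prod>i\<in>C. h i) = (\<Prod>i<n. h i)"
proof -
  have "(\<Prod>C\<in>orbit \<pi> ` {..<n}. \<Prod>i\<in>C. h i) =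
      (\<Prod>C\<in>orbit \<pi> ` {..<n}. \<Prod>i\<in>{i \<in> {..<n}. orbit \<pi> i = C}. h i)"
    by (rule prod.cong[OF refl]) (simp only: orbit_fibre)
  also have "\<dots> = (\<Prod>i<n. h i)" by (rule prod.group) auto
  finally show ?thesis .
qed

lemma sum_card_orbits: "(\<Sum>C\<in>orbit \<pi> ` {..<n}. card C) = n"
proof -
  have "(\<Sum>C\<in>orbit \<pi> ` {..<n}. card C) = (\<Sum>C\<in>orbit \<pi> ` {..<n}. \<Sum>i\<in>{i \<in> {..<n}. orbit \<pi> i = C}. 1)"
    by (rule sum.cong[OF refl]) (simp add: orbit_fibre[simplified])
  also have "\<dots> = (\<Sum>i<n. 1)" by (rule sum.group) auto
  finally show ?thesis by simp
qed

text \<open>A word fixed by \<open>\<pi>\<close> is constant on each cycle, so it amounts to a free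
  choice of one letter per cycle. Expanding the product of sums lists these choices.\<close>

lemma sum_invariant_words:
  fixes w :: "nat \<Rightarrow> 'b \<Rightarrow> 'a::comm_ring_1"
  assumes F: "finite F"
  shows "(\<Sum>c | c \<in> {..<n} \<rightarrow>\<^sub>E F \<and> (\<forall>i<n. c (\<pi> i) = c i). \<Prod>i<n. w i (c i)) =
    (\<Prod>C\<in>orbit \<pi> ` {..<n}. \<Sum>x\<in>F. \<Prod>i\<in>C. w i x)"
proof -
  let ?\<C> = "orbit \<pi> ` {..<n}"
  have in_n: "\<pi> i < n \<longleftrightarrow> i < n" for i using permutes_in_image[OF perm, of i] by simp
  have const: "c j = c i" if "j \<in> orbit \<pi> i" "i < n" "\<forall>i<n. c (\<pi> i) = c i" for c :: "nat \<Rightarrow> 'b" and i j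
    using that(1)
  proof (induction rule: orbit.induct)
    case base
    then show ?case using that by simp
  next
    case (step j)
    have "j < n" using step.hyps orbit_bounded[OF that(2)] by auto
    then show ?case using step that(3) by simp
  qed
  have "(\<Prod>C\<in>?\<C>. \<Sum>x\<in>F. \<Prod>i\<in>C. w i x) = (\<Sum>g\<in>?\<C> \<rightarrow>\<^sub>E F. \<Prod>C\<in>?\<C>. \<Prod>i\<in>C. w i (g C))"
    by (rule prod_sum_PiE) (use F in auto)
  also have "\<dots> = (\<Sum>c | c \<in> {..<n} \<rightarrow>\<^sub>E F \<and> (\<forall>i<n. c (\<pi> i) = c i). \<Prod>i<n. w i (c i))"
  \<comment> \<open>The letter of a cycle is read off at an arbitrary representative; the choice has
    no effect, as the word is constant on the cycle.\<close>
  proof (rule sum.reindex_bij_witness[of _ "\<lambda>c. \<lambda>C\<in>?\<C>. c (SOME i. i \<in> C)" "\<lambda>g. \<lambda>i\<in>{..<n}. g (orbit \<pi> i)"],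
      goal_cases)
    case (1 g)
    have "g (orbit \<pi> (SOME i. i \<in> C)) = g C" "(SOME i. i \<in> C) < n" if C: "C \<in> ?\<C>" for C
    proof -
      obtain i where i: "i < n" "C = orbit \<pi> i" using C by auto
      have "(SOME i. i \<in> C) \<in> C" using orbit_self[of i] i by (auto intro: someI)
      then show "g (orbit \<pi> (SOME i. i \<in> C)) = g C" "(SOME i. i \<in> C) < n"
        using orbit_eq[of _ i] orbit_bounded[OF i(1)] i by auto
    qed
    then show ?case using 1 by (intro PiE_ext[of _ ?\<C> "\<lambda>_. F"]) (auto simp: PiE_def Pi_def)
  next
    case (2 g)
    have "orbit \<pi> (\<pi> i) = orbit \<pi> i" for i by (rule orbit_eq) (rule orbit.base)
    then show ?case using 2 in_n by (auto simp: PiE_def Pi_def)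
  next
    case (3 c)
    have "c (SOME j. j \<in> orbit \<pi> i) = c i" if "i < n" for i
    proof -
      have "(SOME j. j \<in> orbit \<pi> i) \<in> orbit \<pi> i" using orbit_self[of i] by (rule someI)
      then show ?thesis using const[OF _ that] 3 by simp
    qed
    then show ?case using 3 by (intro PiE_ext[of _ "{..<n}" "\<lambda>_. F"]) (auto simp: PiE_def Pi_def)
  next
    case (4 c)
    have "c (SOME j. j \<in> orbit \<pi> i) \<in> F" if "i < n" for i
    proof -
      have "(SOME j. j \<in> orbit \<pi> i) \<in> orbit \<pi> i" using orbit_self[of i] by (rule someI)
      then have "(SOME j. j \<in> orbit \<pi> i) < n" using orbit_bounded[OF that] by auto
      then show ?thesis using 4 by (auto simp: PiE_def Pi_def)
    qed
    then show ?case by auto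
  next
    case (5 g)
    have "(\<Prod>C\<in>?\<C>. \<Prod>i\<in>C. w i (g C)) = (\<Prod>C\<in>?\<C>. \<Prod>i\<in>C. w i (g (orbit \<pi> i)))"
    proof (rule prod.cong[OF refl], rule prod.cong[OF refl])
      fix C i assume "C \<in> ?\<C>" "i \<in> C"
      then have "orbit \<pi> i = C" using orbit_eq by auto
      then show "w i (g C) = w i (g (orbit \<pi> i))" by simp
    qed
    then show ?case by (simp add: prod_over_orbits)
  qed
  finally show ?thesis by simp
qed

end

section \<open>Roots of unity and their orthogonality\<close>

lemma unity_root_cis: "unity_root k j = cis (2 * pi * real j / real k)"
  by (simp add: unity_root_def cis_conv_exp mult_ac)

lemma bij_betw_unity_root:
  assumes "k > 0" shows "bij_betw (unity_root k) {..<k} {z. z ^ k = 1}"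
  using bij_betw_roots_unity[OF assms] by (simp add: unity_root_cis[abs_def])

lemma finite_roots: "k > 0 \<Longrightarrow> finite {z :: complex. z ^ k = 1}"
  using bij_betw_finite[OF bij_betw_unity_root[of k]] by simp

text \<open>Orthogonality of the characters of the cyclic group of order \<open>k\<close>. The
  summand is a power of \<open>z\<close>, and the sum over all roots is a geometric series that
  vanishes unless \<open>k\<close> divides the exponent.\<close>

lemma sum_roots_power:
  assumes k: "k > 0" and j: "j < k"
  shows "(\<Sum>z | z ^ k = 1. z ^ f * cnj (z ^ j)) = (if f mod k = j then of_nat k else (0 :: complex))"
proof -
  have unit: "z * cnj z = 1" if "z ^ k = 1" for z :: complex
  proof -
    have "norm z ^ k = 1" using that by (metis norm_one norm_power)
    then have "norm z = 1" using k power_eq_imp_eq_base[of "norm z" k 1] by simp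
    then show ?thesis using complex_norm_square[of z] by simp
  qed
  have full: "cis (2 * pi * real m) = 1" for m by (rule cis_multiple_2pi) simp
  then have full': "cis (2 * (pi * real m)) = 1" for m by (simp add: mult.assoc)
  \<comment> \<open>Conjugation inverts a root of unity. The shift by \<open>k\<close> keeps the
    exponent \<open>f - j\<close> natural and does not change the power.\<close>
  define e where "e = f + k - j"
  have summand: "z ^ f * cnj (z ^ j) = z ^ e" if z: "z ^ k = 1" for z :: complex
  proof -
    have A: "z ^ e * (z ^ j * cnj (z ^ j)) = z ^ f * z ^ k * cnj (z ^ j)"
      using j by (simp add: e_def mult.assoc[symmetric] power_add[symmetric])
    have B: "z ^ j * cnj (z ^ j) = 1"
      using unit[OF z] by (simp add: complex_cnj_power power_mult_distrib[symmetric])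
    show ?thesis using A unfolding B z by (simp only: mult_1_right)
  qed
  have "(\<Sum>z | z ^ k = 1. z ^ f * cnj (z ^ j)) = (\<Sum>z | z ^ k = (1::complex). z ^ e)"
    by (rule sum.cong) (use summand in auto)
  also have "\<dots> = (\<Sum>i<k. unity_root k i ^ e)"
    by (rule sum.reindex_bij_betw[OF bij_betw_unity_root[OF k], symmetric])
  also have "\<dots> = (\<Sum>i<k. unity_root k e ^ i)"
  proof (rule sum.cong[OF refl])
    fix i show "unity_root k i ^ e = unity_root k e ^ i"
      by (simp add: unity_root_cis DeMoivre mult_ac)
  qed
  also have "(\<Sum>i<k. unity_root k e ^ i) = (if k dvd e then of_nat k else 0)"
  proof (cases "k dvd e")
    case True
    then obtain m where "e = k * m" by auto
    then have "unity_root k e = 1" using k full' by (simp add: unity_root_cis)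
    then show ?thesis using True by simp
  next
    case False
    let ?z = "unity_root k e"
    have "?z = unity_root k (e mod k)"
    proof -
      have "real e = real k * real (e div k) + real (e mod k)"
        by (metis mult_div_mod_eq of_nat_add of_nat_mult)
      then have "2 * pi * real e / real k = 2 * pi * real (e div k) + 2 * pi * real (e mod k) / real k"
        using k by (simp add: field_simps)
      then show ?thesis by (simp only: unity_root_cis cis_mult[symmetric] full mult_1)
    qed
    moreover have "unity_root k (e mod k) \<noteq> unity_root k 0"
      using inj_on_eq_iff[OF bij_betw_imp_inj_on[OF bij_betw_unity_root[OF k]], of "e mod k" 0] k False
      by (simp add: dvd_eq_mod_eq_0)
    moreover have "unity_root k 0 = 1" by (simp add: unity_root_def)
    ultimately have ne: "?z \<noteq> 1" by simp
    have "?z ^ k = 1"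
      using k full' by (simp add: unity_root_cis DeMoivre)
    then show ?thesis using False ne by (simp add: geometric_sum)
  qed
  also have "k dvd e \<longleftrightarrow> f mod k = j"
  proof -
    have ie: "int e = int f - int j + int k" using j by (simp add: e_def)
    have "k dvd e \<longleftrightarrow> int k dvd int f - int j + int k"
      unfolding ie[symmetric] by simp
    also have "\<dots> \<longleftrightarrow> int f mod int k = int j mod int k" by (simp add: mod_eq_dvd_iff)
    also have "\<dots> \<longleftrightarrow> f mod k = j" using j by (simp flip: zmod_int)
    finally show ?thesis .
  qed
  finally show ?thesis .
qed

section \<open>Wreath elements as a permutation together with a root of unity in each row\<close>

definition monomial_mat :: "nat \<Rightarrow> (nat \<Rightarrow> nat) \<Rightarrow> (nat \<Rightarrow> complex) \<Rightarrow> complex mat" where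
  "monomial_mat n \<pi> u = mat n n (\<lambda>(i, j). if j = \<pi> i then u i else 0)"

lemma perm_of_props:
  assumes \<sigma>: "\<sigma> \<in> wreath k n" and i: "i < n"
  shows "perm_of \<sigma> i < n" "\<sigma> $$ (i, perm_of \<sigma> i) \<noteq> 0"
    "j < n \<Longrightarrow> \<sigma> $$ (i, j) \<noteq> 0 \<Longrightarrow> j = perm_of \<sigma> i"
proof -
  have dim: "dim_row \<sigma> = n" "dim_col \<sigma> = n" using \<sigma> by (auto simp: wreath_def)
  have ex: "\<exists>!j. j < n \<and> \<sigma> $$ (i, j) \<noteq> 0" using \<sigma> i by (auto simp: wreath_def)
  have p: "perm_of \<sigma> i = (THE j. j < n \<and> \<sigma> $$ (i, j) \<noteq> 0)" using i by (simp add: perm_of_def dim)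
  show "perm_of \<sigma> i < n" "\<sigma> $$ (i, perm_of \<sigma> i) \<noteq> 0"
    using theI'[OF ex] by (auto simp: p)
  show "j < n \<Longrightarrow> \<sigma> $$ (i, j) \<noteq> 0 \<Longrightarrow> j = perm_of \<sigma> i"
    unfolding p using the1_equality[OF ex] by simp
qed

lemma perm_of_permutes:
  assumes \<sigma>: "\<sigma> \<in> wreath k n" shows "perm_of \<sigma> permutes {..<n}"
proof (rule bij_imp_permutes)
  have inj: "inj_on (perm_of \<sigma>) {..<n}"
  proof (rule inj_onI)
    fix i i' assume i: "i \<in> {..<n}" "i' \<in> {..<n}" and eq: "perm_of \<sigma> i = perm_of \<sigma> i'"
    let ?j = "perm_of \<sigma> i"
    have "?j < n" using perm_of_props(1)[OF \<sigma>] i by simp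
    then have "\<exists>!i. i < n \<and> \<sigma> $$ (i, ?j) \<noteq> 0" using \<sigma> by (simp add: wreath_def)
    moreover have "\<sigma> $$ (i, ?j) \<noteq> 0" using perm_of_props(2)[OF \<sigma>] i by simp
    moreover have "\<sigma> $$ (i', ?j) \<noteq> 0" unfolding eq using perm_of_props(2)[OF \<sigma>] i by simp
    ultimately show "i = i'" using i by (elim ex1E) (metis lessThan_iff)
  qed
  moreover have "perm_of \<sigma> ` {..<n} \<subseteq> {..<n}" using perm_of_props(1)[OF \<sigma>] by auto
  ultimately show "bij_betw (perm_of \<sigma>) {..<n} {..<n}"
    by (simp add: bij_betw_def endo_inj_surj)
  show "perm_of \<sigma> i = i" if "i \<notin> {..<n}" for i
  proof -
    have "dim_row \<sigma> = n" using \<sigma> by (auto simp: wreath_def)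
    then show ?thesis using that by (simp add: perm_of_def)
  qed
qed

lemma entry_root:
  assumes \<sigma>: "\<sigma> \<in> wreath k n" and i: "i < n" shows "entry \<sigma> i ^ k = 1"
  using \<sigma> i perm_of_props(1,2)[OF assms] by (simp add: wreath_def entry_def)

lemma monomial_mat_props:
  assumes \<pi>: "\<pi> permutes {..<n}" and u: "u \<in> {..<n} \<rightarrow>\<^sub>E {z. z ^ k = 1}" and k: "k > 0"
  shows "monomial_mat n \<pi> u \<in> wreath k n" "perm_of (monomial_mat n \<pi> u) = \<pi>"
    "restrict (entry (monomial_mat n \<pi> u)) {..<n} = u"
proof -
  let ?M = "monomial_mat n \<pi> u"
  have in_n: "\<pi> i < n \<longleftrightarrow> i < n" for i using permutes_in_image[OF \<pi>, of i] by simp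
  have u1: "u i ^ k = 1" if "i < n" for i using u that by (auto simp: PiE_def Pi_def)
  then have u0: "u i \<noteq> 0" if "i < n" for i using that k by (metis power_eq_0_iff zero_neq_one)
  have ent: "?M $$ (i, j) = (if j = \<pi> i then u i else 0)" if "i < n" "j < n" for i j
    using that by (simp add: monomial_mat_def)
  have nz: "?M $$ (i, j) \<noteq> 0 \<longleftrightarrow> j = \<pi> i" if "i < n" "j < n" for i j
    using that u0 by (simp add: ent)
  have row: "\<exists>!j. j < n \<and> ?M $$ (i, j) \<noteq> 0" if "i < n" for i
    by (rule ex1I[of _ "\<pi> i"]) (use that nz in_n in auto)
  have col: "\<exists>!i. i < n \<and> ?M $$ (i, j) \<noteq> 0" if j: "j < n" for j
  proof -
    have "j \<in> \<pi> ` {..<n}" using permutes_image[OF \<pi>] j by simp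
    then obtain i where i: "i < n" "j = \<pi> i" by auto
    show ?thesis
    proof (rule ex1I[of _ i])
      show "i < n \<and> ?M $$ (i, j) \<noteq> 0" using nz[OF i(1) j] i by simp
      fix i' assume "i' < n \<and> ?M $$ (i', j) \<noteq> 0"
      then have "\<pi> i' = \<pi> i" using nz[of i' j] i j by auto
      then show "i' = i" using permutes_inj[OF \<pi>] by (simp add: inj_eq)
    qed
  qed
  have root: "(?M $$ (i, j)) ^ k = 1"
    if "i < n" "j < n" "?M $$ (i, j) \<noteq> 0" for i j
    using that nz[OF that(1,2)] u1 by (simp add: ent)
  have dim: "?M \<in> carrier_mat n n" by (simp add: monomial_mat_def)
  show w: "?M \<in> wreath k n"
    unfolding wreath_def using dim row col root by blast
  show p: "perm_of (?M) = \<pi>"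
  proof
    fix i show "perm_of (?M) i = \<pi> i"
    proof (cases "i < n")
      case True
      then show ?thesis using perm_of_props(3)[OF w True, of "\<pi> i"] nz in_n by simp
    next
      case False
      then show ?thesis using permutes_not_in[OF \<pi>, of i] dim by (simp add: perm_of_def)
    qed
  qed
  show "restrict (entry (?M)) {..<n} = u"
  proof (rule extensionalityI)
    show "u \<in> extensional {..<n}" using u by (simp add: PiE_def)
    fix i assume "i \<in> {..<n}"
    then show "restrict (entry (?M)) {..<n} i = u i"
      using in_n by (simp add: entry_def p ent)
  qed simp
qed

lemma monomial_mat_inverse:
  assumes \<sigma>: "\<sigma> \<in> wreath k n"
  shows "monomial_mat n (perm_of \<sigma>) (restrict (entry \<sigma>) {..<n}) = \<sigma>"
proof (rule eq_matI)
  have dim: "dim_row \<sigma> = n" "dim_col \<sigma> = n" using \<sigma> by (auto simp: wreath_def)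
  show "dim_row (monomial_mat n (perm_of \<sigma>) (restrict (entry \<sigma>) {..<n})) = dim_row \<sigma>"
    "dim_col (monomial_mat n (perm_of \<sigma>) (restrict (entry \<sigma>) {..<n})) = dim_col \<sigma>"
    by (simp_all add: monomial_mat_def dim)
  fix i j assume "i < dim_row \<sigma>" "j < dim_col \<sigma>"
  then have ij: "i < n" "j < n" by (simp_all add: dim)
  show "monomial_mat n (perm_of \<sigma>) (restrict (entry \<sigma>) {..<n}) $$ (i, j) = \<sigma> $$ (i, j)"
    using ij perm_of_props(3)[OF \<sigma> ij(1,2)] by (auto simp: monomial_mat_def entry_def)
qed

text \<open>Splits a sum over the wreath product into a sum over permutations and independent sums
  over the entries. The restriction of \<open>entry\<close> makes the second component an element of
  the extensional function space.\<close>

lemma bij_betw_wreath: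
  assumes "k > 0"
  shows "bij_betw (\<lambda>\<sigma>. (perm_of \<sigma>, restrict (entry \<sigma>) {..<n})) (wreath k n)
    ({\<pi>. \<pi> permutes {..<n}} \<times> ({..<n} \<rightarrow>\<^sub>E {z. z ^ k = 1}))"
proof (rule bij_betw_byWitness[where f' = "\<lambda>(\<pi>, u). monomial_mat n \<pi> u"])
  let ?m = "\<lambda>(\<pi>, u). monomial_mat n \<pi> u" and ?f = "\<lambda>\<sigma>. (perm_of \<sigma>, restrict (entry \<sigma>) {..<n})"
  let ?A = "{\<pi>. \<pi> permutes {..<n}} \<times> ({..<n} \<rightarrow>\<^sub>E {z. z ^ k = (1::complex)})"
  show "\<forall>\<sigma>\<in>wreath k n. ?m (perm_of \<sigma>, restrict (entry \<sigma>) {..<n}) = \<sigma>"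
    by (simp add: monomial_mat_inverse)
  show "\<forall>p\<in>?A. (perm_of (?m p),
      restrict (entry (?m p)) {..<n}) = p"
    using monomial_mat_props(2,3)[OF _ _ assms] by (simp add: split_paired_all)
  show "?f ` wreath k n \<subseteq> ?A"
  proof
    fix p assume "p \<in> ?f ` wreath k n"
    then obtain \<sigma> where \<sigma>: "\<sigma> \<in> wreath k n" and p: "p = (perm_of \<sigma>, restrict (entry \<sigma>) {..<n})"
      by (elim imageE)
    have "restrict (entry \<sigma>) {..<n} \<in> {..<n} \<rightarrow>\<^sub>E {z. z ^ k = 1}"
      by (rule restrict_PiE_iff[THEN iffD2]) (simp add: entry_root[OF \<sigma>])
    then show "p \<in> ?A" using perm_of_permutes[OF \<sigma>] unfolding p by simp
  qed
  show "?m ` ?A \<subseteq> wreath k n"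
  proof
    fix \<sigma> assume "\<sigma> \<in> ?m ` ?A"
    then obtain p where p: "p \<in> ?A" and \<sigma>: "\<sigma> = ?m p" by (elim imageE)
    obtain \<pi> u where pu: "p = (\<pi>, u)" by (cases p)
    show "\<sigma> \<in> wreath k n" using p monomial_mat_props(1)[OF _ _ assms] unfolding \<sigma> pu by simp
  qed
qed

lemma finite_wreath: "k > 0 \<Longrightarrow> finite (wreath k n)"
  using bij_betw_finite[OF bij_betw_wreath] finite_roots
  by (simp add: finite_permutations finite_PiE)

section \<open>Cycle types\<close>

lemma cycles_of_eq: "\<sigma> \<in> wreath k n \<Longrightarrow> cycles_of \<sigma> = orbit (perm_of \<sigma>) ` {..<n}"
  by (auto simp: cycles_of_def wreath_def)

lemma prod_unity_roots:
  fixes g :: "complex \<Rightarrow> 'b \<Rightarrow> 'a::comm_monoid_mult"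
  assumes k: "k > 0" and fin: "finite \<C>" and roots: "\<And>C. C \<in> \<C> \<Longrightarrow> P C ^ k = 1"
  shows "(\<Prod>r<k. \<Prod>C\<in>{C \<in> \<C>. P C = unity_root k r}. g (unity_root k r) C) = (\<Prod>C\<in>\<C>. g (P C) C)"
proof -
  have "(\<Prod>r<k. \<Prod>C\<in>{C \<in> \<C>. P C = unity_root k r}. g (unity_root k r) C) =
      (\<Prod>z\<in>{z. z ^ k = 1}. \<Prod>C\<in>{C \<in> \<C>. P C = z}. g z C)"
    by (rule prod.reindex_bij_betw[OF bij_betw_unity_root[OF k]])
  also have "\<dots> = (\<Prod>z\<in>{z. z ^ k = 1}. \<Prod>C\<in>{C \<in> \<C>. P C = z}. g (P C) C)"
    by (rule prod.cong[OF refl], rule prod.cong[OF refl]) auto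
  also have "\<dots> = (\<Prod>C\<in>\<C>. g (P C) C)"
    by (rule prod.group) (use fin finite_roots[OF k] roots in auto)
  finally show ?thesis .
qed

lemma entry_prod_root:
  assumes "\<sigma> \<in> wreath k n" "C \<in> cycles_of \<sigma>" shows "(\<Prod>i\<in>C. entry \<sigma> i) ^ k = 1"
proof -
  have "C \<subseteq> {..<n}"
    using assms orbit_bounded[OF perm_of_permutes[OF assms(1)]] by (auto simp: cycles_of_eq)
  then have "(\<Prod>i\<in>C. entry \<sigma> i ^ k) = 1" using entry_root[OF assms(1)] by (intro prod.neutral) auto
  then show ?thesis by (simp add: prod_power_distrib)
qed

lemma cycle_type_nth:
  assumes "r < k"
  shows "mset (cycle_type k \<sigma> ! r) =
    image_mset card (mset_set {C \<in> cycles_of \<sigma>. (\<Prod>i\<in>C. entry \<sigma> i) = unity_root k r})"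
  using assms by (simp add: cycle_type_def)

lemma finite_cycles_of: "finite (cycles_of \<sigma>)"
proof -
  have "cycles_of \<sigma> = orbit (perm_of \<sigma>) ` {..<dim_row \<sigma>}" by (auto simp: cycles_of_def)
  then show ?thesis by simp
qed

text \<open>The product of the entries along a cycle is a \<open>k\<close>-th root of unity, so each
  cycle is recorded in exactly one component of the cycle type. This translates \<open>Pbar\<close>
  and the \<open>q\<close>-integers into products over cycles.\<close>

lemma prod_cycle_type:
  fixes g :: "complex \<Rightarrow> nat \<Rightarrow> 'a::comm_monoid_mult"
  assumes k: "k > 0" and \<sigma>: "\<sigma> \<in> wreath k n"
  shows "(\<Prod>r<k. \<Prod>l<length (cycle_type k \<sigma> ! r). g (unity_root k r) (cycle_type k \<sigma> ! r ! l)) =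
    (\<Prod>C\<in>cycles_of \<sigma>. g (\<Prod>i\<in>C. entry \<sigma> i) (card C))"
proof -
  have "(\<Prod>l<length xs. h (xs ! l)) = (\<Prod>x\<in>#mset xs. h x)" for xs and h :: "nat \<Rightarrow> 'a"
    by (induction xs) (simp_all add: prod.lessThan_Suc_shift del: prod.lessThan_Suc)
  then have "(\<Prod>r<k. \<Prod>l<length (cycle_type k \<sigma> ! r). g (unity_root k r) (cycle_type k \<sigma> ! r ! l)) =
      (\<Prod>r<k. \<Prod>C\<in>{C \<in> cycles_of \<sigma>. (\<Prod>i\<in>C. entry \<sigma> i) = unity_root k r}. g (unity_root k r) (card C))"
    by (intro prod.cong[OF refl]) (simp add: cycle_type_nth multiset.map_comp comp_def prod_unfold_prod_mset)
  also have "\<dots> = (\<Prod>C\<in>cycles_of \<sigma>. g (\<Prod>i\<in>C. entry \<sigma> i) (card C))"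
    by (rule prod_unity_roots[OF k finite_cycles_of]) (rule entry_prod_root[OF \<sigma>])
  finally show ?thesis .
qed

lemma cycle_type_in:
  assumes k: "k > 0" and \<sigma>: "\<sigma> \<in> wreath k n"
  shows "cycle_type k \<sigma> \<in> multipartitions k n"
proof -
  let ?L = "cycle_type k \<sigma>"
  let ?K = "\<lambda>z. {C \<in> cycles_of \<sigma>. (\<Prod>i\<in>C. entry \<sigma> i) = z}"
  have len: "length ?L = k" by (simp add: cycle_type_def)
  have pos: "0 < card C" if "C \<in> cycles_of \<sigma>" for C
    using that orbit_self[OF perm_of_permutes[OF \<sigma>]] orbit_bounded[OF perm_of_permutes[OF \<sigma>]]
    by (auto simp: cycles_of_eq[OF \<sigma>] card_gt_0_iff intro: finite_subset[OF _ finite_lessThan])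
  have part: "l \<in> partitions (sum_list l)" if l: "l \<in> set ?L" for l
  proof -
    obtain r where r: "r < k" "l = ?L ! r" using l len by (auto simp: in_set_conv_nth)
    have "sorted_wrt (\<ge>) l" using r by (simp add: cycle_type_def sorted_wrt_rev)
    moreover have "0 \<notin> set l"
    proof
      assume "0 \<in> set l"
      then have "0 \<in># mset (?L ! r)" by (simp add: r)
      then obtain C where "C \<in> cycles_of \<sigma>" "card C = 0"
        using finite_cycles_of[of \<sigma>] by (auto simp: cycle_type_nth[OF r(1)] simp del: set_mset_mset)
      then show False using pos[of C] by simp
    qed
    ultimately show ?thesis by (simp add: partitions_def)
  qed
  have "sum_list (map sum_list ?L) = (\<Sum>r<k. sum_list (?L ! r))"
    by (simp add: sum_list_sum_nth len lessThan_atLeast0)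
  also have "\<dots> = (\<Sum>r<k. \<Sum>C\<in>?K (unity_root k r). card C)"
  proof (rule sum.cong[OF refl])
    fix r assume "r \<in> {..<k}"
    then have "sum_mset (mset (?L ! r)) = (\<Sum>C\<in>?K (unity_root k r). card C)"
      by (simp add: cycle_type_nth sum_unfold_sum_mset)
    then show "sum_list (?L ! r) = (\<Sum>C\<in>?K (unity_root k r). card C)" by (simp add: sum_mset_sum_list)
  qed
  also have "\<dots> = (\<Sum>z | z ^ k = 1. \<Sum>C\<in>?K z. card C)"
    by (rule sum.reindex_bij_betw[OF bij_betw_unity_root[OF k]])
  also have "\<dots> = (\<Sum>C\<in>cycles_of \<sigma>. card C)"
    by (rule sum.group) (use finite_cycles_of finite_roots[OF k] entry_prod_root[OF \<sigma>] in auto)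
  also have "\<dots> = n" using sum_card_orbits[OF perm_of_permutes[OF \<sigma>]] by (simp add: cycles_of_eq[OF \<sigma>])
  finally show ?thesis using len part by (simp add: multipartitions_def)
qed

section \<open>The trace on the graded pieces\<close>

lemma poly_mapping_expand: "p = (\<Sum>m\<in>keys p. single m (lookup p m))"
proof (rule poly_mapping_eqI)
  fix m
  have "lookup (\<Sum>m\<in>keys p. single m (lookup p m)) m =
      (\<Sum>m'\<in>keys p. if m' = m then lookup p m else 0)"
    unfolding lookup_sum by (rule sum.cong[OF refl]) (auto simp: lookup_single when_def)
  then show "lookup p m =
      lookup (\<Sum>m\<in>keys p. single m (lookup p m)) m"
    by (simp add: in_keys_iff)
qed

lemma pol_scale_lookup: "lookup (pol_scale c p) m = c * lookup p m"
proof -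
  have "pol_scale c p = (\<Sum>m\<in>keys p. single m (c * lookup p m))"
    unfolding pol_scale_def by (subst (1) poly_mapping_expand[of p]) (simp add: sum_distrib_left mult_single)
  then have "lookup (pol_scale c p) m =
      (\<Sum>m'\<in>keys p. lookup (single m' (c * lookup p m')) m)"
    by (simp add: lookup_sum)
  also have "\<dots> = (\<Sum>m'\<in>keys p. if m' = m then c * lookup p m else 0)"
    by (rule sum.cong[OF refl]) (auto simp: lookup_single when_def)
  finally show ?thesis by (auto simp: in_keys_iff)
qed

abbreviation xmon :: "(pvar \<Rightarrow>\<^sub>0 nat) \<Rightarrow> mpol" where
  "xmon m \<equiv> single m 1"

lemma pol_expand: "p = (\<Sum>m\<in>keys p. pol_scale (lookup p m) (xmon m))"
  using poly_mapping_expand[of p] by (simp add: pol_scale_def mult_single)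

lemma span_xmon: "mpol.span (xmon ` M) = {p :: mpol. keys p \<subseteq> M}"
proof
  have "mpol.subspace {p :: mpol. keys p \<subseteq> M}"
    by (rule mpol.subspaceI)
      (auto simp: in_keys_iff subset_iff lookup_add pol_scale_lookup, metis add.right_neutral)
  moreover have "xmon ` M \<subseteq> {p :: mpol. keys p \<subseteq> M}" by auto
  ultimately show "mpol.span (xmon ` M) \<subseteq> {p :: mpol. keys p \<subseteq> M}"
    by (intro mpol.span_minimal)
  show "{p :: mpol. keys p \<subseteq> M} \<subseteq> mpol.span (xmon ` M)"
  proof
    fix p :: mpol assume p: "p \<in> {p :: mpol. keys p \<subseteq> M}"
    have "(\<Sum>m\<in>keys p. pol_scale (lookup p m) (xmon m)) \<in> mpol.span (xmon ` M)"
      by (rule mpol.span_sum, rule mpol.span_scale, rule mpol.span_base) (use p in auto)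
    then show "p \<in> mpol.span (xmon ` M)" by (simp only: pol_expand[symmetric])
  qed
qed

lemma inj_xmon: "inj xmon"
  by (rule injI) (metis keys_single singleton_inject zero_neq_one)

lemma xmon_eq_iff: "xmon m = xmon m' \<longleftrightarrow> m = m'"
  using injD[OF inj_xmon, of m m'] by auto

lemma independent_xmon: "mpol.independent (xmon ` M)"
proof
  assume "mpol.dependent (xmon ` M)"
  then obtain t u where t: "finite t" "t \<subseteq> xmon ` M" and sum: "(\<Sum>v\<in>t. pol_scale (u v) v) = 0"
    and ex: "\<exists>v\<in>t. u v \<noteq> 0"
    unfolding mpol.dependent_explicit by auto
  obtain m where m: "xmon m \<in> t" "u (xmon m) \<noteq> 0" using ex t(2) by auto
  have "0 = lookup (\<Sum>v\<in>t. pol_scale (u v) v) m" by (simp add: sum)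
  also have "\<dots> = (\<Sum>v\<in>t. u v * lookup v m)" by (simp add: lookup_sum pol_scale_lookup)
  also have "\<dots> = (\<Sum>v\<in>t. if v = xmon m then u v else 0)"
  proof (rule sum.cong[OF refl])
    fix v assume "v \<in> t"
    then obtain m' where "v = xmon m'" using t(2) by auto
    then show "u v * lookup v m = (if v = xmon m then u v else 0)"
      by (auto simp: lookup_single when_def xmon_eq_iff)
  qed
  also have "\<dots> = u (xmon m)" using m t(1) by simp
  finally show False using m by simp
qed

definition expo :: "nat \<Rightarrow> nat \<Rightarrow> (nat \<Rightarrow> nat) \<Rightarrow> pvar \<Rightarrow>\<^sub>0 nat" where
  "expo n d c = single T d + (\<Sum>i<n. single (X i) (c i))"

lemma lookup_expo:
  "lookup (expo n d c) T = d"
  "lookup (expo n d c) (X i) = (if i < n then c i else 0)"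
proof -
  show "lookup (expo n d c) T = d"
    by (simp add: expo_def lookup_add lookup_sum lookup_single when_def)
  have "lookup (expo n d c) (X i) = (\<Sum>j<n. if j = i then c i else 0)"
    by (auto simp: expo_def lookup_add lookup_sum lookup_single when_def intro!: sum.cong)
  then show "lookup (expo n d c) (X i) = (if i < n then c i else 0)" by simp
qed

lemma expo_eq_iff: "expo n d c = expo n d' c' \<longleftrightarrow> d = d' \<and> (\<forall>i<n. c i = c' i)"
proof
  assume eq: "expo n d c = expo n d' c'"
  have "c i = c' i" if "i < n" for i
    using arg_cong[OF eq, of "\<lambda>m. lookup m (X i)"] that by (simp add: lookup_expo)
  moreover have "d = d'" using arg_cong[OF eq, of "\<lambda>m. lookup m T"] by (simp add: lookup_expo)
  ultimately show "d = d' \<and> (\<forall>i<n. c i = c' i)" by simp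
qed (auto simp: expo_def intro!: sum.cong)

lemma prod_single:
  "(\<Prod>i\<in>A. single (f i) (g i)) =
    single (\<Sum>i\<in>A. f i :: 'v \<Rightarrow>\<^sub>0 nat) (\<Prod>i\<in>A. g i :: complex)"
  by (induction A rule: infinite_finite_induct) (simp_all add: mult_single)

lemma single_power:
  "single (single v 1) (a :: complex) ^ c =
    single (single v (c :: nat)) (a ^ c)"
  by (induction c) (simp_all add: mult_single flip: single_add)

lemma scaled_monomial:
  "pol_var T ^ d * (\<Prod>i<n. pol_scale (u i) (pol_var (X (\<pi> i))) ^ c i) =
    single (single T d + (\<Sum>i<n. single (X (\<pi> i)) (c i))) (\<Prod>i<n. u i ^ c i)"
proof -
  have "pol_scale (u i) (pol_var (X (\<pi> i))) ^ c i =
      single (single (X (\<pi> i)) (c i)) (u i ^ c i)" for i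
    using single_power[of "X (\<pi> i)" "u i" "c i"] by (simp add: pol_scale_def pol_var_def mult_single)
  moreover have "pol_var T ^ d = single (single T d) 1"
    using single_power[of T 1 d] by (simp add: pol_var_def)
  ultimately show ?thesis by (simp add: prod_single mult_single)
qed

lemma cube_algebra_eq:
  "cube_algebra n = {p. keys p \<subseteq> {expo n d c | d c. \<forall>i<n. c i \<le> d}}"
proof -
  have scale1: "pol_scale 1 p = p" for p by (simp add: pol_scale_def single_one)
  have mon: "pol_var T ^ d * (\<Prod>i<n. pol_var (X i) ^ c i) = xmon (expo n d c)" for d c
    using scaled_monomial[of d "\<lambda>_. 1" "\<lambda>i. i" c n] by (simp add: scale1 expo_def)
  have "{pol_var T ^ d * (\<Prod>i<n. pol_var (X i) ^ c i) | d c. \<forall>i<n. c i \<le> d} =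
      xmon ` {expo n d c | d c. \<forall>i<n. c i \<le> d}"
    unfolding mon by auto
  then show ?thesis unfolding cube_algebra_def by (simp only: span_xmon)
qed

text \<open>Extensional functions, so that distinct words give distinct monomials; they index the
  monomial basis of a bigraded piece.\<close>

definition words :: "nat \<Rightarrow> nat \<Rightarrow> nat \<Rightarrow> (nat \<Rightarrow> nat) set" where
  "words n d e = {c \<in> {..<n} \<rightarrow>\<^sub>E {..d}. (\<Sum>i<n. c i) = e}"

lemma finite_words: "finite (words n d e)"
  by (rule finite_subset[of _ "{..<n} \<rightarrow>\<^sub>E {..d}"]) (auto simp: words_def finite_PiE)

lemma bigraded_piece_eq:
  "bigraded_piece n d e = {p. keys p \<subseteq> expo n d ` words n d e}"
proof -
  define C where "C = {expo n d c | d c. \<forall>i<n. c i \<le> d}"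
  have iff: "(m \<in> C \<and> lookup m T = d \<and>
      (\<Sum>i<n. lookup m (X i)) = e) \<longleftrightarrow> m \<in> expo n d ` words n d e" for m
  proof
    assume m: "m \<in> C \<and> lookup m T = d \<and>
      (\<Sum>i<n. lookup m (X i)) = e"
    then obtain c where c: "m = expo n d c" "\<forall>i<n. c i \<le> d" by (auto simp: lookup_expo C_def)
    have "m = expo n d (restrict c {..<n})" by (simp add: c expo_eq_iff)
    moreover have "restrict c {..<n} \<in> words n d e"
      using m c by (auto simp: words_def lookup_expo)
    ultimately show "m \<in> expo n d ` words n d e" by simp
  next
    assume "m \<in> expo n d ` words n d e"
    then obtain c where c: "m = expo n d c" "c \<in> words n d e" by (elim imageE)
    have "\<forall>i<n. c i \<le> d" using c by (auto simp: words_def PiE_def Pi_def)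
    moreover have "(\<Sum>i<n. c i) = e" using c by (simp add: words_def)
    ultimately show "m \<in> C \<and> lookup m T = d \<and>
      (\<Sum>i<n. lookup m (X i)) = e" using c by (auto simp: lookup_expo C_def)
  qed
  show ?thesis
  proof (rule Set.set_eqI)
    fix p
    have "p \<in> bigraded_piece n d e \<longleftrightarrow> (\<forall>m\<in>keys p. m \<in> C \<and>
        lookup m T = d \<and> (\<Sum>i<n. lookup m (X i)) = e)"
      by (simp only: bigraded_piece_def cube_algebra_eq C_def[symmetric] mem_Collect_eq subset_eq ball_conj_distrib)
    then show "p \<in> bigraded_piece n d e \<longleftrightarrow> p \<in> {p. keys p \<subseteq> expo n d ` words n d e}"
      by (simp only: iff mem_Collect_eq subset_eq)
  qed
qed

lemma act_linear: "Vector_Spaces.linear pol_scale pol_scale (act \<sigma>)"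
proof -
  define A where "A m = pol_var T ^ lookup m T * (\<Prod>i<dim_row \<sigma>.
      pol_scale (entry \<sigma> i) (pol_var (X (perm_of \<sigma> i))) ^ lookup m (X i))" for m
  \<comment> \<open>The definition of \<open>act\<close> sums over the support of its argument. Zero
    coefficients allow any larger finite set instead, and additivity follows on a common
    one.\<close>
  have act: "act \<sigma> p = (\<Sum>m\<in>K. pol_scale (lookup p m) (A m))"
    if "finite K" "keys p \<subseteq> K" for K p
    unfolding act_def A_def[symmetric]
    by (rule sum.mono_neutral_left) (use that in \<open>auto simp: in_keys_iff\<close>)
  have add: "act \<sigma> (p + q) = act \<sigma> p + act \<sigma> q" for p q
  proof -
    let ?K = "keys p \<union> keys q"
    have "act \<sigma> (p + q) = (\<Sum>m\<in>?K. pol_scale (lookup (p + q) m) (A m))"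
      by (rule act) (auto simp: in_keys_iff lookup_add)
    also have "\<dots> = (\<Sum>m\<in>?K. pol_scale (lookup p m) (A m)) + (\<Sum>m\<in>?K. pol_scale (lookup q m) (A m))"
      by (simp add: lookup_add mpol.scale_left_distrib sum.distrib)
    also have "\<dots> = act \<sigma> p + act \<sigma> q" by (simp add: act[of ?K])
    finally show ?thesis .
  qed
  have scale: "act \<sigma> (pol_scale c p) = pol_scale c (act \<sigma> p)" for c p
  proof -
    have "act \<sigma> (pol_scale c p) = (\<Sum>m\<in>keys p. pol_scale (lookup (pol_scale c p) m) (A m))"
      by (rule act) (auto simp: in_keys_iff pol_scale_lookup)
    also have "\<dots> = pol_scale c (\<Sum>m\<in>keys p. pol_scale (lookup p m) (A m))"
      by (simp add: pol_scale_lookup mpol.scale_sum_right)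
    finally show ?thesis by (simp add: act[of "keys p"])
  qed
  show ?thesis by unfold_locales (use add scale in auto)
qed

text \<open>The exponent \<open>c i\<close> travels with its variable to position
  \<open>perm_of \<sigma> i\<close>, so position \<open>i\<close> receives the exponent from its
  preimage.\<close>

lemma act_monom:
  assumes \<sigma>: "\<sigma> \<in> wreath k n"
  shows "act \<sigma> (xmon (expo n d c)) =
    pol_scale (\<Prod>i<n. entry \<sigma> i ^ c i) (xmon (expo n d (\<lambda>i. c (Hilbert_Choice.inv (perm_of \<sigma>) i))))"
proof -
  let ?\<pi> = "perm_of \<sigma>"
  have \<pi>: "?\<pi> permutes {..<n}" by (rule perm_of_permutes[OF \<sigma>])
  have dim: "dim_row \<sigma> = n" using \<sigma> by (auto simp: wreath_def)
  have scale1: "pol_scale 1 p = p" for p by (simp add: pol_scale_def single_one)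
  have "act \<sigma> (xmon (expo n d c)) =
      pol_var T ^ d * (\<Prod>i<n. pol_scale (entry \<sigma> i) (pol_var (X (?\<pi> i))) ^ c i)"
    by (simp add: act_def dim lookup_expo scale1)
  also have "\<dots> = single (single T d + (\<Sum>i<n. single (X (?\<pi> i)) (c i)))
      (\<Prod>i<n. entry \<sigma> i ^ c i)" by (rule scaled_monomial)
  also have "(\<Sum>i<n. single (X (?\<pi> i)) (c i)) =
      (\<Sum>i<n. single (X i) (c (Hilbert_Choice.inv ?\<pi> i)))"
    using sum.permute[OF \<pi>, of "\<lambda>i. single (X i) (c (Hilbert_Choice.inv ?\<pi> i))"]
    by (simp add: comp_def permutes_inverses(2)[OF \<pi>])
  finally show ?thesis by (simp add: expo_def pol_scale_def mult_single)
qed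

text \<open>In the monomial basis \<open>\<sigma>\<close> acts as a permutation with scalars, and
  only the monomials that it maps to multiples of themselves meet the diagonal.\<close>

lemma trace_bigraded_piece:
  assumes \<sigma>: "\<sigma> \<in> wreath k n"
  shows "mpol.trace_on (bigraded_piece n d e) (act \<sigma>) =
    (\<Sum>c | c \<in> words n d e \<and> (\<forall>i<n. c (perm_of \<sigma> i) = c i). \<Prod>i<n. entry \<sigma> i ^ c i)"
proof -
  let ?\<pi> = "perm_of \<sigma>"
  let ?\<iota> = "Hilbert_Choice.inv ?\<pi>" and ?W = "words n d e"
  let ?B = "xmon ` expo n d ` ?W"
  have \<pi>: "?\<pi> permutes {..<n}" by (rule perm_of_permutes[OF \<sigma>])
  have in_n: "?\<iota> i < n" if "i < n" for i
    using permutes_in_image[OF permutes_inv[OF \<pi>], of i] that by simp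
  have span: "mpol.span ?B = bigraded_piece n d e" by (simp only: span_xmon bigraded_piece_eq)
  have fin: "finite ?B" using finite_words by simp
  have moved: "xmon (expo n d (\<lambda>i. c (?\<iota> i))) \<in> ?B" if c: "c \<in> ?W" for c
  proof -
    let ?c = "restrict (\<lambda>i. c (?\<iota> i)) {..<n}"
    have "(\<Sum>i<n. ?c i) = (\<Sum>i<n. c (?\<iota> i))" by simp
    also have "\<dots> = (\<Sum>i<n. c i)"
      using sum.permute[OF permutes_inv[OF \<pi>], of c] by (simp add: comp_def)
    finally have "(\<Sum>i<n. ?c i) = e" using c by (simp add: words_def)
    moreover have "?c \<in> {..<n} \<rightarrow>\<^sub>E {..d}" using c in_n by (auto simp: words_def PiE_def Pi_def)
    ultimately have "?c \<in> ?W" by (simp add: words_def)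
    moreover have "expo n d (\<lambda>i. c (?\<iota> i)) = expo n d ?c" by (simp add: expo_eq_iff)
    ultimately show ?thesis by simp
  qed
  interpret lin: Vector_Spaces.linear pol_scale pol_scale "act \<sigma>" by (rule act_linear)
  have "act \<sigma> b \<in> mpol.span ?B" if b: "b \<in> ?B" for b
  proof -
    obtain c where c: "c \<in> ?W" "b = xmon (expo n d c)" using b by auto
    show ?thesis unfolding c(2) act_monom[OF \<sigma>]
      by (intro mpol.span_scale mpol.span_base moved c)
  qed
  then have "act \<sigma> ` mpol.span ?B \<subseteq> mpol.span ?B"
    unfolding lin.span_image[symmetric] by (intro mpol.span_minimal mpol.subspace_span) auto
  then have inv: "act \<sigma> ` bigraded_piece n d e \<subseteq> bigraded_piece n d e" by (simp only: span)
  have "mpol.trace_on (bigraded_piece n d e) (act \<sigma>) = (\<Sum>b\<in>?B. mpol.representation ?B (act \<sigma> b) b)"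
    by (rule mpol.trace_on_eq[OF independent_xmon span fin act_linear inv])
  also have "\<dots> = (\<Sum>c\<in>?W. mpol.representation ?B (act \<sigma> (xmon (expo n d c))) (xmon (expo n d c)))"
  proof -
    have "inj_on (expo n d) ?W"
    proof (rule inj_onI)
      fix c c' assume c: "c \<in> ?W" "c' \<in> ?W" and "expo n d c = expo n d c'"
      then have "\<forall>i<n. c i = c' i" by (simp add: expo_eq_iff)
      then show "c = c'" using c by (intro PiE_ext[of c "{..<n}" "\<lambda>_. {..d}"]) (auto simp: words_def)
    qed
    moreover have "inj_on xmon (expo n d ` ?W)" using inj_xmon by (rule inj_on_subset) simp
    ultimately show ?thesis by (simp add: sum.reindex o_def)
  qed
  also have "\<dots> = (\<Sum>c\<in>?W. if \<forall>i<n. c (?\<pi> i) = c i then \<Prod>i<n. entry \<sigma> i ^ c i else 0)"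
  proof (rule sum.cong[OF refl])
    fix c assume c: "c \<in> ?W"
    have if_mult: "P * (if Q then 1 else 0) = (if Q then P else 0)" for P :: complex and Q by simp
    let ?m = "expo n d (\<lambda>i. c (?\<iota> i))"
    have "mpol.representation ?B (act \<sigma> (xmon (expo n d c))) (xmon (expo n d c)) =
        (\<Prod>i<n. entry \<sigma> i ^ c i) * mpol.representation ?B (xmon ?m) (xmon (expo n d c))"
      unfolding act_monom[OF \<sigma>]
      by (subst mpol.representation_scale[OF independent_xmon]) (use moved[OF c] mpol.span_base in auto)
    also have "mpol.representation ?B (xmon ?m) (xmon (expo n d c)) =
        (if xmon ?m = xmon (expo n d c) then 1 else 0)"
      by (subst mpol.representation_basis[OF independent_xmon moved[OF c]]) auto
    also have "xmon ?m = xmon (expo n d c) \<longleftrightarrow> (\<forall>i<n. c (?\<pi> i) = c i)"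
    proof -
      have "xmon ?m = xmon (expo n d c) \<longleftrightarrow> (\<forall>i<n. c (?\<iota> i) = c i)"
        by (simp add: xmon_eq_iff expo_eq_iff)
      also have "\<dots> \<longleftrightarrow> (\<forall>i<n. c (?\<pi> i) = c i)"
      proof safe
        fix i assume A: "\<forall>i<n. c (?\<iota> i) = c i" and i: "i < n"
        have "?\<pi> i < n" using permutes_in_image[OF \<pi>, of i] i by simp
        then show "c (?\<pi> i) = c i" using A permutes_inverses(2)[OF \<pi>, of i] by force
      next
        fix i assume A: "\<forall>i<n. c (?\<pi> i) = c i" and i: "i < n"
        have "c (?\<pi> (?\<iota> i)) = c (?\<iota> i)" 
          by (rule A[rule_format, OF in_n[OF i]])
        then show "c (?\<iota> i) = c i" by (simp add: permutes_inverses(1)[OF \<pi>])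
      qed
      finally show ?thesis .
    qed
    finally show "mpol.representation ?B (act \<sigma> (xmon (expo n d c))) (xmon (expo n d c)) =
        (if \<forall>i<n. c (?\<pi> i) = c i then \<Prod>i<n. entry \<sigma> i ^ c i else 0)" by (simp only: if_mult)
  qed
  also have "\<dots> = (\<Sum>c | c \<in> ?W \<and> (\<forall>i<n. c (?\<pi> i) = c i). \<Prod>i<n. entry \<sigma> i ^ c i)"
    using finite_words[of n d e] by (simp add: sum.If_cases Int_def)
  finally show ?thesis .
qed

section \<open>The Frobenius characteristic\<close>

lemma fps_const_prod: "fps_const (\<Prod>i\<in>A. f i) = (\<Prod>i\<in>A. fps_const (f i :: 'a::comm_ring_1))"
  by (induction A rule: infinite_finite_induct) (simp_all flip: fps_const_mult)

text \<open>Collecting the traces for all \<open>e\<close> weighs a fixed word by \<open>q\<close>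
  to the sum of its letters, and \<open>sum_invariant_words\<close> then factors the sum over the
  cycles.\<close>

lemma character_orbits:
  assumes \<sigma>: "\<sigma> \<in> wreath k n"
  shows "fps_nth (cube_character n \<sigma>) d =
    (\<Prod>C\<in>cycles_of \<sigma>. \<Sum>x\<le>d. \<Prod>i\<in>C. (fps_const (entry \<sigma> i) * fps_X) ^ x)"
proof (rule fps_ext)
  fix e
  let ?inv = "\<lambda>c. \<forall>i<n. c (perm_of \<sigma> i) = c i"
  let ?I = "{c. c \<in> {..<n} \<rightarrow>\<^sub>E {..d} \<and> ?inv c}"
  have fin: "finite ?I" by (rule finite_subset[of _ "{..<n} \<rightarrow>\<^sub>E {..d}"]) (auto simp: finite_PiE)
  have word: "(\<Prod>i<n. (fps_const (entry \<sigma> i) * fps_X) ^ c i) =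
      fps_const (\<Prod>i<n. entry \<sigma> i ^ c i) * fps_X ^ (\<Sum>i<n. c i)" for c
    by (simp add: power_mult_distrib prod.distrib fps_const_prod power_sum fps_const_power)
  have "fps_nth (\<Prod>C\<in>cycles_of \<sigma>. \<Sum>x\<le>d. \<Prod>i\<in>C. (fps_const (entry \<sigma> i) * fps_X) ^ x) e =
      fps_nth (\<Sum>c\<in>?I. \<Prod>i<n. (fps_const (entry \<sigma> i) * fps_X) ^ c i) e"
    unfolding cycles_of_eq[OF \<sigma>]
    by (subst sum_invariant_words[OF perm_of_permutes[OF \<sigma>]]) auto
  also have "\<dots> = (\<Sum>c\<in>?I. if (\<Sum>i<n. c i) = e then \<Prod>i<n. entry \<sigma> i ^ c i else 0)"
    unfolding word fps_sum_nth by (rule sum.cong[OF refl]) (simp add: fps_X_power_nth)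
  also have "\<dots> = (\<Sum>c | c \<in> words n d e \<and> ?inv c. \<Prod>i<n. entry \<sigma> i ^ c i)"
    by (rule sum.mono_neutral_cong_right[OF fin]) (auto simp: words_def)
  also have "\<dots> = fps_nth (fps_nth (cube_character n \<sigma>) d) e"
    by (simp add: cube_character_def trace_bigraded_piece[OF \<sigma>])
  finally show "fps_nth (fps_nth (cube_character n \<sigma>) d) e =
      fps_nth (\<Prod>C\<in>cycles_of \<sigma>. \<Sum>x\<le>d. \<Prod>i\<in>C. (fps_const (entry \<sigma> i) * fps_X) ^ x) e" by simp
qed

text \<open>A cycle with constant letter \<open>x\<close> contributes the \<open>x\<close>-th power
  of its product of entries times \<open>q\<close> to its length. The factor of the cycle is thus a
  \<open>q\<close>-integer at the twisted argument of the theorem.\<close>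

lemma character_q_int:
  assumes \<sigma>: "\<sigma> \<in> wreath k n"
  shows "fps_nth (cube_character n \<sigma>) d =
    (\<Prod>C\<in>cycles_of \<sigma>. q_int (d + 1) (fps_const (\<Prod>i\<in>C. entry \<sigma> i) * fps_X ^ card C))"
proof -
  have "(\<Sum>x\<le>d. \<Prod>i\<in>C. (fps_const (entry \<sigma> i) * fps_X) ^ x) =
      q_int (d + 1) (fps_const (\<Prod>i\<in>C. entry \<sigma> i) * fps_X ^ card C)" for C
    by (simp add: q_int_def prod_power_distrib[symmetric] prod.distrib fps_const_prod lessThan_Suc_atMost)
  then show ?thesis by (simp only: character_orbits[OF \<sigma>])
qed

lemma finite_multipartitions: "finite (multipartitions k n)"
proof (rule finite_subset)
  show "multipartitions k n \<subseteq> {L. set L \<subseteq> (\<Union>m\<le>n. partitions m) \<and> length L = k}"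
  proof
    fix L assume L: "L \<in> multipartitions k n"
    have "l \<in> (\<Union>m\<le>n. partitions m)" if l: "l \<in> set L" for l
    proof -
      have "sum_list l \<le> sum_list (map sum_list L)" using l by (intro member_le_sum_list) auto
      then have "sum_list l \<le> n" using L by (simp add: multipartitions_def)
      moreover have "l \<in> partitions (sum_list l)" using L l by (simp add: multipartitions_def)
      ultimately show ?thesis by auto
    qed
    then show "L \<in> {L. set L \<subseteq> (\<Union>m\<le>n. partitions m) \<and> length L = k}"
      using L by (auto simp: multipartitions_def)
  qed
  show "finite {L. set L \<subseteq> (\<Union>m\<le>n. partitions m) \<and> length L = k}"
    by (rule finite_lists_length_eq) (simp add: finite_partitions)
qed

definition sconst :: "complex \<Rightarrow> symf" where
  "sconst z = mfps_const (fps_const z)"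

lemma sconst_simps:
  "sconst 0 = 0" "sconst 1 = 1" "sconst (a * b) = sconst a * sconst b"
  "sconst (of_nat m) = of_nat m"
proof -
  show "sconst 0 = 0" by (simp add: sconst_def mfps_const_simps)
  show "sconst 1 = 1" by (simp add: sconst_def mfps_const_simps)
  show "sconst (a * b) = sconst a * sconst b"
    by (simp add: sconst_def mfps_const_simps flip: fps_const_mult)
  have "fps_const (of_nat m :: complex) = of_nat m" by (simp add: fps_of_nat)
  then show "sconst (of_nat m) = of_nat m" by (simp add: sconst_def mfps_const_of_nat)
qed

lemma sconst_sum: "sconst (\<Sum>x\<in>A. f x) = (\<Sum>x\<in>A. sconst (f x))"
  unfolding sconst_def
  by (induction A rule: infinite_finite_induct) (simp_all add: mfps_const_simps flip: fps_const_add)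

lemma sconst_prod: "sconst (\<Prod>x\<in>A. f x) = (\<Prod>x\<in>A. sconst (f x))"
  by (simp add: sconst_def fps_const_prod mfps_const_prod)

lemma sconst_power: "sconst (a ^ m) = sconst a ^ m"
  by (induction m) (simp_all add: sconst_simps)

lemma frobenius_nth:
  "fps_nth (frobenius k n \<chi>) d = sconst (1 / (fact n * of_nat k ^ n)) *
    (\<Sum>\<sigma>\<in>wreath k n. mfps_const (fps_nth (\<chi> \<sigma>) d) * Pbar (cycle_type k \<sigma>))"
proof -
  have "scalar_series (fps_const c) = fps_const (mfps_const c)" for c
    by (auto simp: fps_eq_iff scalar_series_def mfps_const_simps)
  then show ?thesis by (simp add: frobenius_def fps_sum_nth scalar_series_def sconst_def)
qed

lemma frobenius_by_classes:
  assumes k: "k > 0"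
  shows "frobenius k n (cube_character n) = Abs_fps (\<lambda>d. \<Sum>L\<in>multipartitions k n.
    mfps_const (\<Prod>i<k. \<Prod>j<length (L ! i).
      q_int (d + 1) (fps_const (unity_root k i) * fps_X ^ (L ! i ! j))) *
    (mfps_const (fps_const (1 / Zcoeff k n L)) * Pbar L))"
proof (rule fps_ext, unfold fps_nth_Abs_fps)
  fix d
  define H :: "nat list list \<Rightarrow> symf" where "H L = mfps_const (\<Prod>i<k. \<Prod>j<length (L ! i).
      q_int (d + 1) (fps_const (unity_root k i) * fps_X ^ (L ! i ! j)))" for L
  let ?a = "fact n * of_nat k ^ n :: complex"
  have char: "mfps_const (fps_nth (cube_character n \<sigma>) d) = H (cycle_type k \<sigma>)" if \<sigma>: "\<sigma> \<in> wreath k n" for \<sigma>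
    using prod_cycle_type[OF k \<sigma>, of "\<lambda>u c. q_int (d + 1) (fps_const u * fps_X ^ c)"]
    by (simp only: H_def character_q_int[OF \<sigma>])
  have "(\<Sum>\<sigma>\<in>wreath k n. mfps_const (fps_nth (cube_character n \<sigma>) d) * Pbar (cycle_type k \<sigma>)) =
      (\<Sum>\<sigma>\<in>wreath k n. H (cycle_type k \<sigma>) * Pbar (cycle_type k \<sigma>))"
    by (rule sum.cong[OF refl]) (simp only: char)
  also have "\<dots> = (\<Sum>L\<in>multipartitions k n. \<Sum>\<sigma>\<in>{\<sigma> \<in> wreath k n. cycle_type k \<sigma> = L}.
      H (cycle_type k \<sigma>) * Pbar (cycle_type k \<sigma>))"
    by (rule sum.group[symmetric]) (use finite_wreath[OF k] finite_multipartitions cycle_type_in[OF k] in auto)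
  also have "\<dots> = (\<Sum>L\<in>multipartitions k n. of_nat (card (conj_class k n L)) * (H L * Pbar L))"
    by (rule sum.cong[OF refl]) (simp add: conj_class_def)
  finally have "fps_nth (frobenius k n (cube_character n)) d =
      (\<Sum>L\<in>multipartitions k n. sconst (1 / ?a) * (of_nat (card (conj_class k n L)) * (H L * Pbar L)))"
    by (simp only: frobenius_nth sum_distrib_left)
  also have "\<dots> = (\<Sum>L\<in>multipartitions k n. H L * (mfps_const (fps_const (1 / Zcoeff k n L)) * Pbar L))"
  proof (rule sum.cong[OF refl])
    fix L
    \<comment> \<open>This also holds for an empty class: \<open>Zcoeff\<close> then divides by
      zero, so it is 0, and both sides vanish.\<close>
    have "1 / Zcoeff k n L = 1 / ?a * of_nat (card (conj_class k n L))" by (simp add: Zcoeff_def)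
    then have "mfps_const (fps_const (1 / Zcoeff k n L)) = sconst (1 / ?a) * of_nat (card (conj_class k n L))"
      by (simp only: sconst_def[symmetric] sconst_simps)
    then show "sconst (1 / ?a) * (of_nat (card (conj_class k n L)) * (H L * Pbar L)) =
        H L * (mfps_const (fps_const (1 / Zcoeff k n L)) * Pbar L)"
      by (simp only: mult_ac)
  qed
  finally show "fps_nth (frobenius k n (cube_character n)) d = (\<Sum>L\<in>multipartitions k n.
      mfps_const (\<Prod>i<k. \<Prod>j<length (L ! i).
        q_int (d + 1) (fps_const (unity_root k i) * fps_X ^ (L ! i ! j))) *
      (mfps_const (fps_const (1 / Zcoeff k n L)) * Pbar L))" unfolding H_def .
qed

section \<open>The average over the wreath product as a sum over words\<close>

abbreviation qs :: symf where
  "qs \<equiv> mfps_const fps_X"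

text \<open>The letter \<open>(f, j, i)\<close> stands for the exponent \<open>f\<close> together with the variable \<open>x\<^bsub>j,i\<^esub>\<close>.\<close>

definition weight :: "nat \<times> nat \<times> nat \<Rightarrow> symf" where
  "weight = (\<lambda>(f, j, i). qs ^ f * xvar j i)"

definition letters :: "nat \<Rightarrow> nat \<Rightarrow> nat \<Rightarrow> (nat \<times> nat \<times> nat) set" where
  "letters k N d = {(f, j, i). f \<le> d \<and> j = f mod k \<and> i < N}"

text \<open>What one position with matrix entry \<open>z\<close> contributes to the character and to
  \<open>Pbar\<close> together: \<open>z ^ f\<close> comes from the action on a monomial, the
  conjugate from the coefficient of the power sum of alphabet \<open>j\<close>.\<close>

definition twist :: "complex \<Rightarrow> nat \<times> nat \<times> nat \<Rightarrow> symf" where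
  "twist z = (\<lambda>(f, j, i). sconst (z ^ f * cnj (z ^ j)) * (qs ^ f * xvar j i))"

text \<open>Both factors are products over the cycles of sums over a common letter, exponents in one
  and variables in the other. Multiplying cycle by cycle gives words in pairs of letters.\<close>

lemma trunc_class_function:
  assumes k: "k > 0" and \<sigma>: "\<sigma> \<in> wreath k n"
  shows "mfps_const (fps_nth (cube_character n \<sigma>) d) * trunc N (Pbar (cycle_type k \<sigma>)) =
    (\<Sum>c | c \<in> {..<n} \<rightarrow>\<^sub>E {..d} \<times> {..<k} \<times> {..<N} \<and> (\<forall>i<n. c (perm_of \<sigma> i) = c i).
      \<Prod>i<n. twist (entry \<sigma> i) (c i))"
proof -
  let ?A = "\<lambda>C. \<Sum>f\<le>d. \<Prod>i\<in>C. (sconst (entry \<sigma> i) * qs) ^ f"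
  let ?B = "\<lambda>C. \<Sum>(j, i)\<in>{..<k} \<times> {..<N}. \<Prod>i'\<in>C. sconst (cnj (entry \<sigma> i' ^ j)) * xvar j i"
  let ?F = "{..d} \<times> {..<k} \<times> {..<N}"
  note perm = perm_of_permutes[OF \<sigma>]
  have "mfps_const (fps_nth (cube_character n \<sigma>) d) =
      (\<Prod>C\<in>cycles_of \<sigma>. ?A C)"
    by (simp add: character_orbits[OF \<sigma>] mfps_const_prod mfps_const_sum mfps_const_power mfps_const_simps sconst_def)
  moreover have "trunc N (Pbar (cycle_type k \<sigma>)) =
      (\<Prod>C\<in>cycles_of \<sigma>. ?B C)"
  proof -
    let ?g = "\<lambda>u c. \<Sum>j<k. sconst (cnj (u ^ j)) * power_sum c j"
    have len: "length (cycle_type k \<sigma>) = k" by (simp add: cycle_type_def)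
    have "Pbar (cycle_type k \<sigma>) = (\<Prod>C\<in>cycles_of \<sigma>. ?g (\<Prod>i\<in>C. entry \<sigma> i) (card C))"
      using prod_cycle_type[OF k \<sigma>, of ?g] by (simp only: Pbar_def len sconst_def)
    then have "trunc N (Pbar (cycle_type k \<sigma>)) = (\<Prod>C\<in>cycles_of \<sigma>. trunc N (?g (\<Prod>i\<in>C. entry \<sigma> i) (card C)))"
      by (simp only: trunc_prod)
    also have "\<dots> = (\<Prod>C\<in>cycles_of \<sigma>. ?B C)"
    proof (rule prod.cong[OF refl])
      fix C assume C: "C \<in> cycles_of \<sigma>"
      then obtain i where "i < n" "C = orbit (perm_of \<sigma>) i" by (auto simp: cycles_of_eq[OF \<sigma>])
      then have "C \<noteq> {}" "finite C"
        using orbit_self[OF perm, of i] orbit_bounded[OF perm, of i] finite_subset by auto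
      then have pos: "card C > 0" by (simp add: card_gt_0_iff)
      have "trunc N (?g (\<Prod>i\<in>C. entry \<sigma> i) (card C)) =
          (\<Sum>j<k. sconst (cnj ((\<Prod>i\<in>C. entry \<sigma> i) ^ j)) * (\<Sum>i<N. xvar j i ^ card C))"
        by (simp only: trunc_sum trunc_mult trunc_power_sum[OF pos] sconst_def trunc_simps)
      also have "\<dots> = (\<Sum>j<k. \<Sum>i<N. \<Prod>i'\<in>C. sconst (cnj (entry \<sigma> i' ^ j)) * xvar j i)"
        by (simp add: sum_distrib_left prod.distrib sconst_prod[symmetric] prod_power_distrib)
      also have "\<dots> = ?B C"
        by (rule sum.cartesian_product)
      finally show "trunc N (?g (\<Prod>i\<in>C. entry \<sigma> i) (card C)) =
          ?B C" .
    qed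
    finally show ?thesis .
  qed
  ultimately have "mfps_const (fps_nth (cube_character n \<sigma>) d) * trunc N (Pbar (cycle_type k \<sigma>)) =
      (\<Prod>C\<in>cycles_of \<sigma>. ?A C *
        ?B C)"
    by (simp only: prod.distrib)
  also have "\<dots> = (\<Prod>C\<in>cycles_of \<sigma>. \<Sum>x\<in>?F. \<Prod>i'\<in>C. twist (entry \<sigma> i') x)"
  proof (rule prod.cong[OF refl])
    fix C
    have "?A C *
        (\<Sum>p\<in>{..<k} \<times> {..<N}. \<Prod>i'\<in>C. sconst (cnj (entry \<sigma> i' ^ fst p)) * xvar (fst p) (snd p)) =
      (\<Sum>(f, p)\<in>?F. (\<Prod>i\<in>C. (sconst (entry \<sigma> i) * qs) ^ f) *
        (\<Prod>i'\<in>C. sconst (cnj (entry \<sigma> i' ^ fst p)) * xvar (fst p) (snd p)))"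
      by (simp only: sum_product sum.cartesian_product)
    also have "\<dots> = (\<Sum>x\<in>?F. \<Prod>i'\<in>C. twist (entry \<sigma> i') x)"
      by (rule sum.cong[OF refl])
        (simp add: twist_def case_prod_unfold prod.distrib[symmetric] power_mult_distrib
           sconst_simps sconst_power mult_ac)
    finally show "?A C *
        ?B C =
        (\<Sum>x\<in>?F. \<Prod>i'\<in>C. twist (entry \<sigma> i') x)"
      by (simp only: case_prod_unfold)
  qed
  also have "\<dots> = (\<Sum>c | c \<in> {..<n} \<rightarrow>\<^sub>E {..d} \<times> {..<k} \<times> {..<N} \<and> (\<forall>i<n. c (perm_of \<sigma> i) = c i).
      \<Prod>i<n. twist (entry \<sigma> i) (c i))"
    unfolding cycles_of_eq[OF \<sigma>] by (rule sum_invariant_words[OF perm, symmetric]) simp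
  finally show ?thesis .
qed

lemma sum_twist:
  assumes k: "k > 0" and x: "x \<in> {..d} \<times> {..<k} \<times> {..<N}"
  shows "(\<Sum>z | z ^ k = 1. twist z x) = (if x \<in> letters k N d then of_nat k * weight x else 0)"
proof -
  obtain f j i where [simp]: "x = (f, j, i)" by (cases x)
  have j: "j < k" "f \<le> d" "i < N" using x by auto
  have "(\<Sum>z | z ^ k = 1. twist z x) = sconst (\<Sum>z | z ^ k = 1. z ^ f * cnj (z ^ j)) * (qs ^ f * xvar j i)"
    by (simp add: twist_def sconst_sum sum_distrib_right)
  also have "\<dots> = (if x \<in> letters k N d then of_nat k * weight x else 0)"
    unfolding sum_roots_power[OF k j(1)]
    using j by (auto simp: letters_def weight_def sconst_simps)
  finally show ?thesis .
qed

lemma finite_letters: "finite (letters k N d)"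
proof (rule finite_subset)
  show "letters k N d \<subseteq> {..d} \<times> (\<lambda>f. f mod k) ` {..d} \<times> {..<N}" by (auto simp: letters_def)
qed simp

text \<open>For a fixed permutation the sum over the diagonal entries leaves the words in
  \<open>letters\<close>, each with a factor \<open>k ^ n\<close>; the sum over permutations gives
  \<open>n!\<close> times the complete homogeneous function. The normalisation cancels both
  factors.\<close>

lemma trunc_frobenius:
  assumes k: "k > 0"
  shows "trunc N (fps_nth (frobenius k n (cube_character n)) d) = hsym (letters k N d) weight n"
proof -
  let ?F = "{..d} \<times> {..<k} \<times> {..<N}" and ?A = "letters k N d"
  let ?P = "{\<pi>. \<pi> permutes {..<n}}" and ?U = "{..<n} \<rightarrow>\<^sub>E {z :: complex. z ^ k = 1}"
  let ?I = "\<lambda>\<pi>. {c. c \<in> {..<n} \<rightarrow>\<^sub>E ?F \<and> (\<forall>i<n. c (\<pi> i) = c i)}"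
  let ?J = "\<lambda>\<pi>. {c. c \<in> {..<n} \<rightarrow>\<^sub>E ?A \<and> (\<forall>i<n. c (\<pi> i) = c i)}"
  let ?w = "\<lambda>c. \<Prod>i<n. if c i \<in> ?A then of_nat k * weight (c i) else 0"
  let ?total = "\<Sum>\<sigma>\<in>wreath k n. mfps_const (fps_nth (cube_character n \<sigma>) d) * trunc N (Pbar (cycle_type k \<sigma>))"
  have sub: "?A \<subseteq> ?F" using k by (auto simp: letters_def)
  have finI: "finite (?I \<pi>)" for \<pi>
    by (rule finite_subset[of _ "{..<n} \<rightarrow>\<^sub>E ?F"]) (auto intro: finite_PiE)
  define G where "G = (\<lambda>(\<pi>, u). \<Sum>c\<in>?I \<pi>. \<Prod>i<n. twist (u i) (c i))"
  have "?total =
      (\<Sum>\<sigma>\<in>wreath k n. G (perm_of \<sigma>, restrict (entry \<sigma>) {..<n}))"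
    by (rule sum.cong[OF refl]) (simp add: trunc_class_function[OF k] G_def)
  also have "\<dots> = (\<Sum>p\<in>?P \<times> ?U. G p)"
    by (rule sum.reindex_bij_betw[OF bij_betw_wreath[OF k]])
  also have "\<dots> = (\<Sum>\<pi>\<in>?P. \<Sum>u\<in>?U. \<Sum>c\<in>?I \<pi>. \<Prod>i<n. twist (u i) (c i))"
    unfolding G_def by (rule sum.cartesian_product[symmetric])
  also have "\<dots> = (\<Sum>\<pi>\<in>?P. \<Sum>c\<in>?J \<pi>. of_nat (k ^ n) * (\<Prod>i<n. weight (c i)))"
  proof (rule sum.cong[OF refl])
    fix \<pi>
    have "(\<Sum>u\<in>?U. \<Sum>c\<in>?I \<pi>. \<Prod>i<n. twist (u i) (c i)) =
        (\<Sum>c\<in>?I \<pi>. \<Sum>u\<in>?U. \<Prod>i<n. twist (u i) (c i))" by (rule sum.swap)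
    \<comment> \<open>The entries of different rows vary independently, so for a fixed word the sum
      factors into one sum over roots per position.\<close>
    also have "\<dots> = (\<Sum>c\<in>?I \<pi>. \<Prod>i<n. \<Sum>z | z ^ k = 1. twist z (c i))"
      by (rule sum.cong[OF refl], rule prod_sum_PiE[symmetric]) (use finite_roots[OF k] in auto)
    also have "\<dots> = (\<Sum>c\<in>?I \<pi>. ?w c)"
    proof (rule sum.cong[OF refl], rule prod.cong[OF refl])
      fix c i assume c: "c \<in> ?I \<pi>" and i: "i \<in> {..<n}"
      have "c \<in> {..<n} \<rightarrow>\<^sub>E ?F" using c by simp
      then have "c i \<in> ?F" using i by (rule PiE_mem)
      then show "(\<Sum>z | z ^ k = 1. twist z (c i)) = (if c i \<in> ?A then of_nat k * weight (c i) else 0)"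
        by (rule sum_twist[OF k])
    qed
    also have "\<dots> = (\<Sum>c\<in>?J \<pi>. of_nat (k ^ n) * (\<Prod>i<n. weight (c i)))"
    proof (rule sum.mono_neutral_cong_right[OF finI])
      show "?J \<pi> \<subseteq> ?I \<pi>" using PiE_mono[of "{..<n}" "\<lambda>_. ?A" "\<lambda>_. ?F"] sub by fast
      show "\<forall>c\<in>?I \<pi> - ?J \<pi>. ?w c = 0"
      proof
        fix c assume c: "c \<in> ?I \<pi> - ?J \<pi>"
        have "\<exists>i<n. c i \<notin> ?A"
        proof (rule ccontr)
          assume "\<not> (\<exists>i<n. c i \<notin> ?A)"
          then have "c \<in> {..<n} \<rightarrow>\<^sub>E ?A" using c by (auto simp: PiE_def Pi_def)
          moreover have "\<forall>i<n. c (\<pi> i) = c i" using DiffD1[OF c] by (elim CollectE conjE)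
          ultimately have "c \<in> ?J \<pi>" by blast
          then show False by (rule DiffD2[OF c])
        qed
        then show "?w c = 0"
          by (intro prod_zero) auto
      qed
      fix c assume "c \<in> ?J \<pi>"
      then have "c i \<in> ?A" if "i < n" for i using that by (auto simp: PiE_def Pi_def)
      then have "?w c = (\<Prod>i<n. of_nat k * weight (c i))"
        by (intro prod.cong) auto
      then show "?w c =
          of_nat (k ^ n) * (\<Prod>i<n. weight (c i))" by (simp add: prod.distrib)
    qed
    finally show "(\<Sum>u\<in>?U. \<Sum>c\<in>?I \<pi>. \<Prod>i<n. twist (u i) (c i)) =
        (\<Sum>c\<in>?J \<pi>. of_nat (k ^ n) * (\<Prod>i<n. weight (c i)))" .
  qed
  also have "\<dots> = of_nat (k ^ n) * (of_nat (fact n) * hsym ?A weight n)"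
    unfolding sum_fixed_words[OF finite_letters, symmetric] by (simp only: sum_distrib_left)
  finally have total: "?total =
      of_nat (k ^ n) * (of_nat (fact n) * hsym ?A weight n)" .
  have "sconst (1 / (fact n * of_nat k ^ n)) * (of_nat (k ^ n) * of_nat (fact n)) =
      sconst (1 / (fact n * of_nat k ^ n) * (of_nat (k ^ n) * of_nat (fact n)))"
    by (simp only: sconst_simps)
  also have "1 / (fact n * of_nat k ^ n) * (of_nat (k ^ n) * of_nat (fact n)) = (1 :: complex)"
    using k by simp
  finally have one: "sconst (1 / (fact n * of_nat k ^ n)) * (of_nat (k ^ n) * of_nat (fact n)) = 1"
    by (simp only: sconst_simps)
  have "trunc N (fps_nth (frobenius k n (cube_character n)) d) =
      sconst (1 / (fact n * of_nat k ^ n)) * (of_nat (k ^ n) * (of_nat (fact n) * hsym ?A weight n))"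
    unfolding frobenius_nth trunc_mult trunc_sum total[symmetric]
    by (simp only: sconst_def trunc_simps)
  then show ?thesis using one by (simp only: mult.assoc[symmetric] mult_1)
qed

text \<open>Multiplying the series distributes the size \<open>n\<close> over the components. The
  induction on \<open>k\<close> splits off the last partition of the tuple.\<close>

lemma prod_partition_series:
  fixes \<phi> :: "nat \<Rightarrow> nat list \<Rightarrow> 'a::comm_ring_1"
  shows "fps_nth (\<Prod>j<k. Abs_fps (\<lambda>m. \<Sum>l\<in>partitions m. \<phi> j l)) n =
    (\<Sum>L\<in>multipartitions k n. \<Prod>j<k. \<phi> j (L ! j))"
proof (induction k arbitrary: n)
  case 0
  have "multipartitions 0 n = (if n = 0 then {[]} else {})" by (auto simp: multipartitions_def)
  then show ?case by simp
next
  case (Suc k)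
  let ?D = "Sigma {0..n} (\<lambda>i. multipartitions k i \<times> partitions (n - i))"
  have "fps_nth (\<Prod>j<Suc k. Abs_fps (\<lambda>m. \<Sum>l\<in>partitions m. \<phi> j l)) n =
      (\<Sum>i=0..n. (\<Sum>L\<in>multipartitions k i. \<Prod>j<k. \<phi> j (L ! j)) * (\<Sum>l\<in>partitions (n - i). \<phi> k l))"
    by (simp add: fps_mult_nth Suc.IH)
  also have "\<dots> = (\<Sum>i=0..n. \<Sum>(L, l)\<in>multipartitions k i \<times> partitions (n - i). (\<Prod>j<k. \<phi> j (L ! j)) * \<phi> k l)"
    by (simp only: sum_product sum.cartesian_product)
  also have "\<dots> = (\<Sum>(i, L, l)\<in>?D. (\<Prod>j<k. \<phi> j (L ! j)) * \<phi> k l)"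
    by (subst sum.Sigma) (use finite_multipartitions finite_partitions in auto)
  also have "\<dots> = (\<Sum>L\<in>multipartitions (Suc k) n. \<Prod>j<Suc k. \<phi> j (L ! j))"
  proof (rule sum.reindex_bij_witness[of _ "\<lambda>L. (sum_list (map sum_list (butlast L)), butlast L, last L)"
        "\<lambda>(i, L, l). L @ [l]"], goal_cases)
    case (1 p)
    then show ?case by (auto simp: multipartitions_def)
  next
    case (2 p)
    then show ?case by (auto simp: multipartitions_def partitions_def)
  next
    case (3 L)
    then have "L \<noteq> []" by (auto simp: multipartitions_def)
    then show ?case by simp
  next
    case (4 L)
    then have ne: "L \<noteq> []" and len: "length L = Suc k" by (auto simp: multipartitions_def)
    have L: "L = butlast L @ [last L]" using ne by simp
    have "sum_list (map sum_list L) = sum_list (map sum_list (butlast L)) + sum_list (last L)"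
      by (subst (1) L) (simp only: map_append sum_list_append list.map sum_list.Cons sum_list.Nil add_0_right)
    moreover have "sum_list (map sum_list L) = n" using 4 by (simp add: multipartitions_def)
    ultimately have s: "n = sum_list (map sum_list (butlast L)) + sum_list (last L)" by simp
    have "\<forall>l\<in>set L. l \<in> partitions (sum_list l)" using 4 by (simp add: multipartitions_def)
    then have "\<forall>l\<in>set (butlast L). l \<in> partitions (sum_list l)" "last L \<in> partitions (sum_list (last L))"
      using ne by (auto dest: in_set_butlastD)
    then show ?case using len s by (simp add: multipartitions_def)
  next
    case (5 p)
    then obtain i L l where p: "p = (i, L, l)" and len: "length L = k" by (auto simp: multipartitions_def)
    have "(\<Prod>j<k. \<phi> j ((L @ [l]) ! j)) = (\<Prod>j<k. \<phi> j (L ! j))"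
      by (rule prod.cong[OF refl]) (simp add: nth_append len)
    then show ?case by (simp add: p nth_append len)
  qed
  finally show ?case .
qed

text \<open>The letters of residue \<open>j\<close> form a rectangle, indexed by the variable and by
  the quotient of the exponent, on which the weight is a product of two factors; the Cauchy identity
  applies to each rectangle.\<close>

lemma hsym_letters:
  assumes k: "k > 0"
  shows "hsym (letters k N d) weight n = (\<Sum>L\<in>multipartitions k n.
    (\<Prod>j<k. schur_eval (L ! j) ((d + k - j) div k) (\<lambda>s. qs ^ (j + k * s))) *
    (\<Prod>j<k. schur_eval (L ! j) N (xvar j)))"
proof -
  let ?M = "\<lambda>j. (d + k - j) div k"
  define A where "A j = (\<lambda>(i, s). (j + k * s, j, i)) ` ({..<N} \<times> {..<?M j})" for j
  have "letters k N d = (\<Union>j<k. A j)"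
  proof (rule Set.set_eqI)
    fix x :: "nat \<times> nat \<times> nat"
    obtain f j i where x: "x = (f, j, i)" by (cases x)
    have "x \<in> (\<Union>j<k. A j) \<longleftrightarrow> j < k \<and> i < N \<and> (\<exists>s. f = j + k * s \<and> s < ?M j)"
      by (auto simp: x A_def image_iff)
    also have "\<dots> \<longleftrightarrow> j < k \<and> i < N \<and> (\<exists>s. f = j + k * s) \<and> f \<le> d"
      using residue_bound[of j k _ d] by auto
    also have "\<dots> \<longleftrightarrow> f \<le> d \<and> j = f mod k \<and> i < N"
    proof -
      have "j < k \<and> (\<exists>s. f = j + k * s) \<longleftrightarrow> j = f mod k"
      proof
        assume "j = f mod k"
        then show "j < k \<and> (\<exists>s. f = j + k * s)"
          using k by (metis mod_less_divisor mod_mult_div_eq)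
      qed auto
      then show ?thesis by auto
    qed
    finally show "x \<in> letters k N d \<longleftrightarrow> x \<in> (\<Union>j<k. A j)" by (simp add: x letters_def)
  qed
  moreover have "A i \<inter> A j = {}" if "i \<noteq> j" for i j using that by (auto simp: A_def)
  moreover have "finite (A j)" for j by (simp add: A_def)
  ultimately have "Abs_fps (hsym (letters k N d) weight) = (\<Prod>j<k. Abs_fps (hsym (A j) weight))"
    using hsym_UN[of "{..<k}" A weight] by simp
  also have "\<dots> = (\<Prod>j<k. Abs_fps (\<lambda>m. \<Sum>l\<in>partitions m.
      schur_eval l (?M j) (\<lambda>s. qs ^ (j + k * s)) * schur_eval l N (xvar j)))"
  proof (rule prod.cong[OF refl], rule arg_cong[of _ _ Abs_fps], rule ext)
    fix j m
    have inj: "inj_on (\<lambda>(i, s). (j + k * s, j, i)) ({..<N} \<times> {..<?M j})"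
      using k by (auto simp: inj_on_def)
    have "hsym (A j) weight m =
        hsym ({..<N} \<times> {..<?M j}) (\<lambda>p. weight ((\<lambda>(i, s). (j + k * s, j, i)) p)) m"
      unfolding A_def by (rule hsym_reindex[OF inj])
    also have "\<dots> = hsym ({..<N} \<times> {..<?M j}) (\<lambda>(i, s). xvar j i * qs ^ (j + k * s)) m"
      by (rule hsym_cong) (auto simp: weight_def mult.commute)
    also have "\<dots> = (\<Sum>l\<in>partitions m. schur_eval l N (xvar j) * schur_eval l (?M j) (\<lambda>s. qs ^ (j + k * s)))"
      by (rule cauchy_identity[symmetric])
    finally show "hsym (A j) weight m = (\<Sum>l\<in>partitions m.
        schur_eval l (?M j) (\<lambda>s. qs ^ (j + k * s)) * schur_eval l N (xvar j))"
      by (simp only: mult.commute)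
  qed
  finally have "hsym (letters k N d) weight n = fps_nth (\<Prod>j<k. Abs_fps (\<lambda>m. \<Sum>l\<in>partitions m.
      schur_eval l (?M j) (\<lambda>s. qs ^ (j + k * s)) * schur_eval l N (xvar j))) n"
    by (metis fps_nth_Abs_fps)
  then show ?thesis
    using prod_partition_series[of "\<lambda>j l. schur_eval l (?M j) (\<lambda>s. qs ^ (j + k * s)) * schur_eval l N (xvar j)" k n]
    by (simp only: prod.distrib)
qed

lemma mfps_const_schur_eval: "mfps_const (schur_eval l N y) = schur_eval l N (\<lambda>s. mfps_const (y s))"
  by (simp add: schur_eval_def mfps_const_sum mfps_const_prod)

text \<open>Both sides agree after every truncation. The coefficients involve only \<open>q\<close>
  and are constants for \<open>trunc\<close>, which therefore acts on the Schur functions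
  alone.\<close>

lemma frobenius_schur_expansion:
  assumes k: "k > 0"
  shows "fps_nth (frobenius k n (cube_character n)) d = (\<Sum>L\<in>multipartitions k n.
    (\<Prod>j<k. schur_eval (L ! j) ((d + k - j) div k) (\<lambda>s. qs ^ (j + k * s))) * schur_multi L)"
proof (rule trunc_eqI)
  fix N
  have const: "trunc N (\<Prod>j<k. schur_eval (L ! j) (M j) (\<lambda>s. qs ^ (j + k * s))) =
      (\<Prod>j<k. schur_eval (L ! j) (M j) (\<lambda>s. qs ^ (j + k * s)))" for L M
    by (simp only: mfps_const_power[symmetric] mfps_const_schur_eval[symmetric] mfps_const_prod[symmetric] trunc_simps)
  have multi: "trunc N (schur_multi L) = (\<Prod>j<k. schur_eval (L ! j) N (xvar j))" if "L \<in> multipartitions k n" for L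
    using that by (simp add: schur_multi_def multipartitions_def trunc_prod trunc_schur)
  show "trunc N (fps_nth (frobenius k n (cube_character n)) d) = trunc N (\<Sum>L\<in>multipartitions k n.
      (\<Prod>j<k. schur_eval (L ! j) ((d + k - j) div k) (\<lambda>s. qs ^ (j + k * s))) * schur_multi L)"
    unfolding trunc_frobenius[OF k] hsym_letters[OF k] trunc_sum trunc_mult const
    by (rule sum.cong[OF refl]) (simp only: multi)
qed

section \<open>The quotient formulas\<close>

lemma fps_prod_nth_0:
  assumes "\<And>x. x \<in> A \<Longrightarrow> fps_nth (f x) 0 = (1 :: 'a::comm_ring_1)"
  shows "fps_nth (\<Prod>x\<in>A. f x) 0 = 1"
  using assms by (induction A rule: infinite_finite_induct) auto

text \<open>The coefficients form a ring without general division, so quotients are verified by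
  multiplying out; the constant term 1 makes the denominator a unit.\<close>

lemma fps_mfps_eq_divide:
  fixes f g h :: "('i, 'a::comm_ring_1) mfps fps"
  assumes g: "fps_nth g 0 = 1" and eq: "h * g = f"
  shows "h = f / g"
proof -
  have inv: "g * inverse g = 1"
    unfolding fps_inverse_def by (rule fps_right_inverse) (simp add: g)
  have "h = h * g * inverse g" by (simp add: mult.assoc inv)
  also have "\<dots> = f / g * g * inverse g" by (simp add: eq fps_divide_mfps[OF g])
  also have "\<dots> = f / g" by (simp add: mult.assoc inv)
  finally show ?thesis .
qed

lemma frobenius_quotient:
  assumes k: "k > 0" and n: "n \<ge> 1"
  shows "frobenius k n (cube_character n) =
    (\<Sum>L\<in>multipartitions k n. \<Sum>S\<in>SYT L. tvar ^ wdes L S * qvar ^ wcomaj L S * fps_const (schur_multi L)) /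
    ((1 - tvar) * (\<Prod>j=1..n. 1 - tvar ^ k * qvar ^ (k * j)))"
proof (rule fps_mfps_eq_divide)
  let ?D = "(1 - tvar) * (\<Prod>j=1..n. 1 - tvar ^ k * qvar ^ (k * j))"
  show "fps_nth ?D 0 = 1"
    using k by (simp add: fps_prod_nth_0)
  let ?f = "\<lambda>L. Abs_fps (\<lambda>r. \<Prod>i<k. schur_eval (L ! i) ((r + k - i) div k) (\<lambda>s. qs ^ (i + k * s)))"
  have "frobenius k n (cube_character n) = (\<Sum>L\<in>multipartitions k n. ?f L * fps_const (schur_multi L))"
    by (rule fps_ext) (simp add: frobenius_schur_expansion[OF k] fps_sum_nth)
  then have "frobenius k n (cube_character n) * ?D =
      (\<Sum>L\<in>multipartitions k n. (?f L * ?D) * fps_const (schur_multi L))"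
    by (simp only: sum_distrib_right mult.assoc mult.commute[of "fps_const _"])
  also have "\<dots> = (\<Sum>L\<in>multipartitions k n. (\<Sum>S\<in>SYT L. tvar ^ wdes L S * qvar ^ wcomaj L S) * fps_const (schur_multi L))"
  proof (rule sum.cong[OF refl])
    fix L assume L: "L \<in> multipartitions k n"
    have "?f L * ?D = (\<Sum>S\<in>SYT L. tvar ^ wdes L S * qvar ^ wcomaj L S)"
      using schur_product_series[of k L n qs] L k n
      by (simp only: multipartitions_def mem_Collect_eq fps_const_power)
    then show "(?f L * ?D) * fps_const (schur_multi L) =
        (\<Sum>S\<in>SYT L. tvar ^ wdes L S * qvar ^ wcomaj L S) * fps_const (schur_multi L)" by (simp only:)
  qed
  finally show "frobenius k n (cube_character n) * ?D = (\<Sum>L\<in>multipartitions k n. \<Sum>S\<in>SYT L.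
      tvar ^ wdes L S * qvar ^ wcomaj L S * fps_const (schur_multi L))"
    by (simp only: sum_distrib_right)
qed

section \<open>The case of one alphabet\<close>

lemma multipartitions_1: "multipartitions 1 n = (\<lambda>l. [l]) ` partitions n"
proof
  show "multipartitions 1 n \<subseteq> (\<lambda>l. [l]) ` partitions n"
    by (auto simp: multipartitions_def length_Suc_conv)
  show "(\<lambda>l. [l]) ` partitions n \<subseteq> multipartitions 1 n"
    by (auto simp: multipartitions_def partitions_def)
qed

lemma sum_multipartitions_1: "(\<Sum>L\<in>multipartitions 1 n. f L) = (\<Sum>l\<in>partitions n. f [l])"
  unfolding multipartitions_1 by (subst sum.reindex) (auto simp: inj_on_def)

lemma schur_multi_single: "schur_multi [l] = schur l 0"
  by (simp add: schur_multi_def)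

lemma frobenius_schur_single:
  "frobenius 1 n (cube_character n) = Abs_fps (\<lambda>i. \<Sum>l\<in>partitions n.
    mfps_const (schur_eval l (i + 1) (\<lambda>j. fps_X ^ j)) * schur l 0)"
  by (rule fps_ext)
    (simp add: frobenius_schur_expansion sum_multipartitions_1[unfolded One_nat_def] schur_multi_single
       mfps_const_schur_eval mfps_const_power)

lemma frobenius_quotient_single:
  assumes n: "n \<ge> 1"
  shows "frobenius 1 n (cube_character n) =
    (\<Sum>l\<in>partitions n. \<Sum>S\<in>SYT [l]. tvar ^ des l S * qvar ^ comaj l S * fps_const (schur l 0)) /
    (\<Prod>j=0..n. 1 - tvar * qvar ^ j)"
proof -
  have num: "(\<Sum>L\<in>multipartitions 1 n. \<Sum>S\<in>SYT L. tvar ^ wdes L S * qvar ^ wcomaj L S * fps_const (schur_multi L)) =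
      (\<Sum>l\<in>partitions n. \<Sum>S\<in>SYT [l]. tvar ^ des l S * qvar ^ comaj l S * fps_const (schur l 0))"
    unfolding sum_multipartitions_1
  proof (rule sum.cong[OF refl], rule sum.cong[OF refl])
    fix l S assume l: "l \<in> partitions n" and S: "S \<in> SYT [l]"
    have "sum_list l \<ge> 1" using l n by (simp add: partitions_def)
    then show "tvar ^ wdes [l] S * qvar ^ wcomaj [l] S * fps_const (schur_multi [l]) =
        tvar ^ des l S * qvar ^ comaj l S * fps_const (schur l 0)"
      by (simp only: wdes_single[OF S] wcomaj_single[OF S] schur_multi_single)
  qed
  \<comment> \<open>The separate factor \<open>1 - t\<close> supplies the index
    \<open>j = 0\<close>.\<close>
  have den: "(1 - tvar) * (\<Prod>j=1..n. 1 - tvar ^ 1 * qvar ^ (1 * j)) = (\<Prod>j=0..n. 1 - tvar * qvar ^ j)"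
    by (simp add: prod.atLeast_Suc_atMost)
  show ?thesis using frobenius_quotient[of 1 n] n unfolding num den by simp
qed

theorem theorem5p25:
  shows
    "(\<forall>k n. k \<ge> 1 \<and> n \<ge> 1 \<longrightarrow>
       frobenius k n (cube_character n) =
         Abs_fps (\<lambda>r. \<Sum>L\<in>multipartitions k n.
           mfps_const (\<Prod>i<k. \<Prod>j<length (L ! i).
               q_int (r + 1) (fps_const (unity_root k i) * fps_X ^ (L ! i ! j))) *
           (mfps_const (fps_const (1 / Zcoeff k n L)) * Pbar L)) \<and>
       Abs_fps (\<lambda>r. \<Sum>L\<in>multipartitions k n.
           mfps_const (\<Prod>i<k. \<Prod>j<length (L ! i).
               q_int (r + 1) (fps_const (unity_root k i) * fps_X ^ (L ! i ! j))) *
           (mfps_const (fps_const (1 / Zcoeff k n L)) * Pbar L)) =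
         (\<Sum>L\<in>multipartitions k n. \<Sum>S\<in>SYT L.
             tvar ^ wdes L S * qvar ^ wcomaj L S * fps_const (schur_multi L)) /
         ((1 - tvar) * (\<Prod>j=1..n. 1 - tvar ^ k * qvar ^ (k * j)))) \<and>
     (\<forall>n. n \<ge> 1 \<longrightarrow>
       frobenius 1 n (cube_character n) =
         Abs_fps (\<lambda>i. \<Sum>l\<in>partitions n.
           mfps_const (schur_eval l (i + 1) (\<lambda>j. fps_X ^ j)) * schur l 0) \<and>
       Abs_fps (\<lambda>i. \<Sum>l\<in>partitions n.
           mfps_const (schur_eval l (i + 1) (\<lambda>j. fps_X ^ j)) * schur l 0) =
         (\<Sum>l\<in>partitions n. \<Sum>S\<in>SYT [l].
             tvar ^ des l S * qvar ^ comaj l S * fps_const (schur l 0)) /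
         (\<Prod>j=0..n. 1 - tvar * qvar ^ j))"
  apply (rule conjI; intro allI impI conjI)
  subgoal by (rule frobenius_by_classes) simp
  subgoal by (rule trans[OF frobenius_by_classes[symmetric] frobenius_quotient]) simp_all
  subgoal by (rule frobenius_schur_single)
  subgoal by (rule trans[OF frobenius_schur_single[symmetric] frobenius_quotient_single])
  done

end
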